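(* Let $\mathfrak{A}/_{\cong}$ denote the equivalence classes of crystallographic arrangements (of arbitrary rank $r\ge 1$), and let $\mathfrak{C}/_{\cong}$ denote the equivalence classes of connected simply connected Cartan schemes $\mathcal{C}$ for which the real roots form a finite root system of type $\mathcal{C}$. Then the assignment $$\Lambda:\mathfrak{A}/_{\cong}\longrightarrow\mathfrak{C}/_{\cong},\qquad \overline{(\mathcal{A},R)}\longmapsto\overline{\mathcal{C}(\mathcal{A},R,K)},$$ where $K$ is any chamber of $\mathcal{A}$, is a well-defined bijection. In particular: (1) If $(\mathcal{A},R)$ is a crystallographic arrangement, then $R$ is the set of real roots at some object of a connected Cartan scheme, i.e. there are a connected Cartan scheme $\mathcal{C}$ with index set $I$, an object $a$ of $\mathcal{C}$, and a linear isomorphism $V^*\to\mathbb{R}^I$ mapping $R$ onto $(R^{\mathrm{re}})^a\subseteq\mathbb{Z}^I\subseteq\mathbb{R}^I$. (2) For every connected simply connected Cartan scheme $\mathcal{C}$ for which the real roots are a finite root system there is, up to equivalence, a unique crystallographic arrangement $(\mathcal{A},R)$ such that $\mathcal{C}\cong\mathcal{C}(\mathcal{A},R,K)$ for a chamber $K$ of $\mathcal{A}$.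
   Context: **Crystallographic arrangements.** Let $r\ge 1$, $V=\mathbb{R}^r$, $V^*$ its dual; for $\alpha\in V^*$ write $\alpha^\perp=\ker\alpha$. A simplicial arrangement in $V$ is a finite set $\mathcal{A}$ of linear hyperplanes in $V$ such that every connected component of $V\setminus\bigcup_{H\in\mathcal{A}}H$ is an open simplicial cone, i.e. of the form $\{\sum_i a_iv_i\mid a_i>0\}$ for a basis $v_1,\dots,v_r$ of $V$. These components are the chambers; $\mathcal{K}(\mathcal{A})$ is the set of chambers. Let $R\subseteq V^*$ be a finite set with $\mathcal{A}=\{\alpha^\perp\mid\alpha\in R\}$ and $\mathbb{R}\alpha\cap R=\{\pm\alpha\}$ for all $\alpha\in R$. For a chamber $K$ with closure $\overline K$ let $W^K=\{H\in\mathcal{A}\mid\dim(H\cap\overline K)=r-1\}$ (dimension of the linear span; the walls of $K$) and $B^K=\{\alpha\in R\mid\alpha^\perp\in W^K,\ \alpha\ge 0\text{ on }K\}$, a basis of $V^*$. The pair $(\mathcal{A},R)$ is a crystallographic arrangement if $R\subseteq\sum_{\alpha\in B^K}\mathbb{Z}\alpha$ for all chambers $K$. Two crystallographic arrangements $(\mathcal{A},R),(\mathcal{A}',R')$ in $V$ are equivalent if there is $\psi\in\mathrm{Aut}(V^* )$ with $\psi(R)=R'$ (arrangements in spaces of different dimension are not equivalent). **Chains of chambers.** Let $(\mathcal{A},R)$ be crystallographic. Distinct chambers $K,K'$ are adjacent, with common wall $\alpha^\perp$ ($\alpha\in B^K$), if $\overline K\cap\overline{K'}$ spans $\alpha^\perp$.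 In this case there are unique $c_\beta\in\mathbb{N}_0$ ($\beta\in B^K\setminus\{\alpha\}$) such that $\varphi_{K,K'}:B^K\to B^{K'}$, $\alpha\mapsto-\alpha$, $\beta\mapsto c_\beta\alpha+\beta$, is a bijection. Fix a chamber $K_0$ and an ordering $B^{K_0}=\{\alpha_1,\dots,\alpha_r\}$; put $I=\{1,\dots,r\}$. A sequence $a=(\mu_1,\dots,\mu_m)$ in $I$ determines a chain $K_0,K_1,\dots,K_m$: $K_i$ is the chamber adjacent to $K_{i-1}$ with common wall $\big(\varphi_{K_{i-2},K_{i-1}}\cdots\varphi_{K_0,K_1}(\alpha_{\mu_i})\big)^\perp$. Set $\varphi_a=\varphi_{K_{m-1},K_m}\cdots\varphi_{K_0,K_1}:B^{K_0}\to B^{K_m}$, and let $\pi(a)\in\mathrm{End}(V^* )$ be the linear extension of $\varphi_a$. **The Cartan scheme $\mathcal{C}(\mathcal{A},R,K_0)$.** Let $\hat A$ be the set of all finite sequences in $I$, $a\sim b$ iff $\pi(a)=\pi(b)$, and $A=\hat A/_\sim$. For $a=(\mu_1,\dots,\mu_m)$ and $i\in I$ let $a.i=(\mu_1,\dots,\mu_m,i)$, and let $\rho_i:A\to A$, $\overline a\mapsto\overline{a.i}$. Let $C^a=(c^a_{ij})_{i,j\in I}$ be the integer matrix defined by $\varphi_{a.i}(\alpha_j)=-c^a_{ij}\varphi_a(\alpha_i)+\varphi_a(\alpha_j)$; it depends only on the class of $a$. Then $\mathcal{C}(\mathcal{A},R,K_0)$ is the Cartan scheme $(I,A,(\rho_i)_{i\in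 I},(C^a)_{a\in A})$; a different ordering of $B^{K_0}$ yields an equivalent Cartan scheme. **Cartan schemes.** Let $I$ be a non-empty finite set and $\{e_i\}_{i\in I}$ the standard basis of $\mathbb{Z}^I$. A generalized Cartan matrix is $C=(c_{ij})\in\mathbb{Z}^{I\times I}$ with (M1) $c_{ii}=2$ and $c_{jk}\le 0$ for $j\ne k$; (M2) $c_{ij}=0\Rightarrow c_{ji}=0$. A Cartan scheme $\mathcal{C}(I,A,(\rho_i)_{i\in I},(C^a)_{a\in A})$ consists of such an $I$, a non-empty set $A$ (the objects), maps $\rho_i:A\to A$ and generalized Cartan matrices $C^a=(c^a_{jk})\in\mathbb{Z}^{I\times I}$ with (C1) $\rho_i^2=\mathrm{id}$; (C2) $c^a_{ij}=c^{\rho_i(a)}_{ij}$ for all $a\in A$, $i,j\in I$. Let $\sigma_i^a\in\mathrm{Aut}(\mathbb{Z}^I)$, $\sigma_i^a(e_j)=e_j-c^a_{ij}e_i$. The Weyl groupoid $\mathcal{W}(\mathcal{C})$ is the category with object set $A$ whose morphisms are the compositions of the maps $\sigma_i^a$, regarded as elements of $\mathrm{Hom}(a,\rho_i(a))$. $\mathcal{C}$ is connected if $\mathrm{Hom}(a,b)\neq\emptyset$ for all $a,b\in A$, and simply connected if $\mathrm{Hom}(a,a)=\{\mathrm{id}_a\}$ for all $a\in A$. Two Cartan schemes $\mathcal{C},\mathcal{C}'$ are equivalent ($\mathcal{C}\cong\mathcal{C}'$) if there are bijections $\varphi_0:I\to I'$, $\varphi_1:A\to A'$ with $\varphi_1(\rho_i(a))=\rho'_{\varphi_0(i)}(\varphi_1(a))$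 and $c'^{\,\varphi_1(a)}_{\varphi_0(i)\varphi_0(j)}=c^a_{ij}$ for all $i,j\in I$, $a\in A$. **Real roots and root systems.** For $a\in A$ the set $(R^{\mathrm{re}})^a\subseteq\mathbb{Z}^I$ of real roots at $a$ is the set of all $w(e_j)$ with $j\in I$ and $w$ a morphism of $\mathcal{W}(\mathcal{C})$ with target $a$. A family $(R^a)_{a\in A}$ of subsets of $\mathbb{Z}^I$ is a root system of type $\mathcal{C}$ if, with $R^a_+=R^a\cap\mathbb{N}_0^I$ and $m^a_{i,j}=|R^a\cap(\mathbb{N}_0e_i+\mathbb{N}_0e_j)|$: (R1) $R^a=R^a_+\cup-R^a_+$; (R2) $R^a\cap\mathbb{Z}e_i=\{e_i,-e_i\}$; (R3) $\sigma_i^a(R^a)=R^{\rho_i(a)}$; (R4) if $i\ne j$ and $m^a_{i,j}$ is finite then $(\rho_i\rho_j)^{m^a_{i,j}}(a)=a$; for all $a\in A$, $i,j\in I$. It is finite if every $R^a$ is finite. "The real roots form a finite root system" means that $((R^{\mathrm{re}})^a)_{a\in A}$ is a finite root system of type $\mathcal{C}$. *)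

theory Defs
  imports "HOL-Analysis.Analysis" "HOL-Library.Function_Algebras"
begin

section \<open>The ambient spaces\<close>

text \<open>
  The rank \<open>r\<close> varies inside the statement, so \<open>V = \<real>\<^sup>r\<close> is the carrier of the library topology
  \<^const>\<open>Euclidean_space\<close>, i.e. the functions \<open>nat \<Rightarrow> real\<close> vanishing at all indices \<open>\<ge> r\<close>.
  The pointwise vector space structure on functions makes the library notions
  \<^const>\<open>span\<close>, \<^const>\<open>dim\<close>, \<^const>\<open>independent\<close>, \<^const>\<open>subspace\<close> and \<^const>\<open>linear\<close> available.
\<close>

instantiation "fun" :: (type, real_vector) real_vector
begin

definition scaleR_fun :: "real \<Rightarrow> ('a \<Rightarrow> 'b) \<Rightarrow> 'a \<Rightarrow> 'b"
  where "scaleR_fun c f = (\<lambda>x. c *\<^sub>R f x)"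

instance
  by standard (auto simp: scaleR_fun_def fun_eq_iff scaleR_add_right scaleR_add_left)

end

abbreviation Rn :: "nat \<Rightarrow> (nat \<Rightarrow> real) set"
  where "Rn r \<equiv> topspace (Euclidean_space r)"

text \<open>
  The dual \<open>V\<^sup>*\<close> is identified with \<^term>\<open>Rn r\<close> by means of the dual of the standard basis:
  \<open>\<alpha>\<close> stands for the linear form \<^term>\<open>pairing r \<alpha>\<close>.
\<close>

definition pairing :: "nat \<Rightarrow> (nat \<Rightarrow> real) \<Rightarrow> (nat \<Rightarrow> real) \<Rightarrow> real"
  where "pairing r \<alpha> x = (\<Sum>i<r. \<alpha> i * x i)"

definition perp :: "nat \<Rightarrow> (nat \<Rightarrow> real) \<Rightarrow> (nat \<Rightarrow> real) set"
  where "perp r \<alpha> = {x \<in> Rn r. pairing r \<alpha> x = 0}"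

text \<open>
  Linear isomorphisms between subspaces.  Every linear map on a subspace extends linearly to the
  whole type, so asking \<open>f\<close> to be linear everywhere is no restriction.
\<close>

definition linear_iso :: "'a::real_vector set \<Rightarrow> 'b::real_vector set \<Rightarrow> ('a \<Rightarrow> 'b) \<Rightarrow> bool"
  where "linear_iso U W f \<longleftrightarrow> linear f \<and> bij_betw f U W"


section \<open>Crystallographic arrangements\<close>

definition chambers :: "nat \<Rightarrow> (nat \<Rightarrow> real) set set \<Rightarrow> (nat \<Rightarrow> real) set set"
  where "chambers r \<A> =
    connected_components_of (subtopology (Euclidean_space r) (Rn r - \<Union>\<A>))"

definition hyperplane :: "nat \<Rightarrow> (nat \<Rightarrow> real) set \<Rightarrow> bool"
  where "hyperplane r H \<longleftrightarrow> H \<subseteq> Rn r \<and> subspace H \<and> dim H = r - 1"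

definition open_simplicial_cone :: "nat \<Rightarrow> (nat \<Rightarrow> real) set \<Rightarrow> bool"
  where "open_simplicial_cone r K \<longleftrightarrow>
    (\<exists>B. finite B \<and> independent B \<and> span B = Rn r \<and>
         K = {(\<Sum>v\<in>B. a v *\<^sub>R v) | a :: (nat \<Rightarrow> real) \<Rightarrow> real. \<forall>v\<in>B. a v > 0})"

definition simplicial_arrangement :: "nat \<Rightarrow> (nat \<Rightarrow> real) set set \<Rightarrow> bool"
  where "simplicial_arrangement r \<A> \<longleftrightarrow>
    finite \<A> \<and> (\<forall>H\<in>\<A>. hyperplane r H) \<and> (\<forall>K\<in>chambers r \<A>. open_simplicial_cone r K)"

definition walls :: "nat \<Rightarrow> (nat \<Rightarrow> real) set set \<Rightarrow> (nat \<Rightarrow> real) set \<Rightarrow> (nat \<Rightarrow> real) set set"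
  where "walls r \<A> K = {H \<in> \<A>. dim (H \<inter> (Euclidean_space r closure_of K)) = r - 1}"

definition chamber_basis ::
    "nat \<Rightarrow> (nat \<Rightarrow> real) set set \<Rightarrow> (nat \<Rightarrow> real) set \<Rightarrow> (nat \<Rightarrow> real) set \<Rightarrow> (nat \<Rightarrow> real) set"
  where "chamber_basis r \<A> R K =
    {\<alpha> \<in> R. perp r \<alpha> \<in> walls r \<A> K \<and> (\<forall>x\<in>K. pairing r \<alpha> x \<ge> 0)}"

definition int_span :: "'a::real_vector set \<Rightarrow> 'a set"
  where "int_span B = {(\<Sum>\<beta>\<in>B. of_int (c \<beta>) *\<^sub>R \<beta>) | c :: 'a \<Rightarrow> int. True}"

definition crystallographic ::
    "nat \<Rightarrow> (nat \<Rightarrow> real) set set \<Rightarrow> (nat \<Rightarrow> real) set \<Rightarrow> bool"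
  where "crystallographic r \<A> R \<longleftrightarrow>
    r \<ge> 1 \<and> simplicial_arrangement r \<A> \<and>
    finite R \<and> R \<subseteq> Rn r \<and> \<A> = perp r ` R \<and>
    (\<forall>\<alpha>\<in>R. range (\<lambda>t. t *\<^sub>R \<alpha>) \<inter> R = {\<alpha>, - \<alpha>}) \<and>
    (\<forall>K\<in>chambers r \<A>. R \<subseteq> int_span (chamber_basis r \<A> R K))"

type_synonym arrangement = "nat \<times> (nat \<Rightarrow> real) set set \<times> (nat \<Rightarrow> real) set"

definition arrangement_class :: "arrangement set"
  where "arrangement_class = {(r, \<A>, R). crystallographic r \<A> R}"

definition arrangement_equiv :: "arrangement \<Rightarrow> arrangement \<Rightarrow> bool"
  where "arrangement_equiv = (\<lambda>(r, \<A>, R) (r', \<A>', R').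
    r = r' \<and> (\<exists>\<psi>. linear_iso (Rn r) (Rn r) \<psi> \<and> \<psi> ` R = R'))"

definition arrangement_rel :: "(arrangement \<times> arrangement) set"
  where "arrangement_rel =
    {(X, Y). X \<in> arrangement_class \<and> Y \<in> arrangement_class \<and> arrangement_equiv X Y}"


section \<open>Chains of chambers\<close>

definition adjacent ::
    "nat \<Rightarrow> (nat \<Rightarrow> real) set \<Rightarrow> (nat \<Rightarrow> real) set \<Rightarrow> (nat \<Rightarrow> real) set \<Rightarrow> bool"
  where "adjacent r K K' H \<longleftrightarrow>
    K \<noteq> K' \<and> span ((Euclidean_space r closure_of K) \<inter> (Euclidean_space r closure_of K')) = H"

definition transition ::
    "nat \<Rightarrow> (nat \<Rightarrow> real) set set \<Rightarrow> (nat \<Rightarrow> real) set \<Rightarrow>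
     (nat \<Rightarrow> real) set \<Rightarrow> (nat \<Rightarrow> real) set \<Rightarrow> (nat \<Rightarrow> real) \<Rightarrow> (nat \<Rightarrow> real)"
  where "transition r \<A> R K K' =
    (THE f. f \<in> extensional (chamber_basis r \<A> R K) \<and>
            bij_betw f (chamber_basis r \<A> R K) (chamber_basis r \<A> R K') \<and>
            (\<exists>\<alpha> \<in> chamber_basis r \<A> R K. adjacent r K K' (perp r \<alpha>) \<and> f \<alpha> = - \<alpha> \<and>
               (\<forall>\<beta> \<in> chamber_basis r \<A> R K - {\<alpha>}. \<exists>c::nat. f \<beta> = real c *\<^sub>R \<alpha> + \<beta>)))"

definition next_chamber ::
    "nat \<Rightarrow> (nat \<Rightarrow> real) set set \<Rightarrow> (nat \<Rightarrow> real) set \<Rightarrow> (nat \<Rightarrow> real) set \<Rightarrow> (nat \<Rightarrow> real) set"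
  where "next_chamber r \<A> K H = (THE K'. K' \<in> chambers r \<A> \<and> adjacent r K K' H)"

text \<open>
  The ordering \<open>\<alpha>\<^sub>1, \<dots>, \<alpha>\<^sub>r\<close> of the basis is a function \<open>\<alpha>\<close> on \<open>{1..r}\<close>.  The chain determined
  by a sequence is built from left to right; its value is the pair of the last chamber \<open>K\<^sub>m\<close> and
  the map \<open>\<phi>\<^sub>a\<close>, which is only meaningful on the basis at \<open>K\<^sub>0\<close>.
\<close>

definition basis_ordering ::
    "nat \<Rightarrow> (nat \<Rightarrow> real) set set \<Rightarrow> (nat \<Rightarrow> real) set \<Rightarrow> (nat \<Rightarrow> real) set \<Rightarrow>
     (nat \<Rightarrow> nat \<Rightarrow> real) \<Rightarrow> bool"
  where "basis_ordering r \<A> R K \<alpha> \<longleftrightarrow> bij_betw \<alpha> {1..r} (chamber_basis r \<A> R K)"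

definition chain ::
    "nat \<Rightarrow> (nat \<Rightarrow> real) set set \<Rightarrow> (nat \<Rightarrow> real) set \<Rightarrow> (nat \<Rightarrow> real) set \<Rightarrow>
     (nat \<Rightarrow> nat \<Rightarrow> real) \<Rightarrow> nat list \<Rightarrow> (nat \<Rightarrow> real) set \<times> ((nat \<Rightarrow> real) \<Rightarrow> (nat \<Rightarrow> real))"
  where "chain r \<A> R K\<^sub>0 \<alpha> a =
    foldl (\<lambda>(K, f) i. let K' = next_chamber r \<A> K (perp r (f (\<alpha> i)))
                      in (K', transition r \<A> R K K' \<circ> f)) (K\<^sub>0, id) a"

definition phi ::
    "nat \<Rightarrow> (nat \<Rightarrow> real) set set \<Rightarrow> (nat \<Rightarrow> real) set \<Rightarrow> (nat \<Rightarrow> real) set \<Rightarrow>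
     (nat \<Rightarrow> nat \<Rightarrow> real) \<Rightarrow> nat list \<Rightarrow> (nat \<Rightarrow> real) \<Rightarrow> (nat \<Rightarrow> real)"
  where "phi r \<A> R K\<^sub>0 \<alpha> a = snd (chain r \<A> R K\<^sub>0 \<alpha> a)"

text \<open>
  \<^const>\<open>construct\<close> extends a map linearly from an independent set; only the values of the result
  on \<open>V\<^sup>*\<close> matter.
\<close>

definition chain_endo ::
    "nat \<Rightarrow> (nat \<Rightarrow> real) set set \<Rightarrow> (nat \<Rightarrow> real) set \<Rightarrow> (nat \<Rightarrow> real) set \<Rightarrow>
     (nat \<Rightarrow> nat \<Rightarrow> real) \<Rightarrow> nat list \<Rightarrow> (nat \<Rightarrow> real) \<Rightarrow> (nat \<Rightarrow> real)"
  where "chain_endo r \<A> R K\<^sub>0 \<alpha> a =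
    construct (chamber_basis r \<A> R K\<^sub>0) (phi r \<A> R K\<^sub>0 \<alpha> a)"

definition seq_rel ::
    "nat \<Rightarrow> (nat \<Rightarrow> real) set set \<Rightarrow> (nat \<Rightarrow> real) set \<Rightarrow> (nat \<Rightarrow> real) set \<Rightarrow>
     (nat \<Rightarrow> nat \<Rightarrow> real) \<Rightarrow> (nat list \<times> nat list) set"
  where "seq_rel r \<A> R K\<^sub>0 \<alpha> =
    {(a, b). a \<in> lists {1..r} \<and> b \<in> lists {1..r} \<and>
             (\<forall>x\<in>Rn r. chain_endo r \<A> R K\<^sub>0 \<alpha> a x = chain_endo r \<A> R K\<^sub>0 \<alpha> b x)}"


section \<open>Cartan schemes\<close>

record ('i, 'a) cartan_data =
  idx :: "'i set"
  objs :: "'a set"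
  rho :: "'i \<Rightarrow> 'a \<Rightarrow> 'a"
  cart :: "'a \<Rightarrow> 'i \<Rightarrow> 'i \<Rightarrow> int"

definition generalized_cartan_matrix :: "'i set \<Rightarrow> ('i \<Rightarrow> 'i \<Rightarrow> int) \<Rightarrow> bool"
  where "generalized_cartan_matrix I c \<longleftrightarrow>
    (\<forall>i\<in>I. c i i = 2) \<and>
    (\<forall>j\<in>I. \<forall>k\<in>I. j \<noteq> k \<longrightarrow> c j k \<le> 0) \<and>
    (\<forall>i\<in>I. \<forall>j\<in>I. c i j = 0 \<longrightarrow> c j i = 0)"

definition cartan_scheme :: "('i, 'a) cartan_data \<Rightarrow> bool"
  where "cartan_scheme C \<longleftrightarrow>
    finite (idx C) \<and> idx C \<noteq> {} \<and> objs C \<noteq> {} \<and>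
    (\<forall>i\<in>idx C. \<forall>a\<in>objs C. rho C i a \<in> objs C) \<and>
    (\<forall>a\<in>objs C. generalized_cartan_matrix (idx C) (cart C a)) \<and>
    (\<forall>i\<in>idx C. \<forall>a\<in>objs C. rho C i (rho C i a) = a) \<and>
    (\<forall>a\<in>objs C. \<forall>i\<in>idx C. \<forall>j\<in>idx C. cart C a i j = cart C (rho C i a) i j)"

definition cartan_equiv :: "('i, 'a) cartan_data \<Rightarrow> ('j, 'b) cartan_data \<Rightarrow> bool"
  where "cartan_equiv C C' \<longleftrightarrow>
    (\<exists>f g. bij_betw f (idx C) (idx C') \<and> bij_betw g (objs C) (objs C') \<and>
       (\<forall>i\<in>idx C. \<forall>a\<in>objs C. g (rho C i a) = rho C' (f i) (g a)) \<and>
       (\<forall>a\<in>objs C. \<forall>i\<in>idx C. \<forall>j\<in>idx C. cart C' (g a) (f i) (f j) = cart C a i j))"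

text \<open>\<open>\<int>\<^sup>I\<close> consists of the integer functions vanishing outside \<open>I\<close>.\<close>

definition int_lattice :: "'i set \<Rightarrow> ('i \<Rightarrow> int) set"
  where "int_lattice I = {x. \<forall>i. i \<notin> I \<longrightarrow> x i = 0}"

definition unit_vec :: "'i \<Rightarrow> 'i \<Rightarrow> int"
  where "unit_vec i = (\<lambda>k. if k = i then 1 else 0)"

text \<open>
  The linear extension of \<open>e\<^sub>j \<mapsto> e\<^sub>j - c\<^sub>i\<^sub>j e\<^sub>i\<close>.  It neither reads nor changes coordinates outside
  \<open>I\<close>; hence two compositions of such maps that agree on \<open>\<int>\<^sup>I\<close> agree everywhere, and equality of
  morphisms is equality of functions.
\<close>

definition sigma :: "('i, 'a) cartan_data \<Rightarrow> 'i \<Rightarrow> 'a \<Rightarrow> ('i \<Rightarrow> int) \<Rightarrow> ('i \<Rightarrow> int)"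
  where "sigma C i a x = (\<lambda>k. x k - (\<Sum>j\<in>idx C. cart C a i j * x j) * unit_vec i k)"

text \<open>\<open>weyl_hom C a w b\<close> means \<open>w \<in> Hom(a, b)\<close> in the Weyl groupoid.\<close>

inductive weyl_hom :: "('i, 'a) cartan_data \<Rightarrow> 'a \<Rightarrow> (('i \<Rightarrow> int) \<Rightarrow> ('i \<Rightarrow> int)) \<Rightarrow> 'a \<Rightarrow> bool"
  for C :: "('i, 'a) cartan_data" and a :: 'a where
  weyl_id: "a \<in> objs C \<Longrightarrow> weyl_hom C a id a"
| weyl_comp: "weyl_hom C a w b \<Longrightarrow> i \<in> idx C \<Longrightarrow> weyl_hom C a (sigma C i b \<circ> w) (rho C i b)"

definition connected_scheme :: "('i, 'a) cartan_data \<Rightarrow> bool"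
  where "connected_scheme C \<longleftrightarrow> (\<forall>a\<in>objs C. \<forall>b\<in>objs C. \<exists>w. weyl_hom C a w b)"

definition simply_connected_scheme :: "('i, 'a) cartan_data \<Rightarrow> bool"
  where "simply_connected_scheme C \<longleftrightarrow> (\<forall>a\<in>objs C. {w. weyl_hom C a w a} = {id})"

definition real_roots :: "('i, 'a) cartan_data \<Rightarrow> 'a \<Rightarrow> ('i \<Rightarrow> int) set"
  where "real_roots C a = {w (unit_vec j) | w j b. j \<in> idx C \<and> b \<in> objs C \<and> weyl_hom C b w a}"

definition root_system :: "('i, 'a) cartan_data \<Rightarrow> ('a \<Rightarrow> ('i \<Rightarrow> int) set) \<Rightarrow> bool"
  where "root_system C \<Phi> \<longleftrightarrow>
    (\<forall>a\<in>objs C.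
       \<Phi> a \<subseteq> int_lattice (idx C) \<and>
       (let P = {x \<in> \<Phi> a. \<forall>i\<in>idx C. x i \<ge> 0} in \<Phi> a = P \<union> uminus ` P) \<and>
       (\<forall>i\<in>idx C. \<Phi> a \<inter> range (\<lambda>z k. z * unit_vec i k) = {unit_vec i, - unit_vec i}) \<and>
       (\<forall>i\<in>idx C. sigma C i a ` \<Phi> a = \<Phi> (rho C i a)) \<and>
       (\<forall>i\<in>idx C. \<forall>j\<in>idx C.
          let M = {x \<in> \<Phi> a. \<exists>p q :: nat. x = (\<lambda>k. int p * unit_vec i k + int q * unit_vec j k)}
          in i \<noteq> j \<and> finite M \<longrightarrow> ((rho C i \<circ> rho C j) ^^ card M) a = a))"

definition finite_root_system :: "('i, 'a) cartan_data \<Rightarrow> ('a \<Rightarrow> ('i \<Rightarrow> int) set) \<Rightarrow> bool"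
  where "finite_root_system C \<Phi> \<longleftrightarrow> root_system C \<Phi> \<and> (\<forall>a\<in>objs C. finite (\<Phi> a))"

definition cartan_class :: "('i, 'a) cartan_data set"
  where "cartan_class =
    {C. cartan_scheme C \<and> connected_scheme C \<and> simply_connected_scheme C \<and>
        finite_root_system C (real_roots C)}"

definition cartan_rel :: "(('i, 'a) cartan_data \<times> ('i, 'a) cartan_data) set"
  where "cartan_rel =
    {(C, C'). C \<in> cartan_class \<and> C' \<in> cartan_class \<and> cartan_equiv C C'}"


section \<open>The Cartan scheme of an arrangement and the map \<open>\<Lambda>\<close>\<close>

text \<open>
  Objects are the classes of sequences modulo \<^const>\<open>seq_rel\<close>.  In \<open>rho\<close> and \<open>cart\<close> the element
  \<open>a\<close> ranges over the representatives of the class \<open>X\<close>.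
\<close>

definition cartan_of ::
    "nat \<Rightarrow> (nat \<Rightarrow> real) set set \<Rightarrow> (nat \<Rightarrow> real) set \<Rightarrow> (nat \<Rightarrow> real) set \<Rightarrow>
     (nat \<Rightarrow> nat \<Rightarrow> real) \<Rightarrow> (nat, nat list set) cartan_data"
  where "cartan_of r \<A> R K\<^sub>0 \<alpha> =
    \<lparr> idx = {1..r},
      objs = lists {1..r} // seq_rel r \<A> R K\<^sub>0 \<alpha>,
      rho = (\<lambda>i X. \<Union>a\<in>X. seq_rel r \<A> R K\<^sub>0 \<alpha> `` {a @ [i]}),
      cart = (\<lambda>X i j. THE c. \<exists>a\<in>X.
        phi r \<A> R K\<^sub>0 \<alpha> (a @ [i]) (\<alpha> j) =
          - (of_int c *\<^sub>R phi r \<A> R K\<^sub>0 \<alpha> a (\<alpha> i)) + phi r \<A> R K\<^sub>0 \<alpha> a (\<alpha> j)) \<rparr>"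

text \<open>
  The union runs over all representatives, chambers and orderings; that all of them contribute the
  same class is the well-definedness of \<open>\<Lambda>\<close>.
\<close>

definition Lambda :: "arrangement set \<Rightarrow> (nat, nat list set) cartan_data set"
  where "Lambda X =
    (\<Union>(r, \<A>, R)\<in>X. \<Union>K\<in>chambers r \<A>. \<Union>\<alpha>\<in>{\<alpha>. basis_ordering r \<A> R K \<alpha>}.
       cartan_rel `` {cartan_of r \<A> R K \<alpha>})"

lemma linear_iso_inverse:
  assumes "linear_iso U W f" "subspace U"
  shows "\<exists>g. linear_iso W U g \<and> (\<forall>x\<in>U. g (f x) = x)"
proof -
  from assms have f: "linear f" "bij_betw f U W" by (auto simp: linear_iso_def)
  then obtain g where g: "linear g" "\<forall>v\<in>U. g (f v) = v"
    using linear_exists_left_inverse_on[OF f(1) assms(2)] by (auto simp: bij_betw_def)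
  have "bij_betw g W U"
    by (rule bij_betw_byWitness[where f' = f]) (use f g in \<open>auto simp: bij_betw_def\<close>)
  with g show ?thesis by (auto simp: linear_iso_def)
qed

lemma subspace_Rn: "subspace (Rn r)"
  by (auto simp: subspace_def topspace_Euclidean_space scaleR_fun_def)

lemma arrangement_equiv_iff:
  "arrangement_equiv (r, \<A>, R) (r', \<A>', R') \<longleftrightarrow>
     r = r' \<and> (\<exists>\<psi>. linear_iso (Rn r) (Rn r) \<psi> \<and> \<psi> ` R = R')"
  by (simp add: arrangement_equiv_def)

lemma arrangement_equiv_refl: "arrangement_equiv X X"
proof -
  obtain r \<A> R where X: "X = (r, \<A>, R)" by (rule prod_cases3)
  have "linear_iso (Rn r) (Rn r) id" "id ` R = R"
    by (simp_all only: linear_iso_def linear_id bij_betw_id image_id id_apply simp_thms)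
  then show ?thesis unfolding X arrangement_equiv_iff by blast
qed

lemma arrangement_equiv_sym:
  assumes "X \<in> arrangement_class" "arrangement_equiv X Y"
  shows "arrangement_equiv Y X"
proof -
  obtain r \<A> R where X: "X = (r, \<A>, R)" by (rule prod_cases3)
  obtain r' \<A>' R' where Y: "Y = (r', \<A>', R')" by (rule prod_cases3)
  from assms(2) obtain \<psi> where \<psi>: "r = r'" "linear_iso (Rn r) (Rn r) \<psi>" "\<psi> ` R = R'"
    unfolding X Y arrangement_equiv_iff by blast
  from assms(1) have R: "R \<subseteq> Rn r"
    unfolding X arrangement_class_def crystallographic_def by blast
  obtain g where g: "linear_iso (Rn r) (Rn r) g" "\<forall>x\<in>Rn r. g (\<psi> x) = x"
    using linear_iso_inverse[OF \<psi>(2) subspace_Rn] by blast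
  have "g ` \<psi> ` R = (\<lambda>x. x) ` R"
    unfolding image_image using g(2) R by (intro image_cong refl) blast
  then have "g ` R' = R" unfolding \<psi>(3) by simp
  then show ?thesis
    unfolding X Y arrangement_equiv_iff using \<psi>(1) g(1) by blast
qed

lemma arrangement_equiv_trans:
  assumes "arrangement_equiv X Y" "arrangement_equiv Y Z"
  shows "arrangement_equiv X Z"
proof -
  obtain r \<A> R where X: "X = (r, \<A>, R)" by (rule prod_cases3)
  obtain r' \<A>' R' where Y: "Y = (r', \<A>', R')" by (rule prod_cases3)
  obtain r'' \<A>'' R'' where Z: "Z = (r'', \<A>'', R'')" by (rule prod_cases3)
  from assms(1) obtain f where f: "r = r'" "linear_iso (Rn r) (Rn r) f" "f ` R = R'"
    unfolding X Y arrangement_equiv_iff by blast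
  from assms(2) obtain g where g: "r' = r''" "linear_iso (Rn r') (Rn r') g" "g ` R' = R''"
    unfolding Y Z arrangement_equiv_iff by blast
  have "linear_iso (Rn r) (Rn r) (g \<circ> f)"
    using f g unfolding linear_iso_def by (blast intro: linear_compose bij_betw_trans)
  moreover have "(g \<circ> f) ` R = R''"
    unfolding image_comp[symmetric] f(3) g(3) ..
  ultimately show ?thesis
    unfolding X Z arrangement_equiv_iff using f(1) g(1) by blast
qed

lemma equiv_arrangement_rel: "equiv arrangement_class arrangement_rel"
proof (rule equivI)
  show "arrangement_rel \<subseteq> arrangement_class \<times> arrangement_class"
    unfolding arrangement_rel_def by blast
  show "refl_on arrangement_class arrangement_rel"
    unfolding refl_on_def arrangement_rel_def using arrangement_equiv_refl by blast
  show "sym arrangement_rel"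
    unfolding sym_def arrangement_rel_def using arrangement_equiv_sym by blast
  show "trans arrangement_rel"
    unfolding trans_def arrangement_rel_def using arrangement_equiv_trans by blast
qed

lemma cartan_equiv_refl: "cartan_equiv C C"
  unfolding cartan_equiv_def by (intro exI[of _ id]) auto

lemma cartan_equiv_sym:
  assumes "cartan_scheme C" "cartan_equiv C C'"
  shows "cartan_equiv C' C"
proof -
  from assms(2) obtain f g where fg: "bij_betw f (idx C) (idx C')" "bij_betw g (objs C) (objs C')"
      "\<And>i a. i \<in> idx C \<Longrightarrow> a \<in> objs C \<Longrightarrow> g (rho C i a) = rho C' (f i) (g a)"
      "\<And>a i j. a \<in> objs C \<Longrightarrow> i \<in> idx C \<Longrightarrow> j \<in> idx C \<Longrightarrow> cart C' (g a) (f i) (f j) = cart C a i j"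
    unfolding cartan_equiv_def by blast
  let ?f = "inv_into (idx C) f" and ?g = "inv_into (objs C) g"
  have f: "?f i \<in> idx C" "f (?f i) = i" if "i \<in> idx C'" for i
    using that fg(1) by (auto simp: bij_betw_def inv_into_into f_inv_into_f)
  have g: "?g a \<in> objs C" "g (?g a) = a" if "a \<in> objs C'" for a
    using that fg(2) by (auto simp: bij_betw_def inv_into_into f_inv_into_f)
  have "?g (rho C' i a) = rho C (?f i) (?g a)" if "i \<in> idx C'" "a \<in> objs C'" for i a
  proof -
    have "rho C (?f i) (?g a) \<in> objs C"
      using assms(1) f[OF that(1)] g[OF that(2)] by (auto simp: cartan_scheme_def)
    moreover have "g (rho C (?f i) (?g a)) = rho C' i a"
      using fg(3)[OF f(1)[OF that(1)] g(1)[OF that(2)]] f(2)[OF that(1)] g(2)[OF that(2)] by simp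
    ultimately show ?thesis using fg(2) by (metis bij_betw_inv_into_left)
  qed
  moreover have "cart C (?g a) (?f i) (?f j) = cart C' a i j"
    if "a \<in> objs C'" "i \<in> idx C'" "j \<in> idx C'" for a i j
    using fg(4)[OF g(1) f(1) f(1), OF that] f(2)[OF that(2)] f(2)[OF that(3)] g(2)[OF that(1)] by simp
  ultimately show ?thesis
    unfolding cartan_equiv_def using bij_betw_inv_into[OF fg(1)] bij_betw_inv_into[OF fg(2)]
    by (intro exI[of _ ?f] exI[of _ ?g]) simp
qed

lemma cartan_equiv_trans:
  assumes "cartan_equiv C C'" "cartan_equiv C' C''"
  shows "cartan_equiv C C''"
proof -
  from assms(1) obtain f g where fg: "bij_betw f (idx C) (idx C')" "bij_betw g (objs C) (objs C')"
      "\<forall>i\<in>idx C. \<forall>a\<in>objs C. g (rho C i a) = rho C' (f i) (g a)"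
      "\<forall>a\<in>objs C. \<forall>i\<in>idx C. \<forall>j\<in>idx C. cart C' (g a) (f i) (f j) = cart C a i j"
    unfolding cartan_equiv_def by blast
  from assms(2) obtain f' g' where fg': "bij_betw f' (idx C') (idx C'')" "bij_betw g' (objs C') (objs C'')"
      "\<forall>i\<in>idx C'. \<forall>a\<in>objs C'. g' (rho C' i a) = rho C'' (f' i) (g' a)"
      "\<forall>a\<in>objs C'. \<forall>i\<in>idx C'. \<forall>j\<in>idx C'. cart C'' (g' a) (f' i) (f' j) = cart C' a i j"
    unfolding cartan_equiv_def by blast
  have "f i \<in> idx C'" if "i \<in> idx C" for i using that fg(1) by (auto simp: bij_betw_def)
  moreover have "g a \<in> objs C'" if "a \<in> objs C" for a using that fg(2) by (auto simp: bij_betw_def)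
  ultimately have "\<forall>i\<in>idx C. \<forall>a\<in>objs C. (g' \<circ> g) (rho C i a) = rho C'' ((f' \<circ> f) i) ((g' \<circ> g) a)"
    "\<forall>a\<in>objs C. \<forall>i\<in>idx C. \<forall>j\<in>idx C. cart C'' ((g' \<circ> g) a) ((f' \<circ> f) i) ((f' \<circ> f) j) = cart C a i j"
    using fg(3,4) fg'(3,4) by simp_all
  then show ?thesis
    unfolding cartan_equiv_def using bij_betw_trans[OF fg(1) fg'(1)] bij_betw_trans[OF fg(2) fg'(2)]
    by (intro exI[of _ "f' \<circ> f"] exI[of _ "g' \<circ> g"] conjI)
qed

lemma equiv_cartan_rel: "equiv cartan_class cartan_rel"
proof (rule equivI)
  show "cartan_rel \<subseteq> cartan_class \<times> cartan_class"
    by (auto simp: cartan_rel_def)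
  show "refl_on cartan_class cartan_rel"
    by (auto simp: refl_on_def cartan_rel_def cartan_equiv_refl)
  show "sym cartan_rel"
    by (auto simp: sym_def cartan_rel_def cartan_class_def intro: cartan_equiv_sym)
  show "trans cartan_rel"
    by (auto simp: trans_def cartan_rel_def intro: cartan_equiv_trans)
qed

end

theory Submission
  imports Defs
begin

text \<open>
  Both sides of the bijection are compared with a \<^emph>\<open>realization\<close>: a finite reduced symmetric set
  \<open>R\<close> of vectors, together with a labelled basis \<open>L a\<close> of every object \<open>a\<close> such that each element of
  \<open>R\<close> is an integer combination of \<open>L a\<close> with coefficients of one sign, and \<open>\<rho>\<^sub>i\<close> acts on these
  bases by \<open>L a j \<mapsto> L a j - c\<^sub>i\<^sub>j L a i\<close>.  Crossing the wall \<open>L a i\<close> changes the sign of \<open>\<plusminus> L a i\<close> only,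
  so a linear functional that is nonzero on \<open>R\<close> can be made positive on some basis by descending
  through the walls on which it is negative; this gives all chambers and shows that
  every root is simple at some object.

  Walking around a face of codimension two reverses the positive roots of the rank two subsystem
  one at a time, hence closes up after twice their number of steps; this is (R4).  Conversely,
  (R4) makes the descents confluent, so two objects with the same labelled basis coincide.  Hence
  a scheme with a realization is determined by \<open>R\<close> up to equivalence, and \<open>R\<close> by the scheme up to
  linear isomorphism.  A crystallographic arrangement realizes its Cartan scheme, since the basis
  beyond a wall differs from the old one by nonnegative multiples of the crossed root; a connected
  simply connected scheme is realized by the real roots at one object.
\<close>


section \<open>Labelled bases and realizations\<close>

text \<open>Trivial groups \<open>Hom(a, a)\<close> do not yet separate objects. Placing the Cartan
  matrix of type A_2 on a circle of twelve objects, a double cover of the hexagon of its chambers,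
  keeps these groups trivial and the real roots unchanged, but objects at distance six carry the
  same labelled basis. Only (R4) excludes such covers, so deriving the injectivity of
  \<open>L\<close> from (R4) is the core of one direction. In the other direction injectivity is
  built in, since \<open>seq_rel\<close> identifies sequences with equal bases. This is why
  injectivity separates \<open>realization\<close> from \<open>prerealization\<close>.

  The axioms (C1), (C2), (M1) and (M2) come from sign coherence: a root with a coordinate 1 has no
  negative coordinate, and reading a base change in both directions makes the remaining coefficients
  vanish.

  The combinatorial part works in an arbitrary real vector space, with linear functionals in the
  role of points. Topology enters only where chambers and their closures are described as cones over
  such bases.\<close>

definition lbase :: "'v::real_vector set \<Rightarrow> 'i set \<Rightarrow> ('i \<Rightarrow> 'v) \<Rightarrow> bool"
  where "lbase R I b \<longleftrightarrow> (\<forall>i\<in>I. b i \<in> R) \<and>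
    (\<forall>x::'i \<Rightarrow> real. (\<Sum>i\<in>I. x i *\<^sub>R b i) = 0 \<longrightarrow> (\<forall>i\<in>I. x i = 0)) \<and>
    (\<forall>\<alpha>\<in>R. \<exists>x::'i \<Rightarrow> int. \<alpha> = (\<Sum>i\<in>I. of_int (x i) *\<^sub>R b i) \<and>
       ((\<forall>i\<in>I. x i \<ge> 0) \<or> (\<forall>i\<in>I. x i \<le> 0)))"

text \<open>Values outside \<open>I\<close> are unspecified, hence the hypotheses
  \<open>i \<in> I\<close> in the lemmas on coordinates.\<close>

definition crd :: "'i set \<Rightarrow> ('i \<Rightarrow> 'v::real_vector) \<Rightarrow> 'v \<Rightarrow> 'i \<Rightarrow> int"
  where "crd I b \<alpha> = (SOME x. \<alpha> = (\<Sum>i\<in>I. of_int (x i) *\<^sub>R b i))"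

lemma lbase_in: "lbase R I b \<Longrightarrow> i \<in> I \<Longrightarrow> b i \<in> R"
  unfolding lbase_def by (elim conjE) (erule bspec)

lemma lbase_indep:
  assumes "lbase R I b" "(\<Sum>i\<in>I. x i *\<^sub>R b i) = 0" "i \<in> I"
  shows "x i = 0"
proof -
  have "\<forall>x::_ \<Rightarrow> real. (\<Sum>i\<in>I. x i *\<^sub>R b i) = 0 \<longrightarrow> (\<forall>i\<in>I. x i = 0)"
    using assms(1) unfolding lbase_def by (elim conjE)
  from this[rule_format, OF assms(2,3)] show ?thesis .
qed

lemma lbase_root:
  assumes "lbase R I b" "\<alpha> \<in> R"
  obtains x :: "_ \<Rightarrow> int" where "\<alpha> = (\<Sum>i\<in>I. of_int (x i) *\<^sub>R b i)"
    "(\<forall>i\<in>I. x i \<ge> 0) \<or> (\<forall>i\<in>I. x i \<le> 0)"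
proof -
  have "\<forall>\<alpha>\<in>R. \<exists>x::_ \<Rightarrow> int. \<alpha> = (\<Sum>i\<in>I. of_int (x i) *\<^sub>R b i) \<and>
       ((\<forall>i\<in>I. x i \<ge> 0) \<or> (\<forall>i\<in>I. x i \<le> 0))"
    using assms(1) unfolding lbase_def by (elim conjE)
  from bspec[OF this assms(2)] that show ?thesis by (elim exE conjE)
qed

lemma lbase_eq_coords:
  assumes "lbase R I b" "(\<Sum>i\<in>I. x i *\<^sub>R b i) = (\<Sum>i\<in>I. y i *\<^sub>R b i)" "i \<in> I"
  shows "x i = y i"
proof -
  have "(\<Sum>i\<in>I. (x i - y i) *\<^sub>R b i) = 0"
    using assms(2) by (simp add: scaleR_diff_left sum_subtractf)
  from lbase_indep[OF assms(1) this assms(3)] have "x i - y i = 0" .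
  then show ?thesis by simp
qed

lemma crd_unique:
  assumes "lbase R I b" "\<alpha> = (\<Sum>i\<in>I. of_int (x i) *\<^sub>R b i)" "i \<in> I"
  shows "crd I b \<alpha> i = x i"
proof -
  have "\<alpha> = (\<Sum>i\<in>I. of_int (crd I b \<alpha> i) *\<^sub>R b i)"
    unfolding crd_def by (rule someI[of "\<lambda>x. \<alpha> = (\<Sum>i\<in>I. of_int (x i) *\<^sub>R b i)"]) (rule assms(2))
  with assms(2) have "(\<Sum>i\<in>I. of_int (crd I b \<alpha> i) *\<^sub>R b i) = (\<Sum>i\<in>I. of_int (x i) *\<^sub>R b i)"
    by simp
  from lbase_eq_coords[OF assms(1) this assms(3)] show ?thesis by simp
qed

lemma crd_sum:
  assumes "lbase R I b" "\<alpha> \<in> R"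
  shows "\<alpha> = (\<Sum>i\<in>I. of_int (crd I b \<alpha> i) *\<^sub>R b i)"
proof -
  from lbase_root[OF assms] obtain x :: "_ \<Rightarrow> int" where "\<alpha> = (\<Sum>i\<in>I. of_int (x i) *\<^sub>R b i)" .
  then show ?thesis
    unfolding crd_def by (rule someI[of "\<lambda>x. \<alpha> = (\<Sum>i\<in>I. of_int (x i) *\<^sub>R b i)"])
qed

lemma crd_sign:
  assumes "lbase R I b" "\<alpha> \<in> R"
  shows "(\<forall>i\<in>I. crd I b \<alpha> i \<ge> 0) \<or> (\<forall>i\<in>I. crd I b \<alpha> i \<le> 0)"
proof -
  from lbase_root[OF assms] obtain x :: "_ \<Rightarrow> int" where "\<alpha> = (\<Sum>i\<in>I. of_int (x i) *\<^sub>R b i)"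
     "(\<forall>i\<in>I. x i \<ge> 0) \<or> (\<forall>i\<in>I. x i \<le> 0)" .
  with crd_unique[OF assms(1) this(1)] show ?thesis by simp
qed

lemma crd_basis:
  assumes "lbase R I b" "finite I" "i \<in> I" "j \<in> I"
  shows "crd I b (b i) j = (if j = i then 1 else 0)"
proof -
  have "b i = (\<Sum>k\<in>I. of_int (if k = i then 1 else 0) *\<^sub>R b k)"
    using assms(2,3) by (simp add: if_distrib[of of_int] if_distrib[of "\<lambda>x. x *\<^sub>R _"] cong: if_cong)
  from crd_unique[OF assms(1) this assms(4)] show ?thesis .
qed

lemma crd_uminus:
  assumes "lbase R I b" "\<alpha> \<in> R" "i \<in> I"
  shows "crd I b (- \<alpha>) i = - crd I b \<alpha> i"
proof -
  have "- \<alpha> = (\<Sum>i\<in>I. of_int (- crd I b \<alpha> i) *\<^sub>R b i)"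
    using crd_sum[OF assms(1,2)] by (simp add: sum_negf)
  from crd_unique[OF assms(1) this assms(3)] show ?thesis .
qed

lemma lbase_inj: "lbase R I b \<Longrightarrow> finite I \<Longrightarrow> inj_on b I"
  by (rule inj_onI) (metis crd_basis zero_neq_one)

lemma lbase_independent:
  fixes b :: "'i \<Rightarrow> 'v::real_vector"
  assumes b: "lbase R I b" and fin: "finite I"
  shows "independent (b ` I)"
  unfolding independent_explicit_finite_subsets
proof (intro allI impI ballI)
  fix S :: "'v set" and u :: "'v \<Rightarrow> real" and v
  assume S: "S \<subseteq> b ` I" "finite S" "(\<Sum>v\<in>S. u v *\<^sub>R v) = 0" "v \<in> S"
  let ?u = "\<lambda>v. if v \<in> S then u v else 0"
  have "(\<Sum>i\<in>I. ?u (b i) *\<^sub>R b i) = (\<Sum>v\<in>b ` I. ?u v *\<^sub>R v)"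
    by (simp add: sum.reindex[OF lbase_inj[OF b fin]])
  also have "\<dots> = (\<Sum>v\<in>S. u v *\<^sub>R v)"
    using S fin by (intro sum.mono_neutral_cong_right) auto
  finally have "(\<Sum>i\<in>I. ?u (b i) *\<^sub>R b i) = 0" using S(3) by simp
  note eq = lbase_indep[OF b this]
  from S obtain i where "i \<in> I" "v = b i" by auto
  with eq[of i] S(4) show "u v = 0" by simp
qed

text \<open>Such an \<open>h\<close> is an interior point of the chamber with simple roots
  \<open>b\<close>; on a root it is the height, the sum of the coordinates.\<close>

lemma lbase_functional:
  fixes b :: "'i \<Rightarrow> 'v::real_vector"
  assumes "lbase R I b" "finite I"
  obtains h :: "'v \<Rightarrow> real" where "linear h" "\<And>i. i \<in> I \<Longrightarrow> h (b i) = 1"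
  using linear_independent_extend[OF lbase_independent[OF assms], of "\<lambda>_. 1"] by auto

lemma span_lbase:
  assumes "lbase R I b"
  shows "span (b ` I) = span R"
proof (rule span_eq[THEN iffD2], intro conjI subsetI)
  fix v assume "v \<in> b ` I"
  then show "v \<in> span R" using lbase_in[OF assms] by (auto intro: span_base)
next
  fix v assume "v \<in> R"
  have "(\<Sum>i\<in>I. of_int (crd I b v i) *\<^sub>R b i) \<in> span (b ` I)"
    by (intro span_sum span_scale span_base imageI)
  then show "v \<in> span (b ` I)" using crd_sum[OF assms \<open>v \<in> R\<close>] by simp
qed

lemma lbase_cong: "(\<And>i. i \<in> I \<Longrightarrow> b i = b' i) \<Longrightarrow> lbase R I b = lbase R I b'"
  unfolding lbase_def by (simp cong: sum.cong)

lemma lbase_reindex: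
  assumes "lbase R J b" "bij_betw f I J"
  shows "lbase R I (\<lambda>i. b (f i))"
proof -
  have eq: "(\<Sum>i\<in>I. x i *\<^sub>R b (f i)) = (\<Sum>j\<in>J. x (inv_into I f j) *\<^sub>R b j)" for x
    using sum.reindex_bij_betw[OF assms(2), of "\<lambda>j. x (inv_into I f j) *\<^sub>R b j"] assms(2)
    by (simp add: bij_betw_inv_into_left cong: sum.cong)
  have f: "f i \<in> J" if "i \<in> I" for i using that assms(2) by (auto simp: bij_betw_def)
  show ?thesis unfolding lbase_def
  proof (intro conjI allI ballI impI)
    fix i assume "i \<in> I"
    then show "b (f i) \<in> R" using lbase_in[OF assms(1) f] by simp
  next
    fix x :: "_ \<Rightarrow> real" and i assume x: "(\<Sum>i\<in>I. x i *\<^sub>R b (f i)) = 0" "i \<in> I"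
    from lbase_indep[OF assms(1) x(1)[unfolded eq] f[OF x(2)]] show "x i = 0"
      using bij_betw_inv_into_left[OF assms(2) x(2)] by simp
  next
    fix \<alpha> assume "\<alpha> \<in> R"
    from lbase_root[OF assms(1) this] obtain x :: "_ \<Rightarrow> int" where
      x: "\<alpha> = (\<Sum>j\<in>J. of_int (x j) *\<^sub>R b j)" "(\<forall>i\<in>J. x i \<ge> 0) \<or> (\<forall>i\<in>J. x i \<le> 0)" .
    have "\<alpha> = (\<Sum>i\<in>I. of_int (x (f i)) *\<^sub>R b (f i))"
      unfolding x(1) by (rule sum.reindex_bij_betw[OF assms(2), symmetric])
    with x(2) f show "\<exists>x. \<alpha> = (\<Sum>i\<in>I. of_int (x i) *\<^sub>R b (f i)) \<and> ((\<forall>i\<in>I. 0 \<le> x i) \<or> (\<forall>i\<in>I. x i \<le> 0))"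
      by (intro exI[of _ "\<lambda>i. x (f i)"]) auto
  qed
qed

lemma lbase_image:
  assumes b: "lbase R I b" and psi: "linear \<psi>" "inj_on \<psi> (span R)"
  shows "lbase (\<psi> ` R) I (\<lambda>i. \<psi> (b i))"
  unfolding lbase_def
proof (intro conjI allI ballI impI)
  fix i assume "i \<in> I"
  then show "\<psi> (b i) \<in> \<psi> ` R" using lbase_in[OF b] by simp
next
  fix x :: "_ \<Rightarrow> real" and i assume x: "(\<Sum>i\<in>I. x i *\<^sub>R \<psi> (b i)) = 0" "i \<in> I"
  have "\<psi> (\<Sum>i\<in>I. x i *\<^sub>R b i) = \<psi> 0"
    using x(1) by (simp add: linear_sum[OF psi(1)] linear_scale[OF psi(1)] linear_0[OF psi(1)])
  then have "(\<Sum>i\<in>I. x i *\<^sub>R b i) = 0"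
  proof (rule inj_onD[OF psi(2)])
    show "(\<Sum>i\<in>I. x i *\<^sub>R b i) \<in> span R"
      by (rule span_sum, rule span_scale, rule span_base, erule lbase_in[OF b])
  qed (rule span_zero)
  from lbase_indep[OF b this x(2)] show "x i = 0" .
next
  fix \<alpha> assume "\<alpha> \<in> \<psi> ` R"
  then obtain \<beta> where be: "\<beta> \<in> R" "\<alpha> = \<psi> \<beta>" by auto
  from lbase_root[OF b be(1)] obtain x :: "_ \<Rightarrow> int" where
    x: "\<beta> = (\<Sum>i\<in>I. of_int (x i) *\<^sub>R b i)" "(\<forall>i\<in>I. x i \<ge> 0) \<or> (\<forall>i\<in>I. x i \<le> 0)" .
  have "\<alpha> = (\<Sum>i\<in>I. of_int (x i) *\<^sub>R \<psi> (b i))"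
    unfolding be(2) x(1) by (simp add: linear_sum[OF psi(1)] linear_scale[OF psi(1)])
  with x(2) show "\<exists>x. \<alpha> = (\<Sum>i\<in>I. of_int (x i) *\<^sub>R \<psi> (b i)) \<and> ((\<forall>i\<in>I. 0 \<le> x i) \<or> (\<forall>i\<in>I. x i \<le> 0))"
    by blast
qed

lemma linear_crd:
  fixes h :: "'v::real_vector \<Rightarrow> real"
  assumes "lbase R I b" "\<alpha> \<in> R" "linear h"
  shows "h \<alpha> = (\<Sum>i\<in>I. of_int (crd I b \<alpha> i) * h (b i))"
proof -
  have "h \<alpha> = h (\<Sum>i\<in>I. of_int (crd I b \<alpha> i) *\<^sub>R b i)"
    using crd_sum[OF assms(1,2)] by simp
  then show ?thesis using assms(3) by (simp add: linear_sum linear_scale)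
qed

text \<open>One positive value decides between the two cases of \<open>crd_sign\<close>: with all
  coordinates nonpositive, \<open>h \<alpha>\<close> would be nonpositive too.\<close>

lemma crd_nonneg:
  fixes h :: "'v::real_vector \<Rightarrow> real"
  assumes b: "lbase R I b" and \<alpha>: "\<alpha> \<in> R"
    and h: "linear h" "\<And>i. i \<in> I \<Longrightarrow> h (b i) > 0" "h \<alpha> > 0" and i: "i \<in> I"
  shows "crd I b \<alpha> i \<ge> 0"
proof (rule ccontr)
  assume "\<not> ?thesis"
  then have "\<forall>i\<in>I. crd I b \<alpha> i \<le> 0" using crd_sign[OF b \<alpha>] i by force
  then have "h \<alpha> \<le> 0" unfolding linear_crd[OF b \<alpha> h(1)]
    using h(2) by (intro sum_nonpos mult_nonpos_nonneg) (auto simp: less_imp_le)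
  with h(3) show False by simp
qed

text \<open>
  The transition matrices between the two bases are nonnegative and mutually inverse, hence
  permutation matrices.
\<close>

lemma lbase_subset:
  fixes h :: "'v::real_vector \<Rightarrow> real"
  assumes b: "lbase R I b" and c: "lbase R J c" and fin: "finite I" "finite J"
    and h: "linear h" "\<And>i. i \<in> I \<Longrightarrow> h (b i) > 0" "\<And>j. j \<in> J \<Longrightarrow> h (c j) > 0"
    and red: "\<And>\<alpha> t. \<alpha> \<in> R \<Longrightarrow> t *\<^sub>R \<alpha> \<in> R \<Longrightarrow> t = 1 \<or> t = -1"
  shows "b ` I \<subseteq> c ` J"
proof
  fix v assume "v \<in> b ` I"
  then obtain i where i: "i \<in> I" "v = b i" by auto
  have vR: "v \<in> R" using lbase_in[OF b i(1)] i(2) by simp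
  have cR: "c j \<in> R" if "j \<in> J" for j using lbase_in[OF c that] .
  let ?n = "crd J c v" and ?m = "\<lambda>j. crd I b (c j)"
  have "v = (\<Sum>j\<in>J. of_int (?n j) *\<^sub>R c j)" by (rule crd_sum[OF c vR])
  also have "\<dots> = (\<Sum>j\<in>J. of_int (?n j) *\<^sub>R (\<Sum>k\<in>I. of_int (?m j k) *\<^sub>R b k))"
    by (intro sum.cong refl arg_cong2[where f = scaleR] crd_sum[OF b] cR)
  also have "\<dots> = (\<Sum>k\<in>I. of_int (\<Sum>j\<in>J. ?n j * ?m j k) *\<^sub>R b k)"
    unfolding scaleR_sum_right by (subst sum.swap) (simp add: scaleR_sum_left)
  finally have eq: "(\<Sum>j\<in>J. ?n j * ?m j k) = (if k = i then 1 else 0)" if "k \<in> I" for k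
    using crd_unique[OF b _ that] crd_basis[OF b fin(1) i(1) that] i(2) by metis
  have n0: "?n j \<ge> 0" if "j \<in> J" for j using crd_nonneg[OF c vR h(1,3) _ that] h(2) i by simp
  have m0: "?m j k \<ge> 0" if "j \<in> J" "k \<in> I" for j k
    using crd_nonneg[OF b cR[OF that(1)] h(1,2) h(3)[OF that(1)] that(2)] by simp
  have "\<exists>j\<in>J. ?n j * ?m j i \<noteq> 0"
    using eq[OF i(1)] by (metis (no_types, lifting) sum.neutral zero_neq_one)
  then obtain j where j: "j \<in> J" "?n j \<noteq> 0" "?m j i \<noteq> 0" by auto
  have "?m j k = 0" if "k \<in> I" "k \<noteq> i" for k
  proof -
    have "\<forall>j\<in>J. ?n j * ?m j k = 0"
      using eq[OF that(1)] that n0 m0 fin(2) by (subst sum_nonneg_eq_0_iff[symmetric]) auto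
    with j show ?thesis by auto
  qed
  then have "(\<Sum>k\<in>I. of_int (?m j k) *\<^sub>R b k) = of_int (?m j i) *\<^sub>R b i"
    using fin i by (subst sum.remove[of I i]) auto
  with crd_sum[OF b cR[OF j(1)]] have cj: "c j = of_int (?m j i) *\<^sub>R b i" by simp
  with red[OF vR, of "of_int (?m j i)"] cR[OF j(1)] i(2) have "?m j i = 1 \<or> ?m j i = -1"
    by (metis of_int_1 of_int_eq_iff of_int_minus)
  with m0[OF j(1) i(1)] have "?m j i = 1" by auto
  with cj i(2) have "v = c j" by simp
  with j(1) show "v \<in> c ` J" by blast
qed

section \<open>Walks between objects and realizations of a scheme\<close>

definition walk :: "('i, 'a) cartan_data \<Rightarrow> 'a \<Rightarrow> 'i list \<Rightarrow> 'a"
  where "walk C a w = foldl (\<lambda>x i. rho C i x) a w"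

lemma walk_simps [simp]:
  "walk C a [] = a" "walk C a (w @ [i]) = rho C i (walk C a w)"
  "walk C a (i # w) = walk C (rho C i a) w"
  by (simp_all add: walk_def)

lemma walk_append: "walk C a (u @ v) = walk C (walk C a u) v"
  by (simp add: walk_def)

text \<open>Of the Cartan axioms only the diagonal entries are assumed; the others are derived from
  the bases later. Connectedness is stated with walks, because morphisms are recovered from the
  bases as changes of coordinates. The condition \<open>reduced\<close> is (R2) in a form that
  refers to no object; it also keeps 0 out of \<open>R\<close>.\<close>

locale prerealization =
  fixes C :: "('i, 'a) cartan_data" and L :: "'a \<Rightarrow> 'i \<Rightarrow> 'v::real_vector" and R :: "'v set"
  assumes finite_idx: "finite (idx C)" and idx_ne: "idx C \<noteq> {}" and objs_ne: "objs C \<noteq> {}"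
    and rho_in: "\<And>i a. i \<in> idx C \<Longrightarrow> a \<in> objs C \<Longrightarrow> rho C i a \<in> objs C"
    and finite_R: "finite R" and sym_R: "\<And>\<alpha>. \<alpha> \<in> R \<Longrightarrow> - \<alpha> \<in> R"
    and reduced: "\<And>\<alpha> t. \<alpha> \<in> R \<Longrightarrow> t *\<^sub>R \<alpha> \<in> R \<Longrightarrow> t = 1 \<or> t = -1"
    and base: "\<And>a. a \<in> objs C \<Longrightarrow> lbase R (idx C) (L a)"
    and step: "\<And>a i j. a \<in> objs C \<Longrightarrow> i \<in> idx C \<Longrightarrow> j \<in> idx C \<Longrightarrow>
       L (rho C i a) j = L a j - of_int (cart C a i j) *\<^sub>R L a i"
    and cart_diag: "\<And>a i. a \<in> objs C \<Longrightarrow> i \<in> idx C \<Longrightarrow> cart C a i i = 2"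
    and conn: "\<And>a b. a \<in> objs C \<Longrightarrow> b \<in> objs C \<Longrightarrow> \<exists>w\<in>lists (idx C). b = walk C a w"
begin

abbreviation "I \<equiv> idx C"
abbreviation "co a \<equiv> crd I (L a)"

definition pos :: "'a \<Rightarrow> 'v set"
  where "pos a = {\<alpha> \<in> R. \<forall>i\<in>I. co a \<alpha> i \<ge> 0}"

lemma L_in: "a \<in> objs C \<Longrightarrow> i \<in> I \<Longrightarrow> L a i \<in> R"
  using lbase_in[OF base] .

lemma zero_notin: "0 \<notin> R"
  using reduced[of 0 2] by auto

lemma walk_in: "a \<in> objs C \<Longrightarrow> w \<in> lists I \<Longrightarrow> walk C a w \<in> objs C"
  by (induction w arbitrary: a) (auto intro: rho_in)

lemma step_self: "a \<in> objs C \<Longrightarrow> i \<in> I \<Longrightarrow> L (rho C i a) i = - L a i"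
  by (subst step) (auto simp: cart_diag algebra_simps scaleR_2)

text \<open>The step changes each basis vector by a multiple of \<open>L a i\<close> only, so the
  coordinate at \<open>i\<close> absorbs the whole change.\<close>

lemma co_step:
  assumes "a \<in> objs C" "i \<in> I" "j \<in> I" "j \<noteq> i" "\<alpha> \<in> R"
  shows "co (rho C i a) \<alpha> j = co a \<alpha> j"
proof -
  let ?y = "co (rho C i a) \<alpha>"
  let ?z = "\<lambda>j. ?y j - (if j = i then (\<Sum>j\<in>I. ?y j * cart C a i j) else 0)"
  have "\<alpha> = (\<Sum>j\<in>I. of_int (?y j) *\<^sub>R L (rho C i a) j)"
    by (rule crd_sum[OF base[OF rho_in[OF assms(2,1)]] assms(5)])
  also have "\<dots> = (\<Sum>j\<in>I. of_int (?y j) *\<^sub>R (L a j - of_int (cart C a i j) *\<^sub>R L a i))"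
    using assms by (intro sum.cong refl) (simp add: step)
  also have "\<dots> = (\<Sum>j\<in>I. of_int (?y j) *\<^sub>R L a j) - of_int (\<Sum>j\<in>I. ?y j * cart C a i j) *\<^sub>R L a i"
    by (simp add: scaleR_diff_right sum_subtractf scaleR_sum_left)
  also have "\<dots> = (\<Sum>j\<in>I. of_int (?z j) *\<^sub>R L a j)"
    using assms(2) finite_idx
    by (simp add: scaleR_diff_left sum_subtractf if_distrib[of of_int] if_distrib[of "\<lambda>x. x *\<^sub>R _"] cong: if_cong)
  finally have "co a \<alpha> j = ?z j"
    by (rule crd_unique[OF base[OF assms(1)], where x = ?z, OF _ assms(3)])
  with assms(4) show ?thesis by simp
qed

lemma root_single_support:
  assumes "a \<in> objs C" "\<alpha> \<in> R" "i \<in> I" "\<forall>j\<in>I - {i}. co a \<alpha> j = 0"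
  shows "\<alpha> = L a i \<or> \<alpha> = - L a i"
proof -
  have "\<alpha> = (\<Sum>j\<in>I. of_int (co a \<alpha> j) *\<^sub>R L a j)" by (rule crd_sum[OF base[OF assms(1)] assms(2)])
  also have "\<dots> = of_int (co a \<alpha> i) *\<^sub>R L a i"
    using assms finite_idx by (subst sum.remove[of I i]) auto
  finally show ?thesis using reduced[OF L_in[OF assms(1,3)]] assms(2)
    by (metis scaleR_minus1_left scaleR_one)
qed

lemma pos_self: "a \<in> objs C \<Longrightarrow> i \<in> I \<Longrightarrow> L a i \<in> pos a"
  unfolding pos_def using crd_basis[OF base finite_idx] L_in by auto

lemma co_nonzero: "a \<in> objs C \<Longrightarrow> \<alpha> \<in> R \<Longrightarrow> \<exists>i\<in>I. co a \<alpha> i \<noteq> 0"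
proof (rule ccontr)
  assume *: "a \<in> objs C" "\<alpha> \<in> R" "\<not> (\<exists>i\<in>I. co a \<alpha> i \<noteq> 0)"
  with crd_sum[OF base[OF *(1)] *(2)] have "\<alpha> = 0" by simp
  with *(2) zero_notin show False by simp
qed

lemma pos_uminus: "a \<in> objs C \<Longrightarrow> \<alpha> \<in> R \<Longrightarrow> - \<alpha> \<in> pos a \<longleftrightarrow> \<alpha> \<notin> pos a"
proof -
  assume *: "a \<in> objs C" "\<alpha> \<in> R"
  show ?thesis
    unfolding pos_def using * co_nonzero[OF *] crd_sign[OF base[OF *(1)] *(2)] crd_uminus[OF base[OF *(1)] *(2)] sym_R
    by fastforce
qed

lemma pos_R: "pos a \<subseteq> R" by (auto simp: pos_def)

lemma finite_pos: "finite (pos a)" using finite_subset[OF pos_R finite_R] .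

text \<open>Such a root has a nonzero coordinate at some \<open>j \<noteq> i\<close> by reducedness.
  This coordinate survives the step, and by sign coherence it decides positivity at both
  objects.\<close>

lemma pos_step_other:
  assumes "a \<in> objs C" "i \<in> I" "\<alpha> \<in> R" "\<alpha> \<noteq> L a i" "\<alpha> \<noteq> - L a i"
  shows "\<alpha> \<in> pos (rho C i a) \<longleftrightarrow> \<alpha> \<in> pos a"
proof -
  obtain j where j: "j \<in> I" "j \<noteq> i" "co a \<alpha> j \<noteq> 0"
    using root_single_support[OF assms(1,3,2)] assms(4,5) by auto
  have "co (rho C i a) \<alpha> j = co a \<alpha> j" by (rule co_step) (use assms j in auto)
  then show ?thesis
    using j crd_sign[OF base[OF assms(1)] assms(3)]
      crd_sign[OF base[OF rho_in[OF assms(2,1)]] assms(3)] assms(3)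
    unfolding pos_def by (smt (verit) mem_Collect_eq)
qed

lemma pos_step:
  assumes "a \<in> objs C" "i \<in> I"
  shows "pos (rho C i a) = insert (- L a i) (pos a - {L a i})"
proof -
  have 1: "- L a i \<in> pos (rho C i a)" using pos_self[OF rho_in[OF assms(2,1)] assms(2)] step_self[OF assms] by simp
  have 2: "L a i \<notin> pos (rho C i a)"
    using pos_uminus[OF rho_in[OF assms(2,1)] L_in[OF assms]] 1 by simp
  have 3: "- L a i \<notin> pos a" using pos_uminus[OF assms(1) L_in[OF assms]] pos_self[OF assms] by simp
  show ?thesis using 1 2 3 pos_step_other[OF assms] pos_R by blast
qed

text \<open>Its cardinality counts the root hyperplanes on whose other side \<open>h\<close> lies,
  seen from \<open>a\<close>. It drops by one with every crossing of a wall on which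
  \<open>h\<close> is negative, and is the measure for all inductions on descents.\<close>

definition neg :: "('v \<Rightarrow> real) \<Rightarrow> 'a \<Rightarrow> 'v set"
  where "neg h a = {\<alpha> \<in> pos a. h \<alpha> < 0}"

lemma finite_neg: "finite (neg h a)" unfolding neg_def using finite_pos by simp

lemma neg_step:
  assumes "a \<in> objs C" "i \<in> I" "linear h" "h (L a i) < 0"
  shows "neg h (rho C i a) = neg h a - {L a i}" "L a i \<in> neg h a"
proof -
  have "h (- L a i) > 0" using assms(3,4) by (simp add: linear_neg)
  then show "neg h (rho C i a) = neg h a - {L a i}"
    unfolding neg_def pos_step[OF assms(1,2)] by auto
  show "L a i \<in> neg h a" unfolding neg_def using assms pos_self by simp
qed

lemma walk_to_chamber:
  fixes h :: "'v \<Rightarrow> real"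
  assumes "linear h" "\<And>\<alpha>. \<alpha> \<in> R \<Longrightarrow> h \<alpha> \<noteq> 0" "a \<in> objs C"
  shows "\<exists>w\<in>lists I. \<forall>i\<in>I. h (L (walk C a w) i) > 0"
  using assms(3)
proof (induction "card (neg h a)" arbitrary: a rule: less_induct)
  case less
  show ?case
  proof (cases "\<exists>i\<in>I. h (L a i) < 0")
    case False
    then have "\<forall>i\<in>I. h (L a i) > 0" using assms(2) L_in[OF less.prems] by (metis linorder_neqE_linordered_idom)
    then show ?thesis by (intro bexI[of _ "[]"]) auto
  next
    case True
    then obtain i where i: "i \<in> I" "h (L a i) < 0" by auto
    have "card (neg h (rho C i a)) < card (neg h a)"
      unfolding neg_step[OF less.prems i(1) assms(1) i(2)]
      by (rule card_Diff1_less[OF finite_neg neg_step(2)[OF less.prems i(1) assms(1) i(2)]])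
    from less.hyps[OF this rho_in[OF i(1) less.prems]] obtain w where
      "w \<in> lists I" "\<forall>k\<in>I. h (L (walk C (rho C i a) w) k) > 0" by auto
    then show ?thesis using i(1) by (intro bexI[of _ "i # w"]) auto
  qed
qed

lemma functional_exists:
  assumes "a \<in> objs C"
  obtains h :: "'v \<Rightarrow> real" where "linear h" "\<And>i. i \<in> I \<Longrightarrow> h (L a i) = 1"
    "\<And>\<alpha>. \<alpha> \<in> R \<Longrightarrow> h \<alpha> \<noteq> 0" "\<And>\<alpha>. \<alpha> \<in> pos a \<Longrightarrow> h \<alpha> > 0"
proof -
  obtain h :: "'v \<Rightarrow> real" where h: "linear h" "\<And>i. i \<in> I \<Longrightarrow> h (L a i) = 1"
    using lbase_functional[OF base[OF assms] finite_idx] by blast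
  have p: "h \<alpha> > 0" if "\<alpha> \<in> pos a" for \<alpha>
  proof -
    have aR: "\<alpha> \<in> R" and nn: "\<And>i. i \<in> I \<Longrightarrow> co a \<alpha> i \<ge> 0" using that by (auto simp: pos_def)
    have eq: "h \<alpha> = (\<Sum>i\<in>I. of_int (co a \<alpha> i))"
      using linear_crd[OF base[OF assms] aR h(1)] h(2) by simp
    obtain i where "i \<in> I" "co a \<alpha> i \<noteq> 0" using co_nonzero[OF assms aR] by auto
    then show ?thesis unfolding eq using nn finite_idx
      by (intro sum_pos2[of I i]) (auto simp: order_less_le)
  qed
  have "h \<alpha> \<noteq> 0" if "\<alpha> \<in> R" for \<alpha>
    using p[of \<alpha>] p[of "- \<alpha>"] pos_uminus[OF assms that] linear_neg[OF h(1)] by fastforce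
  with that h p show ?thesis by blast
qed

text \<open>If \<open>h\<close> is positive on the positive roots at \<open>a\<close>, the walk
  towards \<open>- h\<close> turns all of them negative. A root changes sign only in the step across
  its own hyperplane, and there it is a basis vector.\<close>

lemma root_is_simple:
  assumes "\<alpha> \<in> R"
  shows "\<exists>b\<in>objs C. \<exists>i\<in>I. \<alpha> = L b i"
proof -
  have *: "\<exists>b\<in>objs C. \<exists>i\<in>I. \<alpha> = L b i"
    if "w \<in> lists I" "a \<in> objs C" "\<alpha> \<in> R" "\<alpha> \<in> pos a" "\<alpha> \<notin> pos (walk C a w)" for w a \<alpha>
    using that
  proof (induction w arbitrary: a)
    case (Cons i w)
    then have a: "a \<in> objs C" and i: "i \<in> I" by auto
    show ?case
    proof (cases "\<alpha> = L a i")
      case False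
      moreover have "\<alpha> \<noteq> - L a i"
        using Cons.prems pos_uminus[OF a L_in[OF a i]] pos_self[OF a i] by auto
      ultimately have "\<alpha> \<in> pos (rho C i a)"
        using pos_step_other[OF a i] Cons.prems by auto
      with Cons show ?thesis by (auto intro: rho_in)
    qed (use a i in auto)
  qed auto
  obtain a where a: "a \<in> objs C" using objs_ne by auto
  have main: "\<exists>b\<in>objs C. \<exists>i\<in>I. \<alpha> = L b i" if aR: "\<alpha> \<in> R" "\<alpha> \<in> pos a" for \<alpha>
  proof -
    obtain h where h: "linear h" "\<And>\<alpha>. \<alpha> \<in> R \<Longrightarrow> h \<alpha> \<noteq> 0" "\<And>\<alpha>. \<alpha> \<in> pos a \<Longrightarrow> h \<alpha> > (0::real)"
      using functional_exists[OF a] by metis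
    obtain w where w: "w \<in> lists I" "\<forall>i\<in>I. - h (L (walk C a w) i) > 0"
      using walk_to_chamber[of "\<lambda>x. - h x" a] a h linear_compose_neg by auto
    let ?b = "walk C a w"
    have b: "?b \<in> objs C" by (rule walk_in[OF a w(1)])
    have "\<alpha> \<notin> pos ?b"
    proof
      assume "\<alpha> \<in> pos ?b"
      then have "h \<alpha> \<le> 0" unfolding linear_crd[OF base[OF b] aR(1) h(1)]
        using w(2) by (intro sum_nonpos mult_nonneg_nonpos) (auto simp: pos_def less_imp_le)
      with h(3)[OF aR(2)] show False by simp
    qed
    with * w(1) a aR show ?thesis by blast
  qed
  show ?thesis
  proof (cases "\<alpha> \<in> pos a")
    case True with main assms show ?thesis by blast
  next
    case False
    then have "- \<alpha> \<in> pos a" using pos_uminus[OF a assms] by simp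
    with main sym_R[OF assms] obtain b i where "b \<in> objs C" "i \<in> I" "- \<alpha> = L b i" by blast
    moreover have "\<alpha> = L (rho C i b) i"
      using calculation step_self by (metis add.inverse_inverse)
    ultimately show ?thesis using rho_in by blast
  qed
qed

end

section \<open>Rank two and uniqueness of chambers\<close>

text \<open>The objects met on turning around the codimension two face on which the simple roots at
  \<open>i\<close> and \<open>j\<close> vanish, leaving \<open>a\<close> through the wall
  \<open>i\<close>.\<close>

fun alt :: "('i, 'a) cartan_data \<Rightarrow> 'a \<Rightarrow> 'i \<Rightarrow> 'i \<Rightarrow> nat \<Rightarrow> 'a"
  where
    "alt C a i j 0 = a"
  | "alt C a i j (Suc n) = rho C (if even n then i else j) (alt C a i j n)"

lemma alt_add:
  "alt C a i j (m + n) =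
     alt C (alt C a i j m) (if even m then i else j) (if even m then j else i) n"
  by (induction n) auto

text \<open>The composite applies \<open>rho C j\<close> first, so the turn starts with
  \<open>j\<close>. This swap reappears whenever (R4) is used or proved.\<close>

lemma alt_funpow: "((rho C i \<circ> rho C j) ^^ m) a = alt C a j i (2 * m)"
  by (induction m) auto

context prerealization
begin

lemma alt_in: "a \<in> objs C \<Longrightarrow> i \<in> I \<Longrightarrow> j \<in> I \<Longrightarrow> alt C a i j n \<in> objs C"
  by (induction n) (auto intro: rho_in)

text \<open>The rank two subsystem, described by vanishing coordinates instead of a span. Crossing
  the walls \<open>i\<close> and \<open>j\<close> leaves these coordinates unchanged, so one set
  serves all objects of the turn.\<close>

definition plane :: "'a \<Rightarrow> 'i \<Rightarrow> 'i \<Rightarrow> 'v set"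
  where "plane a i j = {\<alpha> \<in> R. \<forall>k\<in>I - {i, j}. co a \<alpha> k = 0}"

lemma plane_commute: "plane a i j = plane a j i"
  unfolding plane_def by (simp add: insert_commute)

lemma co_alt:
  assumes "a \<in> objs C" "i \<in> I" "j \<in> I" "k \<in> I - {i, j}" "\<alpha> \<in> R"
  shows "co (alt C a i j n) \<alpha> k = co a \<alpha> k"
proof (induction n)
  case (Suc n)
  then show ?case using assms by (auto simp: co_step[OF alt_in[OF assms(1-3)]])
qed simp

lemma plane_alt:
  assumes "a \<in> objs C" "i \<in> I" "j \<in> I"
  shows "plane (alt C a i j n) i j = plane a i j"
  unfolding plane_def
  by (intro Collect_cong conj_cong refl ball_cong) (simp add: co_alt[OF assms])

lemma plane_basis:
  assumes "a \<in> objs C" "i \<in> I" "j \<in> I"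
  shows "L a i \<in> plane a i j" "L a j \<in> plane a i j"
  using assms by (auto simp: plane_def L_in crd_basis[OF base[OF assms(1)] finite_idx])

lemma plane_uminus:
  assumes "a \<in> objs C" "\<alpha> \<in> plane a i j"
  shows "- \<alpha> \<in> plane a i j"
  using assms by (auto simp: plane_def sym_R crd_uminus[OF base[OF assms(1)]])

lemma plane_sum:
  assumes "a \<in> objs C" "\<alpha> \<in> plane a i j" "i \<in> I" "j \<in> I" "i \<noteq> j"
  shows "\<alpha> = of_int (co a \<alpha> i) *\<^sub>R L a i + of_int (co a \<alpha> j) *\<^sub>R L a j"
proof -
  have aR: "\<alpha> \<in> R" and z: "\<And>k. k \<in> I - {i, j} \<Longrightarrow> co a \<alpha> k = 0"
    using assms(2) by (auto simp: plane_def)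
  have "\<alpha> = (\<Sum>k\<in>I. of_int (co a \<alpha> k) *\<^sub>R L a k)" by (rule crd_sum[OF base[OF assms(1)] aR])
  also have "\<dots> = (\<Sum>k\<in>{i, j}. of_int (co a \<alpha> k) *\<^sub>R L a k)"
    using z finite_idx assms by (intro sum.mono_neutral_right) auto
  finally show ?thesis using assms(5) by simp
qed

text \<open>Its cardinality is the number \<open>m\<close> of (R4), as \<open>card_rank_two\<close>
  shows; it is also the number of steps in half a turn.\<close>

definition pp :: "'a \<Rightarrow> 'i \<Rightarrow> 'i \<Rightarrow> 'v set"
  where "pp a i j = pos a \<inter> plane a i j"

lemma finite_pp: "finite (pp a i j)" unfolding pp_def using finite_pos by simp

text \<open>Counting starts at 0: the root \<gamma>_n spans the wall between the objects number n
  and n + 1 of the turn. At the latter object its negative keeps the label, which gives the second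
  basis vector of the plane there.\<close>

definition crossed :: "'a \<Rightarrow> 'i \<Rightarrow> 'i \<Rightarrow> nat \<Rightarrow> 'v"
  where "crossed a i j n = L (alt C a i j n) (if even n then i else j)"

lemma crossed_other:
  assumes "a \<in> objs C" "i \<in> I" "j \<in> I"
  shows "L (alt C a i j (Suc n)) (if even n then i else j) = - crossed a i j n"
  unfolding crossed_def alt.simps using assms by (intro step_self alt_in) auto

lemma crossed_in_plane:
  assumes "a \<in> objs C" "i \<in> I" "j \<in> I"
  shows "crossed a i j n \<in> plane a i j"
  unfolding crossed_def using plane_basis[OF alt_in[OF assms, of n] assms(2,3)] plane_alt[OF assms]
  by auto

lemma pos_if_nonneg_combination:
  assumes "a \<in> objs C" "\<beta> \<in> pos a" "\<gamma> \<in> pos a" "x \<ge> 0" "y \<ge> 0" "\<alpha> \<in> R"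
    "\<alpha> = of_int x *\<^sub>R \<beta> + of_int y *\<^sub>R \<gamma>"
  shows "\<alpha> \<in> pos a"
proof -
  have R: "\<beta> \<in> R" "\<gamma> \<in> R" using assms pos_R by auto
  let ?z = "\<lambda>k. x * co a \<beta> k + y * co a \<gamma> k"
  have "\<alpha> = of_int x *\<^sub>R (\<Sum>k\<in>I. of_int (co a \<beta> k) *\<^sub>R L a k)
         + of_int y *\<^sub>R (\<Sum>k\<in>I. of_int (co a \<gamma> k) *\<^sub>R L a k)"
    using crd_sum[OF base[OF assms(1)] R(1)] crd_sum[OF base[OF assms(1)] R(2)] assms(7) by simp
  also have "\<dots> = (\<Sum>k\<in>I. of_int (?z k) *\<^sub>R L a k)"
    by (simp add: scaleR_sum_right scaleR_add_left sum.distrib)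
  finally have eq: "\<alpha> = (\<Sum>k\<in>I. of_int (?z k) *\<^sub>R L a k)" .
  have "co a \<alpha> k = ?z k" if "k \<in> I" for k
    by (rule crd_unique[OF base[OF assms(1)], where x = ?z, OF eq that])
  then show ?thesis using assms by (auto simp: pos_def)
qed

text \<open>
  Once a crossed root \<open>\<gamma>\<^sub>n\<close> is negative at \<open>a\<close> while \<open>\<gamma>\<^sub>n\<^sub>-\<^sub>1\<close> is positive, the basis
  \<open>{\<gamma>\<^sub>n, - \<gamma>\<^sub>n\<^sub>-\<^sub>1}\<close> of the plane is negative at \<open>a\<close>, so all positive roots have been crossed.
\<close>

lemma alt_inversions:
  assumes a: "a \<in> objs C" and ij: "i \<in> I" "j \<in> I" "i \<noteq> j" and n: "n \<le> card (pp a i j)"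
  shows "crossed a i j ` {..<n} = pp a i j - pos (alt C a i j n) \<and>
         inj_on (crossed a i j) {..<n}"
  using n
proof (induction n)
  case 0
  then show ?case by (auto simp: pp_def)
next
  case (Suc n)
  let ?g = "crossed a i j" and ?P = "pp a i j" and ?b = "alt C a i j"
  let ?s = "if even n then i else j" and ?t = "if even n then j else i"
  have IH: "?g ` {..<n} = ?P - pos (?b n)" "inj_on ?g {..<n}" using Suc by auto
  have b: "?b n \<in> objs C" by (rule alt_in[OF a ij(1,2)])
  have s: "?s \<in> I" using ij by auto
  \<comment> \<open>Only \<open>n\<close> of more than \<open>n\<close> roots have been crossed, so
    some positive root \<alpha> of the plane is still positive. Its sign yields the contradiction if
    the next crossed root was negative at \<open>a\<close>.\<close>
  have "card (?P - pos (?b n)) = n" using IH card_image by fastforce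
  with Suc.prems have "?P \<inter> pos (?b n) \<noteq> {}"
    by (metis Diff_triv Suc_n_not_le_n)
  then obtain \<alpha> where al: "\<alpha> \<in> ?P" "\<alpha> \<in> pos (?b n)" by auto
  have gR: "?g n \<in> R" using crossed_in_plane[OF a ij(1,2)] by (auto simp: plane_def)
  have gp: "?g n \<in> pos (?b n)" unfolding crossed_def by (rule pos_self[OF b s])
  have gP: "?g n \<in> ?P"
  proof (cases n)
    case 0
    then show ?thesis using a ij by (simp add: crossed_def pp_def pos_self plane_basis)
  next
    case (Suc k)
    show ?thesis
    proof (rule ccontr)
      assume "?g n \<notin> ?P"
      then have 1: "- ?g n \<in> pos a"
        using crossed_in_plane[OF a ij(1,2), of n] pos_uminus[OF a gR] by (simp add: pp_def)
      have 2: "?g k \<in> pos a" using IH Suc by (auto simp: pp_def)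
      have pl: "\<alpha> \<in> plane (?b n) ?s ?t"
        using al plane_alt[OF a ij(1,2), of n] by (auto simp: pp_def plane_commute)
      have t: "L (?b n) ?t = - ?g k" using crossed_other[OF a ij(1,2), of k] Suc by auto
      have "\<alpha> = of_int (co (?b n) \<alpha> ?s) *\<^sub>R L (?b n) ?s + of_int (co (?b n) \<alpha> ?t) *\<^sub>R L (?b n) ?t"
        by (rule plane_sum[OF b pl]) (use ij in auto)
      then have eq: "- \<alpha> = of_int (co (?b n) \<alpha> ?s) *\<^sub>R (- ?g n) + of_int (co (?b n) \<alpha> ?t) *\<^sub>R ?g k"
        unfolding t crossed_def[symmetric]
        by (drule_tac arg_cong[of _ _ uminus])
          (simp only: minus_add_distrib scaleR_minus_right minus_minus)
      have nn: "co (?b n) \<alpha> ?s \<ge> 0" "co (?b n) \<alpha> ?t \<ge> 0" and aR: "\<alpha> \<in> R"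
        using al(2) ij by (auto simp: pos_def)
      have "- \<alpha> \<in> pos a"
        by (rule pos_if_nonneg_combination[OF a 1 2 nn sym_R[OF aR] eq])
      then show False using pos_uminus[OF a aR] al(1) by (auto simp: pp_def)
    qed
  qed
  have new: "?g n \<notin> ?g ` {..<n}" using IH gp by auto
  have ps: "pos (?b (Suc n)) = insert (- ?g n) (pos (?b n) - {?g n})"
    using pos_step[OF b s] by (simp add: crossed_def)
  have "- ?g n \<notin> ?P" using gP pos_uminus[OF a gR] by (auto simp: pp_def)
  then have "?P - pos (?b (Suc n)) = insert (?g n) (?P - pos (?b n))"
    unfolding ps using gP by auto
  then show ?case using IH new by (auto simp: lessThan_Suc)
qed

text \<open>After \<open>m\<close> crossings every positive root of the plane has become negative.
  The negated basis of the plane then consists of positive roots and generates all others with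
  natural coefficients, so it is the simple basis at \<open>a\<close> again; what remains is to see
  which vector is which.\<close>

lemma alt_half_turn:
  assumes a: "a \<in> objs C" and ij: "i \<in> I" "j \<in> I" "i \<noteq> j" and m: "m = card (pp a i j)"
  shows "L (alt C a i j m) (if even m then i else j) = - L a i"
    "L (alt C a i j m) (if even m then j else i) = - L a j"
    "card (pp (alt C a i j m) i j) = m" "m \<ge> 2"
proof -
  let ?g = "crossed a i j" and ?P = "pp a i j" and ?b = "alt C a i j"
  have b: "?b m \<in> objs C" by (rule alt_in[OF a ij(1,2)])
  have inv: "?g ` {..<m} = ?P - pos (?b m)" "inj_on ?g {..<m}"
    using alt_inversions[OF a ij, of m] m by auto
  have "card (?P - pos (?b m)) = card ?P" using inv card_image m by fastforce
  then have "?P - pos (?b m) = ?P" by (intro card_subset_eq finite_pp) auto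
  then have disj: "?P \<inter> pos (?b m) = {}" and gP: "?g ` {..<m} = ?P" using inv by auto
  have inP: "L a i \<in> ?P" "L a j \<in> ?P" using a ij by (auto simp: pp_def pos_self plane_basis)
  have neq: "L a i \<noteq> L a j" using lbase_inj[OF base[OF a] finite_idx] ij by (auto dest: inj_onD)
  have "card {L a i, L a j} \<le> card ?P" using inP by (intro card_mono finite_pp) auto
  with neq m show m2: "m \<ge> 2" by simp
  have flip: "- \<alpha> \<in> ?P" if "\<alpha> \<in> pos (?b m)" "\<alpha> \<in> plane a i j" for \<alpha>
  proof -
    have "\<alpha> \<notin> pos a" using that disj by (auto simp: pp_def)
    then show ?thesis using that pos_uminus[OF a, of \<alpha>] plane_uminus[OF a] subsetD[OF pos_R that(1)]
      by (auto simp: pp_def)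
  qed
  have flip': "- \<alpha> \<in> pos (?b m)" if "\<alpha> \<in> ?P" for \<alpha>
    using that disj pos_uminus[OF b, of \<alpha>] subsetD[OF pos_R, of \<alpha>] by (auto simp: pp_def)
  have pm: "pp (?b m) i j = uminus ` ?P"
  proof
    show "pp (?b m) i j \<subseteq> uminus ` ?P"
      using flip unfolding pp_def plane_alt[OF a ij(1,2)]
      by (intro subsetI) (metis IntE add.inverse_inverse image_eqI Int_iff)
    show "uminus ` ?P \<subseteq> pp (?b m) i j"
      using flip' plane_uminus[OF a] unfolding pp_def plane_alt[OF a ij(1,2)] by auto
  qed
  have "card (uminus ` ?P) = card ?P" by (intro card_image) (auto simp: inj_on_def)
  then show "card (pp (?b m) i j) = m" unfolding pm using m by simp
  let ?s = "if even m then i else j" and ?t = "if even m then j else i"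
  \<comment> \<open>\<open>u\<close> belongs to the letter that would be crossed next,
    \<open>v\<close> to the letter crossed last.\<close>
  define u where "u = - L (?b m) ?s"
  define v where "v = - L (?b m) ?t"
  have uP: "u \<in> ?P" unfolding u_def using ij plane_alt[OF a ij(1,2)] plane_basis[OF b ij(1,2)]
    by (intro flip pos_self b) auto
  have vP: "v \<in> ?P" unfolding v_def using ij plane_alt[OF a ij(1,2)] plane_basis[OF b ij(1,2)]
    by (intro flip pos_self b) auto
  have vg: "v = ?g (m - 1)" using crossed_other[OF a ij(1,2), of "m - 1"] m2 by (auto simp: v_def)
  have comb: "\<exists>x y. x \<ge> 0 \<and> y \<ge> 0 \<and> \<alpha> = of_int x *\<^sub>R u + of_int y *\<^sub>R v" if "\<alpha> \<in> ?P" for \<alpha>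
  proof -
    have nP: "- \<alpha> \<in> pos (?b m)" "- \<alpha> \<in> plane (?b m) ?s ?t"
      using flip'[OF that] plane_uminus[OF a] that plane_alt[OF a ij(1,2), of m]
      by (auto simp: pp_def plane_commute)
    have "- \<alpha> = of_int (co (?b m) (- \<alpha>) ?s) *\<^sub>R L (?b m) ?s + of_int (co (?b m) (- \<alpha>) ?t) *\<^sub>R L (?b m) ?t"
      by (rule plane_sum[OF b nP(2)]) (use ij in auto)
    then have "- \<alpha> = - (of_int (co (?b m) (- \<alpha>) ?s) *\<^sub>R u + of_int (co (?b m) (- \<alpha>) ?t) *\<^sub>R v)"
      unfolding u_def v_def by (simp only: minus_add_distrib scaleR_minus_right minus_minus)
    then have "\<alpha> = of_int (co (?b m) (- \<alpha>) ?s) *\<^sub>R u + of_int (co (?b m) (- \<alpha>) ?t) *\<^sub>R v"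
      by (simp only: neg_equal_iff_equal)
    moreover have "co (?b m) (- \<alpha>) ?s \<ge> 0" "co (?b m) (- \<alpha>) ?t \<ge> 0" using nP(1) ij by (auto simp: pos_def)
    ultimately show ?thesis by blast
  qed
  \<comment> \<open>The vector \<open>L a k\<close> is a natural combination of \<open>u\<close> and
    \<open>v\<close>, whose coordinates at \<open>a\<close> are nonnegative. Its coordinate at the
    other label \<open>l\<close> is 0 without cancellation, so one of \<open>u\<close>,
    \<open>v\<close> has no component there and equals \<open>L a k\<close> by reducedness.\<close>
  have simple: "u = L a k \<or> v = L a k" if k: "k \<in> {i, j}" for k
  proof -
    define l where "l = (if k = i then j else i)"
    have kl: "k \<in> I" "l \<in> I" "k \<noteq> l" "{i, j} = {k, l}" using k ij by (auto simp: l_def)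
    obtain x y where xy: "x \<ge> 0" "y \<ge> 0" "L a k = of_int x *\<^sub>R u + of_int y *\<^sub>R v"
      using comb[of "L a k"] inP k by auto
    have nn: "co a \<beta> r \<ge> 0" if "\<beta> \<in> ?P" "r \<in> I" for \<beta> r using that by (auto simp: pp_def pos_def)
    have R: "u \<in> R" "v \<in> R" using uP vP by (auto simp: pp_def pos_def)
    let ?z = "\<lambda>r. x * co a u r + y * co a v r"
    have "L a k = of_int x *\<^sub>R (\<Sum>r\<in>I. of_int (co a u r) *\<^sub>R L a r)
         + of_int y *\<^sub>R (\<Sum>r\<in>I. of_int (co a v r) *\<^sub>R L a r)"
      using crd_sum[OF base[OF a] R(1)] crd_sum[OF base[OF a] R(2)] xy(3) by simp
    also have "\<dots> = (\<Sum>r\<in>I. of_int (?z r) *\<^sub>R L a r)"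
      by (simp add: scaleR_sum_right scaleR_add_left sum.distrib)
    finally have eq: "L a k = (\<Sum>r\<in>I. of_int (?z r) *\<^sub>R L a r)" .
    have z: "?z r = (if r = k then 1 else 0)" if "r \<in> I" for r
      using crd_unique[OF base[OF a], where x = ?z, OF eq that] crd_basis[OF base[OF a] finite_idx kl(1) that]
      by simp
    have single: "\<beta> = L a k" if "\<beta> \<in> ?P" "co a \<beta> l = 0" for \<beta>
    proof -
      have "\<forall>r\<in>I - {k}. co a \<beta> r = 0" using that kl(4) by (auto simp: pp_def plane_def)
      then have "\<beta> = L a k \<or> \<beta> = - L a k"
        using root_single_support[OF a _ kl(1), of \<beta>] that by (auto simp: pp_def pos_def)
      moreover have "- L a k \<notin> pos a" using pos_uminus[OF a L_in[OF a kl(1)]] pos_self[OF a kl(1)] by simp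
      ultimately show ?thesis using that by (auto simp: pp_def)
    qed
    have "x * co a u l + y * co a v l = 0" using z[OF kl(2)] kl(3) by auto
    then have zl: "x * co a u l = 0" "y * co a v l = 0"
      using xy(1,2) nn[OF uP kl(2)] nn[OF vP kl(2)]
      by (metis add_nonneg_eq_0_iff mult_nonneg_nonneg)+
    have "x \<noteq> 0 \<or> y \<noteq> 0" using z[OF kl(1)] by auto
    with zl have "co a u l = 0 \<or> co a v l = 0" by auto
    then show ?thesis using single[OF uP] single[OF vP] by auto
  qed
  have g0: "?g 0 = L a i" by (simp add: crossed_def)
  \<comment> \<open>\<open>v\<close> is the last crossed root and \<open>L a i\<close> the first;
    the crossed roots are distinct and there are at least two of them. This settles the
    matching.\<close>
  have vi: "v \<noteq> L a i"
  proof
    assume "v = L a i"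
    then have "?g (m - 1) = ?g 0" using vg g0 by simp
    then have "m - 1 = 0" using inj_onD[OF inv(2)] m2 by fastforce
    with m2 show False by simp
  qed
  then have ui: "u = L a i" using simple[of i] by auto
  then have vj: "v = L a j" using simple[of j] neq by auto
  show "L (?b m) ?s = - L a i" using ui by (simp add: u_def minus_equation_iff)
  show "L (?b m) ?t = - L a j" using vj by (simp add: v_def minus_equation_iff)
qed

text \<open>Coordinates off \<open>{i, j}\<close> are constant along the turn, so the vector
  labelled \<open>k\<close> keeps its coordinate 1 at \<open>k\<close> and can only move within the
  plane.\<close>

lemma alt_plane_congruent:
  assumes "a \<in> objs C" "i \<in> I" "j \<in> I" "i \<noteq> j" "k \<in> I - {i, j}"
  shows "\<exists>x y::int. L (alt C a i j n) k = L a k + of_int x *\<^sub>R L a i + of_int y *\<^sub>R L a j"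
proof -
  let ?\<beta> = "L (alt C a i j n) k"
  have bR: "?\<beta> \<in> R" using L_in[OF alt_in[OF assms(1-3)]] assms(5) by simp
  have c: "co a ?\<beta> r = (if r = k then 1 else 0)" if "r \<in> I - {i, j}" for r
    using co_alt[OF assms(1-3) that bR, of n] that assms(5)
      crd_basis[OF base[OF alt_in[OF assms(1-3), of n]] finite_idx] by auto
  have "?\<beta> = (\<Sum>r\<in>I. of_int (co a ?\<beta> r) *\<^sub>R L a r)" by (rule crd_sum[OF base[OF assms(1)] bR])
  also have "\<dots> = (\<Sum>r\<in>{i, j, k}. of_int (co a ?\<beta> r) *\<^sub>R L a r)"
    using c assms by (intro sum.mono_neutral_right finite_idx) auto
  also have "\<dots> = L a k + of_int (co a ?\<beta> i) *\<^sub>R L a i + of_int (co a ?\<beta> j) *\<^sub>R L a j"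
    using assms(4,5) c[of k] by auto
  finally show ?thesis by blast
qed

text \<open>Two half turns negate the basis of the plane twice. A vector with another label
  \<open>k\<close> differs from \<open>L a k\<close> by an element of the plane; expressing each of
  the two by the basis containing the other, next to the coefficient 1 at \<open>k\<close>, forces
  both this element and its negative to have nonnegative coefficients.\<close>

lemma alt_full_turn:
  assumes a: "a \<in> objs C" and ij: "i \<in> I" "j \<in> I" "i \<noteq> j" and k: "k \<in> I"
  shows "L (alt C a i j (2 * card (pp a i j))) k = L a k"
proof -
  define m where "m = card (pp a i j)"
  let ?b = "alt C a i j m" and ?s = "if even m then i else j" and ?t = "if even m then j else i"
  let ?c = "alt C a i j (2 * m)"
  have b: "?b \<in> objs C" and c: "?c \<in> objs C" by (simp_all add: alt_in[OF a ij(1,2)])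
  \<comment> \<open>The second half starts with the letter given by the parity of \<open>m\<close>,
    hence the exchanged roles of \<open>i\<close> and \<open>j\<close> for odd
    \<open>m\<close>.\<close>
  have c_eq: "?c = alt C ?b ?s ?t m" using alt_add[of C a i j m m] by (simp add: mult_2)
  note h1 = alt_half_turn[OF a ij m_def]
  have mb: "m = card (pp ?b ?s ?t)" using h1(3) by (auto simp: pp_def plane_commute)
  have st: "?s \<in> I" "?t \<in> I" "?s \<noteq> ?t" using ij by auto
  note h2 = alt_half_turn[OF b st mb]
  have "L ?c i = - L ?b ?s" "L ?c j = - L ?b ?t"
    unfolding c_eq using h2(1,2) by (auto split: if_splits)
  then have cij: "L ?c i = L a i" "L ?c j = L a j" unfolding h1(1,2) by simp_all
  show ?thesis
  proof (cases "k \<in> {i, j}")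
    case False
    with k have k': "k \<in> I - {i, j}" by simp
    obtain x y :: int where xy: "L ?c k = L a k + of_int x *\<^sub>R L a i + of_int y *\<^sub>R L a j"
      using alt_plane_congruent[OF a ij k'] by blast
    have nonneg: "x \<ge> 0 \<and> y \<ge> 0"
      if "d \<in> objs C" "\<beta> \<in> R" "\<beta> = L d k + of_int x *\<^sub>R L d i + of_int y *\<^sub>R L d j" for d \<beta> x y
    proof -
      let ?z = "\<lambda>r. if r = k then 1 else if r = i then x else if r = j then y else 0"
      have "(\<Sum>r\<in>I. of_int (?z r) *\<^sub>R L d r) = (\<Sum>r\<in>{i, j, k}. of_int (?z r) *\<^sub>R L d r)"
        using ij k by (intro sum.mono_neutral_right finite_idx) auto
      also have "\<dots> = \<beta>" using that(3) False ij(3) by (auto simp: algebra_simps)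
      finally have "\<beta> = (\<Sum>r\<in>I. of_int (?z r) *\<^sub>R L d r)" by simp
      note z = crd_unique[OF base[OF that(1)], where x = ?z, OF this]
      from z[OF k] z[OF ij(1)] z[OF ij(2)] have "co d \<beta> k = 1" "co d \<beta> i = x" "co d \<beta> j = y"
        using False ij(3) by auto
      then show ?thesis using crd_sign[OF base[OF that(1)] that(2)] ij k by force
    qed
    have "x \<ge> 0 \<and> y \<ge> 0" using nonneg[OF a L_in[OF c k] xy] .
    moreover have "L a k = L ?c k + of_int (- x) *\<^sub>R L ?c i + of_int (- y) *\<^sub>R L ?c j"
      unfolding cij xy by simp
    from nonneg[OF c L_in[OF a k] this] have "- x \<ge> 0 \<and> - y \<ge> 0" .
    ultimately have "x = 0" "y = 0" by auto
    with xy show ?thesis by (simp add: m_def)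
  qed (use cij in \<open>auto simp: m_def\<close>)
qed

text \<open>On a closed circle of length \<open>2 * m\<close>, going \<open>n\<close> steps one way
  ends where \<open>2 * m - n\<close> steps the other way end. For \<open>n = m\<close> the two half
  turns meet.\<close>

lemma alt_reverse:
  assumes a: "a \<in> objs C" and ij: "i \<in> I" "j \<in> I"
    and invol: "\<And>i a. i \<in> I \<Longrightarrow> a \<in> objs C \<Longrightarrow> rho C i (rho C i a) = a"
    and per: "alt C a j i (2 * m) = a" and n: "n \<le> 2 * m"
  shows "alt C a j i (2 * m - n) = alt C a i j n"
  using n
proof (induction n)
  case (Suc n)
  let ?k = "if even n then i else j"
  have eq: "2 * m - n = Suc (2 * m - Suc n)" using Suc.prems by simp
  \<comment> \<open>The parity ensures that the last step of the reversed turn crosses the same wall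
    as step \<open>n\<close> of the direct one, so the involution undoes it.\<close>
  have "even (2 * m - Suc n) \<longleftrightarrow> odd n" using Suc.prems by presburger
  then have "alt C a j i (2 * m - n) = rho C ?k (alt C a j i (2 * m - Suc n))"
    unfolding eq by auto
  then have "rho C ?k (alt C a i j n) = alt C a j i (2 * m - Suc n)"
    using Suc invol[of ?k] ij alt_in[OF a ij(2,1)] by auto
  then show ?case by auto
qed (use per in simp)

section \<open>Descents towards a functional and their confluence\<close>

definition descends :: "('v \<Rightarrow> real) \<Rightarrow> 'a \<Rightarrow> 'a \<Rightarrow> bool"
  where "descends h a b \<longleftrightarrow> a \<in> objs C \<and> (\<exists>i\<in>I. h (L a i) < 0 \<and> b = rho C i a)"

text \<open>The roots crossed in half a turn are positive at \<open>a\<close>, hence nonnegative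
  combinations of \<open>L a i\<close> and \<open>L a j\<close>. With \<open>h\<close> negative on
  both, every step of either half turn is a descent.\<close>

lemma descends_alt:
  assumes h: "linear h" and a: "a \<in> objs C" and ij: "i \<in> I" "j \<in> I" "i \<noteq> j"
    and lt: "h (L a i) < 0" "h (L a j) < 0" and n: "1 \<le> n" "n \<le> card (pp a i j)"
  shows "(descends h)\<^sup>*\<^sup>* (rho C i a) (alt C a i j n)"
  using n
proof (induction n rule: dec_induct)
  case (step n)
  have "crossed a i j n \<in> crossed a i j ` {..<Suc n}" by simp
  also have "\<dots> \<subseteq> pp a i j" using alt_inversions[OF a ij, of "Suc n"] step.prems by auto
  finally have p: "crossed a i j n \<in> pp a i j" .
  let ?\<alpha> = "crossed a i j n"
  have "?\<alpha> = of_int (co a ?\<alpha> i) *\<^sub>R L a i + of_int (co a ?\<alpha> j) *\<^sub>R L a j"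
    by (rule plane_sum[OF a _ ij]) (use p in \<open>auto simp: pp_def\<close>)
  from arg_cong[OF this, of h]
  have eq: "h ?\<alpha> = of_int (co a ?\<alpha> i) * h (L a i) + of_int (co a ?\<alpha> j) * h (L a j)"
    by (simp only: linear_add[OF h] linear_scale[OF h] real_scaleR_def)
  have nn: "co a ?\<alpha> i \<ge> 0" "co a ?\<alpha> j \<ge> 0" using p ij by (auto simp: pp_def pos_def)
  have "?\<alpha> \<in> R" using p by (auto simp: pp_def pos_def)
  then obtain k where "k \<in> I" "co a ?\<alpha> k \<noteq> 0" using co_nonzero[OF a] by blast
  moreover have "k = i \<or> k = j" using p calculation by (auto simp: pp_def plane_def)
  ultimately have "co a ?\<alpha> i > 0 \<or> co a ?\<alpha> j > 0" using nn by auto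
  then have "h ?\<alpha> < 0"
    unfolding eq
  proof
    assume "co a ?\<alpha> i > 0"
    with nn lt show "of_int (co a ?\<alpha> i) * h (L a i) + of_int (co a ?\<alpha> j) * h (L a j) < 0"
      by (intro add_neg_nonpos mult_pos_neg mult_nonneg_nonpos) auto
  next
    assume "co a ?\<alpha> j > 0"
    with nn lt show "of_int (co a ?\<alpha> i) * h (L a i) + of_int (co a ?\<alpha> j) * h (L a j) < 0"
      by (intro add_nonpos_neg mult_pos_neg mult_nonneg_nonpos) auto
  qed
  then have "descends h (alt C a i j n) (alt C a i j (Suc n))"
    unfolding descends_def crossed_def using alt_in[OF a ij(1,2)] ij by auto
  then show ?case using step by (meson Suc_leD rtranclp.rtrancl_into_rtrancl)
qed simp

lemma descent_end_exists:
  assumes "linear h" "a \<in> objs C"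
  shows "\<exists>e. (descends h)\<^sup>*\<^sup>* a e \<and> neg h e = {}"
  using assms(2)
proof (induction "card (neg h a)" arbitrary: a rule: less_induct)
  case less
  show ?case
  proof (cases "\<exists>i\<in>I. h (L a i) < 0")
    case False
    have "neg h a = {}"
    proof (rule ccontr)
      assume "neg h a \<noteq> {}"
      then obtain \<alpha> where al: "\<alpha> \<in> pos a" "h \<alpha> < 0" by (auto simp: neg_def)
      then have "h \<alpha> \<ge> 0" using False
        by (subst linear_crd[OF base[OF less.prems] _ assms(1)]) (auto simp: pos_def intro!: sum_nonneg)
      with al show False by simp
    qed
    then show ?thesis by blast
  next
    case True
    then obtain i where i: "i \<in> I" "h (L a i) < 0" by auto
    have "card (neg h (rho C i a)) < card (neg h a)"
      unfolding neg_step[OF less.prems i(1) assms(1) i(2)]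
      by (rule card_Diff1_less[OF finite_neg neg_step(2)[OF less.prems i(1) assms(1) i(2)]])
    from less.hyps[OF this rho_in[OF i(1) less.prems]] obtain e where
      e: "(descends h)\<^sup>*\<^sup>* (rho C i a) e" "neg h e = {}" by blast
    moreover have "descends h a (rho C i a)" using i less.prems by (auto simp: descends_def)
    ultimately show ?thesis by (meson converse_rtranclp_into_rtranclp)
  qed
qed

text \<open>
  Newman's lemma: the descents from \<open>a\<close> through \<open>i\<close> and \<open>j\<close> meet again half a turn around the
  common face of these two walls.
\<close>

lemma descent_end_unique:
  assumes h: "linear h"
    and invol: "\<And>i a. i \<in> I \<Longrightarrow> a \<in> objs C \<Longrightarrow> rho C i (rho C i a) = a"
    and per: "\<And>i j a. i \<in> I \<Longrightarrow> j \<in> I \<Longrightarrow> i \<noteq> j \<Longrightarrow> a \<in> objs C \<Longrightarrow> alt C a i j (2 * card (pp a i j)) = a"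
    and a: "a \<in> objs C"
  shows "(descends h)\<^sup>*\<^sup>* a e \<Longrightarrow> neg h e = {} \<Longrightarrow> (descends h)\<^sup>*\<^sup>* a e' \<Longrightarrow> neg h e' = {} \<Longrightarrow> e = e'"
  using a
proof (induction "card (neg h a)" arbitrary: a e e' rule: less_induct)
  case less
  note a = less.prems(5)
  have fin: "f = a" if "(descends h)\<^sup>*\<^sup>* a f" "neg h a = {}" for f
    using that(1)
  proof (cases rule: converse_rtranclpE)
    case (step y)
    then obtain i where "i \<in> I" "h (L a i) < 0" by (auto simp: descends_def)
    then have "L a i \<in> neg h a" using neg_step(2)[OF a _ h] by simp
    with that show ?thesis by simp
  qed simp
  show ?case
  proof (cases "neg h a = {}")
    case True
    with fin less.prems show ?thesis by metis
  next
    case False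
    have first: "\<exists>i\<in>I. h (L a i) < 0 \<and> (descends h)\<^sup>*\<^sup>* (rho C i a) f"
      if "(descends h)\<^sup>*\<^sup>* a f" "neg h f = {}" for f
      using that(1)
    proof (cases rule: converse_rtranclpE)
      case (step y)
      from step(1) obtain i where "i \<in> I" "h (L a i) < 0" "y = rho C i a"
        unfolding descends_def by blast
      with step(2) show ?thesis by blast
    qed (use False that(2) in simp)
    from first[OF less.prems(1,2)] obtain i where
      i: "i \<in> I" "h (L a i) < 0" "(descends h)\<^sup>*\<^sup>* (rho C i a) e" by blast
    from first[OF less.prems(3,4)] obtain j where
      j: "j \<in> I" "h (L a j) < 0" "(descends h)\<^sup>*\<^sup>* (rho C j a) e'" by blast
    have lt: "card (neg h (rho C k a)) < card (neg h a)" if "k \<in> I" "h (L a k) < 0" for k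
      unfolding neg_step[OF a that(1) h that(2)]
      by (rule card_Diff1_less[OF finite_neg neg_step(2)[OF a that(1) h that(2)]])
    show ?thesis
    proof (cases "i = j")
      case True
      with less.hyps[OF lt[OF i(1,2)] i(3) less.prems(2) _ less.prems(4) rho_in[OF i(1) a]] j(3)
      show ?thesis by simp
    next
      case neq: False
      define m where "m = card (pp a i j)"
      have m': "m = card (pp a j i)" by (simp add: m_def pp_def plane_commute)
      have m1: "1 \<le> m" using alt_half_turn(4)[OF a i(1) j(1) neq m_def] by simp
      have d1: "(descends h)\<^sup>*\<^sup>* (rho C i a) (alt C a i j m)"
        using descends_alt[OF h a i(1) j(1) neq i(2) j(2) m1] by (simp add: m_def)
      have d2: "(descends h)\<^sup>*\<^sup>* (rho C j a) (alt C a j i m)"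
        using descends_alt[OF h a j(1) i(1) neq[symmetric] j(2) i(2) m1] by (simp add: m')
      have "alt C a j i (2 * m - m) = alt C a i j m"
        by (rule alt_reverse[OF a i(1) j(1) invol])
          (use per[OF j(1) i(1) neq[symmetric] a] m' in auto)
      then have eq: "alt C a j i m = alt C a i j m" by (simp add: mult_2)
      obtain f where f: "(descends h)\<^sup>*\<^sup>* (alt C a i j m) f" "neg h f = {}"
        using descent_end_exists[OF h alt_in[OF a i(1) j(1)]] by blast
      have "e = f" using less.hyps[OF lt[OF i(1,2)] i(3) less.prems(2) _ f(2) rho_in[OF i(1) a]] d1 f(1)
        by (meson rtranclp_trans)
      moreover have "e' = f" using less.hyps[OF lt[OF j(1,2)] j(3) less.prems(4) _ f(2) rho_in[OF j(1) a]] d2 f(1)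
        unfolding eq by (meson rtranclp_trans)
      ultimately show ?thesis by simp
    qed
  qed
qed

text \<open>Every object on a walk from \<open>a\<close> descends to \<open>a\<close>: since
  \<open>h\<close> is nonzero on all roots, each step of the walk or its reverse is a descent, and
  in the first case uniqueness of the end carries the claim over. Thus \<open>b\<close> descends to
  \<open>a\<close>; but \<open>b\<close> is itself an end.\<close>

lemma chamber_unique:
  assumes h: "linear h" "\<And>\<alpha>. \<alpha> \<in> R \<Longrightarrow> h \<alpha> \<noteq> 0"
    and invol: "\<And>i a. i \<in> I \<Longrightarrow> a \<in> objs C \<Longrightarrow> rho C i (rho C i a) = a"
    and per: "\<And>i j a. i \<in> I \<Longrightarrow> j \<in> I \<Longrightarrow> i \<noteq> j \<Longrightarrow> a \<in> objs C \<Longrightarrow> alt C a i j (2 * card (pp a i j)) = a"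
    and a: "a \<in> objs C" "neg h a = {}" and b: "b \<in> objs C" "neg h b = {}"
  shows "a = b"
proof -
  have uniq: "e = e'" if "c \<in> objs C" "(descends h)\<^sup>*\<^sup>* c e" "neg h e = {}"
    "(descends h)\<^sup>*\<^sup>* c e'" "neg h e' = {}" for c e e'
    by (rule descent_end_unique[OF h(1) _ _ that(1,2,3,4,5)]) (fact invol, fact per)
  have *: "(descends h)\<^sup>*\<^sup>* (walk C a w) a" if "w \<in> lists I" for w
    using that
  proof (induction w rule: rev_induct)
    case (snoc i w)
    let ?c = "walk C a w"
    have w: "w \<in> lists I" and i: "i \<in> I" using snoc.prems by auto
    have IH: "(descends h)\<^sup>*\<^sup>* ?c a" by (rule snoc.IH[OF w])
    have c: "?c \<in> objs C" by (rule walk_in[OF a(1) w])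
    have ri: "rho C i ?c \<in> objs C" by (rule rho_in[OF i c])
    show ?case
    proof (cases "h (L ?c i) < 0")
      case True
      then have d: "descends h ?c (rho C i ?c)" using c i by (auto simp: descends_def)
      obtain e where e: "(descends h)\<^sup>*\<^sup>* (rho C i ?c) e" "neg h e = {}"
        using descent_end_exists[OF h(1) ri] by blast
      have "e = a"
        using uniq[OF c _ e(2) IH a(2)] converse_rtranclp_into_rtranclp[of "descends h", OF d e(1)] by blast
      with e show ?thesis by simp
    next
      case False
      then have "h (L (rho C i ?c) i) < 0"
        using h(2)[OF L_in[OF c i]] linear_neg[OF h(1)] by (auto simp: step_self[OF c i])
      then have "descends h (rho C i ?c) ?c" using ri i invol[OF i c] by (auto simp: descends_def)
      with IH show ?thesis by simp
    qed
  qed simp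
  obtain w where "w \<in> lists I" "b = walk C a w" using conn[OF a(1) b(1)] by blast
  with * have "(descends h)\<^sup>*\<^sup>* b a" by simp
  from uniq[OF b(1) this a(2) _ b(2)] show ?thesis by simp
qed

end

section \<open>The Cartan scheme of a realization\<close>

text \<open>
  The coefficient \<open>t\<close> is a coordinate of \<open>c' j\<close> with respect to \<open>c\<close> next to a coordinate 1, and
  \<open>- t\<close> is one of \<open>c j\<close> with respect to \<open>c'\<close>.
\<close>

lemma lbase_step_unique:
  assumes c: "lbase R I c" and c': "lbase R I c'" and fin: "finite I"
    and ij: "i \<in> I" "j \<in> I" "j \<noteq> i" and eq: "c' i = c i" "c' j = c j + of_int t *\<^sub>R c i"
  shows "t = 0"
proof -
  have *: "t \<ge> 0" if b: "lbase R I b" "v \<in> R" "v = b j + of_int t *\<^sub>R b i" for b v t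
  proof -
    let ?z = "\<lambda>k. if k = j then 1 else if k = i then t else 0"
    have "(\<Sum>k\<in>I. of_int (?z k) *\<^sub>R b k) = (\<Sum>k\<in>{i, j}. of_int (?z k) *\<^sub>R b k)"
      using ij fin by (intro sum.mono_neutral_right) auto
    also have "\<dots> = v" using that(3) ij by (simp add: add.commute)
    finally have "v = (\<Sum>k\<in>I. of_int (?z k) *\<^sub>R b k)" by simp
    note z = crd_unique[OF b(1), where x = ?z, OF this]
    from z[OF ij(1)] z[OF ij(2)] have "crd I b v i = t" "crd I b v j = 1" using ij(3) by auto
    then show ?thesis using crd_sign[OF b(1,2)] ij by force
  qed
  have "t \<ge> 0" by (rule *[OF c lbase_in[OF c' ij(2)] eq(2)])
  moreover have "c j = c' j + of_int (- t) *\<^sub>R c' i" unfolding eq by simp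
  then have "- t \<ge> 0" by (rule *[OF c' lbase_in[OF c ij(2)]])
  ultimately show ?thesis by simp
qed

section \<open>Morphisms of the Weyl groupoid as changes of coordinates\<close>

lemma weyl_hom_objs: "weyl_hom C a w b \<Longrightarrow> a \<in> objs C"
  by (induction rule: weyl_hom.induct)

lemma weyl_hom_walk:
  assumes "a \<in> objs C" "w \<in> lists (idx C)"
  shows "\<exists>f. weyl_hom C a f (walk C a w)"
  using assms(2)
proof (induction w rule: rev_induct)
  case Nil
  then show ?case using weyl_id[OF assms(1)] by auto
next
  case (snoc i w)
  then obtain f where "weyl_hom C a f (walk C a w)" by auto
  from weyl_comp[OF this, of i] snoc.prems show ?case by auto
qed

lemma weyl_hom_outside: "weyl_hom C a w b \<Longrightarrow> k \<notin> idx C \<Longrightarrow> w x k = x k"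
  by (induction rule: weyl_hom.induct) (auto simp: sigma_def unit_vec_def)

text \<open>The vector with integer coordinates \<open>x\<close> in the basis \<open>b\<close>. It
  mediates between the lattice, where the Weyl groupoid acts, and the space containing the
  roots.\<close>

definition comb :: "'i set \<Rightarrow> ('i \<Rightarrow> 'v::real_vector) \<Rightarrow> ('i \<Rightarrow> int) \<Rightarrow> 'v"
  where "comb I b x = (\<Sum>i\<in>I. of_int (x i) *\<^sub>R b i)"

lemma comb_unit_vec: "finite I \<Longrightarrow> i \<in> I \<Longrightarrow> comb I b (unit_vec i) = b i"
  unfolding comb_def unit_vec_def
  by (simp add: if_distrib[of of_int] if_distrib[of "\<lambda>x. x *\<^sub>R _"] cong: if_cong)

lemma comb_uminus: "comb I b (- x) = - comb I b x"
  by (simp add: comb_def sum_negf)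

text \<open>While the basis is changed by a step, \<open>sigma\<close> changes the coordinates; with
  the diagonal entry 2 both changes compensate, so the represented vector stays fixed.\<close>

lemma comb_sigma:
  assumes "finite (idx C)" "i \<in> idx C" "cart C a i i = 2"
    and "\<And>j. j \<in> idx C \<Longrightarrow> b' j = b j - of_int (cart C a i j) *\<^sub>R b i"
  shows "comb (idx C) b' (sigma C i a x) = comb (idx C) b x"
proof -
  let ?s = "\<Sum>j\<in>idx C. cart C a i j * x j"
  have "comb (idx C) b' (sigma C i a x)
      = (\<Sum>k\<in>idx C. of_int (x k) *\<^sub>R b' k) - (\<Sum>k\<in>idx C. of_int (?s * unit_vec i k) *\<^sub>R b' k)"
    unfolding comb_def sigma_def by (simp add: scaleR_diff_left sum_subtractf)
  also have "(\<Sum>k\<in>idx C. of_int (?s * unit_vec i k) *\<^sub>R b' k) = of_int ?s *\<^sub>R b' i"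
    unfolding unit_vec_def using assms(1,2)
    by (simp add: if_distrib[of of_int] if_distrib[of "\<lambda>x. x *\<^sub>R _"] if_distrib[of "(*) _"] cong: if_cong)
  also have "b' i = - b i" using assms(2-4) by (simp add: scaleR_2)
  also have "(\<Sum>k\<in>idx C. of_int (x k) *\<^sub>R b' k)
      = (\<Sum>k\<in>idx C. of_int (x k) *\<^sub>R (b k - of_int (cart C a i k) *\<^sub>R b i))"
    using assms by (intro sum.cong refl) simp
  also have "\<dots> = comb (idx C) b x - of_int ?s *\<^sub>R b i"
    unfolding comb_def by (simp add: scaleR_diff_right sum_subtractf scaleR_sum_left mult.commute)
  finally show ?thesis by simp
qed

context prerealization
begin

text \<open>A functional equal to 1 on the common basis leaves no negative root at either object, so
  both are the chamber of the same functional.\<close>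

lemma L_injective:
  assumes invol: "\<And>i a. i \<in> I \<Longrightarrow> a \<in> objs C \<Longrightarrow> rho C i (rho C i a) = a"
    and per: "\<And>i j a. i \<in> I \<Longrightarrow> j \<in> I \<Longrightarrow> i \<noteq> j \<Longrightarrow> a \<in> objs C \<Longrightarrow> alt C a i j (2 * card (pp a i j)) = a"
    and a: "a \<in> objs C" and b: "b \<in> objs C" and eq: "\<And>i. i \<in> I \<Longrightarrow> L a i = L b i"
  shows "a = b"
proof -
  obtain h where h: "linear h" "\<And>i. i \<in> I \<Longrightarrow> h (L a i) = (1::real)" "\<And>\<alpha>. \<alpha> \<in> R \<Longrightarrow> h \<alpha> \<noteq> 0"
    using functional_exists[OF a] by metis
  have e: "neg h c = {}" if c: "c \<in> objs C" "\<And>i. i \<in> I \<Longrightarrow> h (L c i) = 1" for c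
  proof -
    have "h \<alpha> \<ge> 0" if "\<alpha> \<in> pos c" for \<alpha>
      using that c(2)
      by (subst linear_crd[OF base[OF c(1)] _ h(1)]) (auto simp: pos_def intro!: sum_nonneg)
    then show ?thesis unfolding neg_def by (metis (mono_tags, lifting) Collect_empty_eq not_le)
  qed
  show ?thesis
    by (rule chamber_unique[OF h(1,3) _ _ a e[OF a h(2)] b e[OF b]])
      (use eq h(2) in \<open>auto intro: invol per\<close>)
qed

abbreviation "val a \<equiv> comb I (L a)"

lemmas val_unit_vec = comb_unit_vec[OF finite_idx]

lemma val_inj: 
  assumes "a \<in> objs C" "val a x = val a y" "i \<in> I"
  shows "x i = y i"
  using lbase_eq_coords[OF base[OF assms(1)] assms(2)[unfolded comb_def] assms(3)] by simp

lemma val_inj_on: "a \<in> objs C \<Longrightarrow> inj_on (val a) (int_lattice I)"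
  by (rule inj_onI, rule ext) (metis (mono_tags, lifting) val_inj int_lattice_def mem_Collect_eq)

lemma co_val:
  assumes "a \<in> objs C" "i \<in> I"
  shows "co a (val a x) i = x i"
  by (rule crd_unique[OF base[OF assms(1)], where x = x, OF _ assms(2)]) (simp add: comb_def)

lemma val_sigma:
  assumes "a \<in> objs C" "i \<in> I"
  shows "val (rho C i a) (sigma C i a x) = val a x"
  by (rule comb_sigma[OF finite_idx assms(2) cart_diag[OF assms] step[OF assms]])

text \<open>A morphism from \<open>a\<close> to \<open>b\<close> rewrites coordinates for
  \<open>L a\<close> as coordinates for \<open>L b\<close>. On the lattice it is therefore
  determined by its ends, which gives simple connectedness.\<close>

lemma val_weyl_hom: "weyl_hom C a w b \<Longrightarrow> b \<in> objs C \<and> (\<forall>x. val b (w x) = val a x)"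
  by (induction rule: weyl_hom.induct) (auto simp: val_sigma rho_in)

lemma weyl_hom_self:
  assumes "weyl_hom C a w a"
  shows "w = id"
proof (intro ext)
  fix x k
  have a: "a \<in> objs C" by (rule weyl_hom_objs[OF assms])
  show "w x k = id x k"
  proof (cases "k \<in> I")
    case True
    show ?thesis using val_inj[OF a _ True, of "w x" x] val_weyl_hom[OF assms] by simp
  qed (simp add: weyl_hom_outside[OF assms])
qed

lemma sigma_sigma:
  assumes "a \<in> objs C" "i \<in> I" "rho C i (rho C i a) = a"
  shows "sigma C i (rho C i a) (sigma C i a x) = x"
proof -
  have "weyl_hom C a (sigma C i (rho C i a) \<circ> (sigma C i a \<circ> id)) (rho C i (rho C i a))"
    by (intro weyl_hom.intros assms)
  with assms(3) have "weyl_hom C a (sigma C i (rho C i a) \<circ> (sigma C i a \<circ> id)) a" by simp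
  from fun_cong[OF weyl_hom_self[OF this], of x] show ?thesis by simp
qed

text \<open>Since morphisms preserve represented vectors, \<open>w (unit_vec j)\<close> represents
  the basis vector \<open>L b j\<close> at the source of \<open>w\<close>. Conversely each root is a
  basis vector somewhere, and a walk from there to \<open>a\<close> supplies the morphism.\<close>

lemma real_roots_eq:
  assumes "a \<in> objs C"
  shows "real_roots C a = {x \<in> int_lattice I. val a x \<in> R}"
proof (intro equalityI subsetI)
  fix x assume "x \<in> real_roots C a"
  then obtain w j b where w: "x = w (unit_vec j)" "j \<in> I" "b \<in> objs C" "weyl_hom C b w a"
    by (auto simp: real_roots_def)
  have "val a x = L b j" using val_weyl_hom[OF w(4)] w(1,2) val_unit_vec by simp
  moreover have "x \<in> int_lattice I"
    unfolding int_lattice_def w(1) using weyl_hom_outside[OF w(4)] w(2) by (auto simp: unit_vec_def)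
  ultimately show "x \<in> {x \<in> int_lattice I. val a x \<in> R}" using L_in w by simp
next
  fix x assume x: "x \<in> {x \<in> int_lattice I. val a x \<in> R}"
  then obtain b j where b: "b \<in> objs C" "j \<in> I" "val a x = L b j" using root_is_simple by blast
  obtain u where "u \<in> lists I" "a = walk C b u" using conn[OF b(1) assms] by blast
  then obtain w where w: "weyl_hom C b w a" using weyl_hom_walk[OF b(1)] by blast
  have "val a (w (unit_vec j)) = val a x" using val_weyl_hom[OF w] b by (simp add: val_unit_vec)
  moreover have "w (unit_vec j) \<in> int_lattice I"
    unfolding int_lattice_def using weyl_hom_outside[OF w] b(2) by (auto simp: unit_vec_def)
  ultimately have "w (unit_vec j) = x" using inj_onD[OF val_inj_on[OF assms]] x by blast
  then show "x \<in> real_roots C a" unfolding real_roots_def using b w by blast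
qed

text \<open>Both numbers count the same roots, on the left by coordinates in the lattice as in (R4),
  on the right as roots crossed in half a turn; \<open>val a\<close> is the bijection.\<close>

lemma card_rank_two:
  assumes a: "a \<in> objs C" and ij: "i \<in> I" "j \<in> I" and neq: "i \<noteq> j"
  shows "card {x \<in> real_roots C a. \<exists>p q::nat. x = (\<lambda>k. int p * unit_vec i k + int q * unit_vec j k)}
    = card (pp a i j)" (is "card ?M = _")
proof -
  let ?F = "real_roots C a"
  note F = real_roots_eq[OF a]
  have "val a ` ?M = pp a i j"
  proof (intro equalityI subsetI)
    fix \<alpha> assume "\<alpha> \<in> val a ` ?M"
    then obtain p q :: nat and x where x: "\<alpha> = val a x" "x = (\<lambda>k. int p * unit_vec i k + int q * unit_vec j k)"
      "x \<in> ?F" by auto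
    then show "\<alpha> \<in> pp a i j" unfolding pp_def pos_def plane_def
      using co_val[OF a, of _ x] F by (auto simp: unit_vec_def)
  next
    fix \<alpha> assume al: "\<alpha> \<in> pp a i j"
    let ?x = "\<lambda>k. int (nat (co a \<alpha> i)) * unit_vec i k + int (nat (co a \<alpha> j)) * unit_vec j k"
    have nn: "co a \<alpha> i \<ge> 0" "co a \<alpha> j \<ge> 0" using al ij by (auto simp: pp_def pos_def)
    have "val a ?x = of_int (co a \<alpha> i) *\<^sub>R val a (unit_vec i) + of_int (co a \<alpha> j) *\<^sub>R val a (unit_vec j)"
      unfolding comb_def using nn by (simp add: scaleR_sum_right scaleR_add_left sum.distrib)
    also have "\<dots> = \<alpha>" unfolding val_unit_vec[OF ij(1)] val_unit_vec[OF ij(2)]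
      by (rule plane_sum[OF a _ ij neq, symmetric]) (use al in \<open>simp add: pp_def\<close>)
    finally have v: "val a ?x = \<alpha>" .
    have "?x \<in> ?F" unfolding F using v al ij by (auto simp: pp_def plane_def int_lattice_def unit_vec_def)
    then have "?x \<in> ?M" by blast
    from imageI[OF this, of "val a"] show "\<alpha> \<in> val a ` ?M" unfolding v .
  qed
  moreover have "inj_on (val a) ?M" by (rule inj_on_subset[OF val_inj_on[OF a]]) (auto simp: F)
  ultimately show ?thesis using card_image[of "val a" ?M] by simp
qed

lemma co_pair:
  assumes "a \<in> objs C" "i \<in> I" "j \<in> I" "i \<noteq> j" "\<beta> \<in> R"
    "\<beta> = of_int x *\<^sub>R L a i + of_int y *\<^sub>R L a j"
  shows "(x \<ge> 0 \<and> y \<ge> 0) \<or> (x \<le> 0 \<and> y \<le> 0)"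
proof -
  let ?z = "\<lambda>k. if k = i then x else if k = j then y else 0"
  have "val a ?z = (\<Sum>k\<in>{i, j}. of_int (?z k) *\<^sub>R L a k)"
    unfolding comb_def using assms finite_idx by (intro sum.mono_neutral_right) auto
  also have "\<dots> = \<beta>" using assms by simp
  finally have "val a ?z = \<beta>" .
  with co_val[OF assms(1,2), of ?z] co_val[OF assms(1,3), of ?z] assms(4)
  have "co a \<beta> i = x" "co a \<beta> j = y" by auto
  with crd_sign[OF base[OF assms(1)] assms(5)] assms(2,3) show ?thesis by force
qed

end

text \<open>Faithful labelling excludes proper covers; an object is now the same as its labelled
  basis.\<close>

locale realization = prerealization +
  assumes inj: "\<And>a b. a \<in> objs C \<Longrightarrow> b \<in> objs C \<Longrightarrow> (\<And>i. i \<in> idx C \<Longrightarrow> L a i = L b i) \<Longrightarrow> a = b"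
begin

text \<open>Crossing the wall \<open>i\<close> twice restores \<open>L a i\<close> and moves the
  other vectors by integer multiples of it, which \<open>lbase_step_unique\<close> shows to be 0.
  This is (C2); with injectivity it gives (C1).\<close>

lemma
  assumes a: "a \<in> objs C" and i: "i \<in> I"
  shows rho_rho: "rho C i (rho C i a) = a"
    and cart_rho: "j \<in> I \<Longrightarrow> cart C (rho C i a) i j = cart C a i j"
proof -
  let ?b = "rho C i a"
  have b: "?b \<in> objs C" by (rule rho_in[OF i a])
  have bb: "rho C i ?b \<in> objs C" by (rule rho_in[OF i b])
  have eq: "L (rho C i ?b) k = L a k + of_int (cart C ?b i k - cart C a i k) *\<^sub>R L a i" if "k \<in> I" for k
    unfolding step[OF b i that] step_self[OF a i] step[OF a i that]
    by (simp add: scaleR_diff_left)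
  have "L (rho C i ?b) i = L a i" using step_self[OF b i] step_self[OF a i] by simp
  then have z: "cart C ?b i k - cart C a i k = 0" if "k \<in> I" "k \<noteq> i" for k
    by (rule lbase_step_unique[OF base[OF a] base[OF bb] finite_idx i that _ eq[OF that(1)]])
  show c: "cart C ?b i j = cart C a i j" if "j \<in> I" for j
    using z[OF that] cart_diag[OF a i] cart_diag[OF b i] by (cases "j = i") auto
  show "rho C i ?b = a"
    by (rule inj[OF bb a]) (use eq c in simp)
qed

text \<open>In the basis at \<open>a\<close>, the new vector labelled \<open>j\<close> has
  coordinates \<open>- cart C a i j\<close> at \<open>i\<close> and 1 at \<open>j\<close>; sign
  coherence does the rest.\<close>

lemma cart_nonpos:
  assumes "a \<in> objs C" "i \<in> I" "j \<in> I" "i \<noteq> j"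
  shows "cart C a i j \<le> 0"
proof -
  have "L (rho C i a) j = of_int (- cart C a i j) *\<^sub>R L a i + of_int 1 *\<^sub>R L a j"
    using step[OF assms(1-3)] by simp
  from co_pair[OF assms L_in[OF rho_in[OF assms(2,1)] assms(3)] this] show ?thesis by auto
qed

text \<open>If crossing \<open>i\<close> fixes \<open>L a j\<close>, then
  \<open>L (rho C j a) i\<close>, written in the basis at \<open>rho C i a\<close>, has the
  coordinates -1 and \<open>- cart C a j i\<close>. So the entry is nonnegative, and it is
  nonpositive anyway.\<close>

lemma cart_zero:
  assumes "a \<in> objs C" "i \<in> I" "j \<in> I" "cart C a i j = 0"
  shows "cart C a j i = 0"
proof (cases "i = j")
  case False
  have "L (rho C i a) j = L a j" "L (rho C i a) i = - L a i"
    using step[OF assms(1-3)] assms(4) step_self[OF assms(1,2)] by auto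
  then have "L (rho C j a) i = of_int (- 1) *\<^sub>R L (rho C i a) i + of_int (- cart C a j i) *\<^sub>R L (rho C i a) j"
    using step[OF assms(1,3,2)] by simp
  from co_pair[OF rho_in[OF assms(2,1)] assms(2,3) False L_in[OF rho_in[OF assms(3,1)] assms(2)] this]
  show ?thesis using cart_nonpos[OF assms(1,3,2)] False by auto
qed (use assms in auto)

lemma is_cartan_scheme: "cartan_scheme C"
  unfolding cartan_scheme_def generalized_cartan_matrix_def
  using finite_idx idx_ne objs_ne
  by (auto simp: rho_in rho_rho cart_rho cart_diag cart_nonpos cart_zero)

lemma periodic:
  assumes "i \<in> I" "j \<in> I" "i \<noteq> j" "a \<in> objs C"
  shows "alt C a i j (2 * card (pp a i j)) = a"
  by (rule inj[OF alt_in[OF assms(4,1,2)] assms(4)]) (rule alt_full_turn[OF assms(4,1,2,3)])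

lemma is_connected: "connected_scheme C"
  unfolding connected_scheme_def
proof (intro ballI)
  fix a b assume ab: "a \<in> objs C" "b \<in> objs C"
  then obtain w where "w \<in> lists I" "b = walk C a w" using conn by blast
  then show "\<exists>w. weyl_hom C a w b" using weyl_hom_walk[OF ab(1)] by auto
qed

lemma is_simply_connected: "simply_connected_scheme C"
  unfolding simply_connected_scheme_def
  using weyl_hom_self by (auto intro: weyl_id)

lemma is_root_system: "root_system C (real_roots C)"
  unfolding root_system_def Let_def
proof (intro ballI conjI impI)
  fix a assume a: "a \<in> objs C"
  let ?F = "real_roots C a"
  note F = real_roots_eq[OF a]
  show "?F \<subseteq> int_lattice I" unfolding F by auto
  have um: "- x \<in> ?F" if "x \<in> ?F" for x
    using that sym_R unfolding F by (auto simp: comb_uminus int_lattice_def)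
  have sgn: "(\<forall>i\<in>I. x i \<ge> 0) \<or> (\<forall>i\<in>I. (- x) i \<ge> 0)" if "x \<in> ?F" for x
    using that crd_sign[OF base[OF a], of "val a x"] co_val[OF a] unfolding F by auto
  show "?F = {x \<in> ?F. \<forall>i\<in>I. x i \<ge> 0} \<union> uminus ` {x \<in> ?F. \<forall>i\<in>I. x i \<ge> 0}" (is "_ = ?P \<union> uminus ` ?P")
  proof (intro equalityI subsetI)
    fix x assume x: "x \<in> ?F"
    from sgn[OF x] show "x \<in> ?P \<union> uminus ` ?P"
    proof
      assume "\<forall>i\<in>I. (- x) i \<ge> 0"
      then have "- x \<in> ?P" using um[OF x] by blast
      then have "- (- x) \<in> uminus ` ?P" by (rule imageI)
      then show ?thesis by simp
    qed (use x in blast)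
  qed (use um in auto)
  show "?F \<inter> range (\<lambda>z k. z * unit_vec i k) = {unit_vec i, - unit_vec i}" if i: "i \<in> I" for i
  proof (intro equalityI subsetI)
    fix x assume x: "x \<in> ?F \<inter> range (\<lambda>z k. z * unit_vec i k)"
    then obtain z where z: "x = (\<lambda>k. z * unit_vec i k)" by auto
    have "val a x = of_int z *\<^sub>R val a (unit_vec i)"
      unfolding comb_def z by (simp add: scaleR_sum_right)
    then have "of_int z *\<^sub>R L a i \<in> R" using x i F by (auto simp: val_unit_vec)
    with reduced[OF L_in[OF a i]] have "z = 1 \<or> z = - 1"
      by (metis of_int_1 of_int_eq_iff of_int_minus)
    then show "x \<in> {unit_vec i, - unit_vec i}" using z by (auto simp: fun_eq_iff)
  next
    fix x assume x: "x \<in> {unit_vec i, - unit_vec i}"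
    have u: "unit_vec i \<in> ?F" unfolding F using i L_in[OF a i] val_unit_vec[OF i, of "L a"]
      by (auto simp: int_lattice_def unit_vec_def[of i])
    have "\<exists>z. x = (\<lambda>k. z * unit_vec i k)"
      using x by (elim insertE emptyE) (auto simp: fun_eq_iff intro: exI[of _ 1] exI[of _ "-1"])
    then show "x \<in> ?F \<inter> range (\<lambda>z k. z * unit_vec i k)" using x u um by auto
  qed
  show "sigma C i a ` ?F = real_roots C (rho C i a)" if i: "i \<in> I" for i
  proof -
    have sub: "sigma C i b ` real_roots C b \<subseteq> real_roots C (rho C i b)" if b: "b \<in> objs C" for b
      unfolding real_roots_eq[OF b] real_roots_eq[OF rho_in[OF i b]]
      using val_sigma[OF b i] i by (auto simp: int_lattice_def sigma_def unit_vec_def)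
    have b: "rho C i a \<in> objs C" by (rule rho_in[OF i a])
    show ?thesis
    proof (rule equalityI[OF sub[OF a]], rule subsetI)
      fix y assume "y \<in> real_roots C (rho C i a)"
      then have "sigma C i (rho C i a) y \<in> ?F" using sub[OF b] rho_rho[OF a i] by auto
      moreover have "sigma C i a (sigma C i (rho C i a) y) = y"
        using sigma_sigma[OF b i] rho_rho[OF b i] rho_rho[OF a i] by simp
      ultimately show "y \<in> sigma C i a ` ?F" by (metis imageI)
    qed
  qed
  fix i j assume ij: "i \<in> I" "j \<in> I"
  let ?M = "{x \<in> ?F. \<exists>p q::nat. x = (\<lambda>k. int p * unit_vec i k + int q * unit_vec j k)}"
  assume "i \<noteq> j \<and> finite ?M"
  then have neq: "i \<noteq> j" by simp
  \<comment> \<open>The count is symmetric in \<open>i\<close> and \<open>j\<close>, which absorbs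
    the exchange of letters in \<open>alt_funpow\<close>.\<close>
  have "card ?M = card (pp a j i)"
    unfolding card_rank_two[OF a ij neq] by (simp add: pp_def plane_commute)
  then show "((rho C i \<circ> rho C j) ^^ card ?M) a = a"
    unfolding alt_funpow using periodic[OF ij(2,1) neq[symmetric] a] by simp
qed

lemma finite_real_roots: "a \<in> objs C \<Longrightarrow> finite (real_roots C a)"
  unfolding real_roots_eq
  by (rule inj_on_finite[of "val a" _ R]) (auto intro: finite_R inj_on_subset[OF val_inj_on])

theorem in_cartan_class: "C \<in> cartan_class"
  unfolding cartan_class_def finite_root_system_def
  using is_cartan_scheme is_connected is_simply_connected is_root_system finite_real_roots by simp

end

section \<open>Equivalence of realized schemes\<close>

lemma (in prerealization) root_nonzero_if_positive:
  fixes h :: "'v \<Rightarrow> real"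
  assumes b: "lbase R J b" and fin: "finite J" and h: "linear h" "\<And>j. j \<in> J \<Longrightarrow> h (b j) > 0"
    and \<alpha>: "\<alpha> \<in> R"
  shows "h \<alpha> \<noteq> 0"
proof
  assume "h \<alpha> = 0"
  then have z: "(\<Sum>i\<in>J. of_int (crd J b \<alpha> i) * h (b i)) = 0"
    using linear_crd[OF b \<alpha> h(1)] by simp
  have "\<forall>i\<in>J. of_int (crd J b \<alpha> i) * h (b i) = 0"
    using crd_sign[OF b \<alpha>]
  proof
    assume "\<forall>i\<in>J. 0 \<le> crd J b \<alpha> i"
    then show ?thesis using z h(2) fin
      by (subst (asm) sum_nonneg_eq_0_iff) (auto simp: less_imp_le)
  next
    assume "\<forall>i\<in>J. crd J b \<alpha> i \<le> 0"
    moreover have "(\<Sum>i\<in>J. - (of_int (crd J b \<alpha> i) * h (b i))) = 0"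
      unfolding sum_negf z by simp
    ultimately show ?thesis using h(2) fin
      by (subst (asm) sum_nonneg_eq_0_iff) (auto simp: less_imp_le mult_nonpos_nonneg)
  qed
  then have "\<forall>i\<in>J. crd J b \<alpha> i = 0" using h(2) by fastforce
  then have "\<alpha> = 0" using crd_sum[OF b \<alpha>] by simp
  with \<alpha> zero_notin show False by simp
qed

lemma (in prerealization) lbase_is_object:
  fixes b :: "'j \<Rightarrow> 'v"
  assumes b: "lbase R J b" and fin: "finite J"
  shows "\<exists>a\<in>objs C. L a ` I = b ` J"
proof -
  obtain h :: "'v \<Rightarrow> real" where h: "linear h" "\<And>j. j \<in> J \<Longrightarrow> h (b j) = 1"
    using lbase_functional[OF assms] by blast
  have h0: "h \<alpha> \<noteq> 0" if "\<alpha> \<in> R" for \<alpha>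
    by (rule root_nonzero_if_positive[OF b fin h(1) _ that]) (simp add: h(2))
  obtain a0 where a0: "a0 \<in> objs C" using objs_ne by blast
  obtain w where w: "w \<in> lists I" "\<forall>i\<in>I. h (L (walk C a0 w) i) > 0"
    using walk_to_chamber[OF h(1) h0 a0] by blast
  let ?a = "walk C a0 w"
  have a: "?a \<in> objs C" by (rule walk_in[OF a0 w(1)])
  have "L ?a ` I \<subseteq> b ` J"
    by (rule lbase_subset[OF base[OF a] b finite_idx fin h(1) _ _ reduced]) (use w h in auto)
  moreover have "b ` J \<subseteq> L ?a ` I"
    by (rule lbase_subset[OF b base[OF a] fin finite_idx h(1) _ _ reduced]) (use w h in auto)
  ultimately show ?thesis using a by blast
qed

text \<open>It suffices to match one pair of objects, which \<open>lbase_is_object\<close> provides.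
  Matched bases stay matched across corresponding walls: the two new bases share one vector and
  differ elsewhere by multiples of it, so \<open>lbase_step_unique\<close> makes them equal and with
  them the Cartan entries.\<close>

theorem isomorphic_realizations_equiv:
  fixes C :: "('i, 'a) cartan_data" and C' :: "('j, 'b) cartan_data"
    and \<psi> :: "'v::real_vector \<Rightarrow> 'w::real_vector"
  assumes "realization C L R" and "realization C' L' (\<psi> ` R)"
    and psi: "linear \<psi>" "inj_on \<psi> (span R)"
  shows "cartan_equiv C C'"
proof -
  interpret A: realization C L R by fact
  interpret B: realization C' L' "\<psi> ` R" by fact
  obtain a0 where a0: "a0 \<in> objs C" using A.objs_ne by blast
  obtain b0 where b0: "b0 \<in> objs C'" "L' b0 ` idx C' = (\<lambda>i. \<psi> (L a0 i)) ` idx C"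
    using B.lbase_is_object[OF lbase_image[OF A.base[OF a0] psi] A.finite_idx] by blast
  define f where "f = (\<lambda>i. inv_into (idx C') (L' b0) (\<psi> (L a0 i)))"
  have f: "f i \<in> idx C'" "L' b0 (f i) = \<psi> (L a0 i)" if "i \<in> idx C" for i
  proof -
    have "\<psi> (L a0 i) \<in> L' b0 ` idx C'" unfolding b0(2) using that by blast
    then show "f i \<in> idx C'" "L' b0 (f i) = \<psi> (L a0 i)"
      unfolding f_def by (simp_all add: inv_into_into f_inv_into_f)
  qed
  have fbij: "bij_betw f (idx C) (idx C')"
    unfolding bij_betw_def
  proof
    show "inj_on f (idx C)"
    proof (rule inj_onI)
      fix i k assume ik: "i \<in> idx C" "k \<in> idx C" "f i = f k"
      then have "\<psi> (L a0 i) = \<psi> (L a0 k)" using f by metis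
      with lbase_inj[OF lbase_image[OF A.base[OF a0] psi] A.finite_idx] ik show "i = k"
        by (auto dest: inj_onD)
    qed
    show "f ` idx C = idx C'"
    proof
      show "idx C' \<subseteq> f ` idx C"
      proof
        fix j assume j: "j \<in> idx C'"
        then obtain i where i: "i \<in> idx C" "L' b0 j = \<psi> (L a0 i)" using b0(2) by blast
        with f[OF i(1)] have "L' b0 j = L' b0 (f i)" by simp
        then have "j = f i" using inj_onD[OF lbase_inj[OF B.base[OF b0(1)] B.finite_idx]] j f(1)[OF i(1)] by blast
        with i show "j \<in> f ` idx C" by blast
      qed
    qed (use f in blast)
  qed
  \<comment> \<open>The relation of carrying the same labelled basis up to \<psi> and the
    relabelling \<open>f\<close>. Walks make it total on both sides, faithful labelling makes it one
    to one.\<close>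
  define G where "G = (\<lambda>b b'. b \<in> objs C \<and> b' \<in> objs C' \<and> (\<forall>i\<in>idx C. L' b' (f i) = \<psi> (L b i)))"
  have G0: "G a0 b0" unfolding G_def using a0 b0 f by blast
  have Gstep: "G (rho C i b) (rho C' (f i) b')"
    "\<And>j. j \<in> idx C \<Longrightarrow> cart C' b' (f i) (f j) = cart C b i j" if "G b b'" "i \<in> idx C" for b b' i
  proof -
    have b: "b \<in> objs C" "b' \<in> objs C'" and eq: "\<And>i. i \<in> idx C \<Longrightarrow> L' b' (f i) = \<psi> (L b i)"
      using that(1) by (auto simp: G_def)
    note i = that(2)
    let ?r = "rho C i b" and ?r' = "rho C' (f i) b'"
    have r: "?r \<in> objs C" "?r' \<in> objs C'" using b i f by (auto intro: A.rho_in B.rho_in)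
    have c: "lbase (\<psi> ` R) (idx C) (\<lambda>i. \<psi> (L ?r i))" by (rule lbase_image[OF A.base[OF r(1)] psi])
    have c': "lbase (\<psi> ` R) (idx C) (\<lambda>i. L' ?r' (f i))" by (rule lbase_reindex[OF B.base[OF r(2)] fbij])
    have ii: "L' ?r' (f i) = \<psi> (L ?r i)"
      using A.step_self[OF b(1) i] B.step_self[OF b(2) f(1)[OF i]] eq[OF i] by (simp add: linear_neg[OF psi(1)])
    have jj: "L' ?r' (f j) = \<psi> (L ?r j) + of_int (cart C' b' (f i) (f j) - cart C b i j) *\<^sub>R \<psi> (L ?r i)"
      if j: "j \<in> idx C" for j
      unfolding A.step_self[OF b(1) i] A.step[OF b(1) i j] B.step[OF b(2) f(1)[OF i] f(1)[OF j]] eq[OF i] eq[OF j]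
      by (simp add: linear_neg[OF psi(1)] linear_diff[OF psi(1)] linear_scale[OF psi(1)] scaleR_diff_left)
    have z: "cart C' b' (f i) (f j) - cart C b i j = 0" if j: "j \<in> idx C" for j
    proof (cases "j = i")
      case True
      then show ?thesis using A.cart_diag[OF b(1) i] B.cart_diag[OF b(2) f(1)[OF i]] by simp
    next
      case False
      show ?thesis by (rule lbase_step_unique[OF c c' A.finite_idx i j False ii jj[OF j]])
    qed
    show "\<And>j. j \<in> idx C \<Longrightarrow> cart C' b' (f i) (f j) = cart C b i j" using z by simp
    show "G ?r ?r'" unfolding G_def using r jj z by simp
  qed
  have Gwalk: "G (walk C a0 w) (walk C' b0 (map f w))" if "w \<in> lists (idx C)" for w
    using that by (induction w rule: rev_induct) (auto simp: G0 Gstep(1))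
  have left: "\<exists>b'. G b b'" if "b \<in> objs C" for b
    using A.conn[OF a0 that] Gwalk by blast
  have right: "\<exists>b. G b b'" if "b' \<in> objs C'" for b'
  proof -
    obtain w where w: "w \<in> lists (idx C')" "b' = walk C' b0 w" using B.conn[OF b0(1) \<open>b' \<in> objs C'\<close>] by blast
    let ?v = "map (inv_into (idx C) f) w"
    have iv: "inv_into (idx C) f j \<in> idx C" "f (inv_into (idx C) f j) = j" if "j \<in> idx C'" for j
      using that fbij by (auto simp: bij_betw_def inv_into_into f_inv_into_f)
    have "?v \<in> lists (idx C)" using w(1) iv by auto
    moreover have "map f ?v = w" using w(1) iv by (auto simp: map_idI)
    ultimately show ?thesis using Gwalk[of ?v] w(2) by auto
  qed
  have Lspan: "L b i \<in> span R" if "b \<in> objs C" "i \<in> idx C" for b i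
    by (rule span_base[OF A.L_in[OF that]])
  have uniq1: "b' = b''" if "G b b'" "G b b''" for b b' b''
  proof (rule B.inj)
    fix j assume "j \<in> idx C'"
    then obtain i where "i \<in> idx C" "j = f i" using fbij by (auto simp: bij_betw_def)
    with that show "L' b' j = L' b'' j" by (auto simp: G_def)
  qed (use that in \<open>auto simp: G_def\<close>)
  have uniq2: "b = c" if "G b b'" "G c b'" for b c b'
  proof (rule A.inj)
    fix i assume i: "i \<in> idx C"
    with that have "\<psi> (L b i) = \<psi> (L c i)" by (metis (no_types, lifting) G_def)
    with i that show "L b i = L c i" using inj_onD[OF psi(2)] Lspan by (auto simp: G_def)
  qed (use that in \<open>auto simp: G_def\<close>)
  define g where "g = (\<lambda>b. SOME b'. G b b')"
  have g: "G b (g b)" if "b \<in> objs C" for b unfolding g_def using someI_ex[OF left[OF that]] .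
  have "bij_betw g (objs C) (objs C')"
    unfolding bij_betw_def
  proof
    show "inj_on g (objs C)" by (rule inj_onI) (metis g uniq2)
    show "g ` objs C = objs C'"
    proof
      show "g ` objs C \<subseteq> objs C'" using g by (auto simp: G_def)
      show "objs C' \<subseteq> g ` objs C"
      proof
        fix b' assume "b' \<in> objs C'"
        from right[OF this] obtain b where b: "G b b'" by blast
        then have "b \<in> objs C" by (simp add: G_def)
        with uniq1[OF b g[OF this]] show "b' \<in> g ` objs C" by blast
      qed
    qed
  qed
  moreover have "g (rho C i b) = rho C' (f i) (g b)" if "i \<in> idx C" "b \<in> objs C" for i b
    using uniq1[OF g[OF A.rho_in[OF that]] Gstep(1)[OF g[OF that(2)] that(1)]] .
  ultimately show ?thesis
    unfolding cartan_equiv_def using fbij Gstep(2)[OF g]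
    by (intro exI[of _ f] exI[of _ g]) simp
qed

text \<open>The map \<psi> is prescribed on the basis at one object. Equal Cartan entries propagate
  the matching of bases along walks to all objects, and since every root is a basis vector
  somewhere, \<psi> carries \<open>R\<close> onto \<open>R'\<close>.\<close>

theorem equiv_realizations_isomorphic:
  fixes C :: "('i, 'a) cartan_data" and C' :: "('j, 'b) cartan_data"
    and R :: "'v::real_vector set" and R' :: "'w::real_vector set"
  assumes "realization C L R" and "realization C' L' R'" and equiv: "cartan_equiv C C'"
  shows "card (idx C) = card (idx C')"
    and "\<exists>\<psi>. linear \<psi> \<and> bij_betw \<psi> (span R) (span R') \<and> \<psi> ` R = R'"
proof -
  interpret A: realization C L R by fact
  interpret B: realization C' L' R' by fact
  obtain f g where fbij: "bij_betw f (idx C) (idx C')" and gbij: "bij_betw g (objs C) (objs C')"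
    and grho: "\<And>i a. i \<in> idx C \<Longrightarrow> a \<in> objs C \<Longrightarrow> g (rho C i a) = rho C' (f i) (g a)"
    and cc: "\<And>a i j. a \<in> objs C \<Longrightarrow> i \<in> idx C \<Longrightarrow> j \<in> idx C \<Longrightarrow> cart C' (g a) (f i) (f j) = cart C a i j"
    using equiv unfolding cartan_equiv_def by blast
  show "card (idx C) = card (idx C')" by (rule bij_betw_same_card[OF fbij])
  have f: "f i \<in> idx C'" if "i \<in> idx C" for i using that fbij by (auto simp: bij_betw_def)
  have g: "g a \<in> objs C'" if "a \<in> objs C" for a using that gbij by (auto simp: bij_betw_def)
  obtain a0 where a0: "a0 \<in> objs C" using A.objs_ne by blast
  note injL = lbase_inj[OF A.base[OF a0] A.finite_idx]
  note injL' = lbase_inj[OF B.base[OF g[OF a0]] B.finite_idx]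
  obtain \<psi> where psi: "linear \<psi>" "\<And>i. i \<in> idx C \<Longrightarrow> \<psi> (L a0 i) = L' (g a0) (f i)"
    using linear_independent_extend[OF lbase_independent[OF A.base[OF a0] A.finite_idx],
        of "\<lambda>v. L' (g a0) (f (inv_into (idx C) (L a0) v))"]
    by (auto simp: inv_into_f_f[OF injL])
  have walk: "\<forall>i\<in>idx C. \<psi> (L (walk C a0 w) i) = L' (g (walk C a0 w)) (f i)" if "w \<in> lists (idx C)" for w
    using that
  proof (induction w rule: rev_induct)
    case (snoc i w)
    let ?b = "walk C a0 w"
    have i: "i \<in> idx C" and b: "?b \<in> objs C" using snoc.prems A.walk_in[OF a0] by auto
    show ?case
    proof
      fix j assume j: "j \<in> idx C"
      have "\<psi> (L ?b i) = L' (g ?b) (f i)" "\<psi> (L ?b j) = L' (g ?b) (f j)" using snoc i j by auto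
      then show "\<psi> (L (walk C a0 (w @ [i])) j) = L' (g (walk C a0 (w @ [i]))) (f j)"
        using A.step[OF b i j] B.step[OF g[OF b] f[OF i] f[OF j]] grho[OF i b] cc[OF b i j]
        by (simp add: linear_diff[OF psi(1)] linear_scale[OF psi(1)])
    qed
  qed (use psi in simp)
  have all: "\<psi> (L b i) = L' (g b) (f i)" if "b \<in> objs C" "i \<in> idx C" for b i
    using A.conn[OF a0 that(1)] walk that(2) by blast
  have img: "\<psi> ` R = R'"
  proof (intro equalityI subsetI)
    fix \<beta> assume "\<beta> \<in> \<psi> ` R"
    then obtain b i where "b \<in> objs C" "i \<in> idx C" "\<beta> = \<psi> (L b i)" using A.root_is_simple by blast
    then show "\<beta> \<in> R'" using all B.L_in[OF g f] by simp
  next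
    fix \<beta> assume "\<beta> \<in> R'"
    then obtain b' i' where b': "b' \<in> objs C'" "i' \<in> idx C'" "\<beta> = L' b' i'" using B.root_is_simple by blast
    then obtain b i where "b \<in> objs C" "i \<in> idx C" "b' = g b" "i' = f i"
      using fbij gbij unfolding bij_betw_def by (metis imageE)
    then show "\<beta> \<in> \<psi> ` R" using all b'(3) A.L_in by (metis imageI)
  qed
  have imgB: "\<psi> ` L a0 ` idx C = L' (g a0) ` idx C'"
  proof -
    have "\<psi> ` L a0 ` idx C = L' (g a0) ` f ` idx C" unfolding image_image using psi(2) by (intro image_cong) auto
    then show ?thesis using fbij by (simp add: bij_betw_def)
  qed
  have "inj_on \<psi> (L a0 ` idx C)"
  proof (rule inj_onI)
    fix x y assume xy: "x \<in> L a0 ` idx C" "y \<in> L a0 ` idx C" "\<psi> x = \<psi> y"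
    then obtain i k where ik: "i \<in> idx C" "k \<in> idx C" "x = L a0 i" "y = L a0 k" by blast
    with xy(3) psi(2) have "L' (g a0) (f i) = L' (g a0) (f k)" by simp
    then have "f i = f k" using inj_onD[OF injL'] f ik by blast
    then have "i = k" using fbij ik unfolding bij_betw_def by (blast dest: inj_onD)
    with ik show "x = y" by simp
  qed
  moreover have "independent (\<psi> ` L a0 ` idx C)"
    unfolding imgB by (rule lbase_independent[OF B.base[OF g[OF a0]] B.finite_idx])
  ultimately have "inj_on \<psi> (span (L a0 ` idx C))"
    using linear_inj_on_span_iff_independent_image[OF psi(1)] by blast
  then have "inj_on \<psi> (span R)" using span_lbase[OF A.base[OF a0]] by simp
  moreover have "\<psi> ` span R = span R'" unfolding img[symmetric] by (rule linear_span_image[OF psi(1), symmetric])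
  ultimately show "\<exists>\<psi>. linear \<psi> \<and> bij_betw \<psi> (span R) (span R') \<and> \<psi> ` R = R'"
    using psi(1) img unfolding bij_betw_def by blast
qed

section \<open>Realizing a Cartan scheme\<close>

lemma weyl_hom_trans:
  assumes "weyl_hom C a w b" "weyl_hom C b v c"
  shows "weyl_hom C a (v \<circ> w) c"
  using assms(2)
proof (induction rule: weyl_hom.induct)
  case weyl_id
  then show ?case using assms(1) by simp
next
  case (weyl_comp v c i)
  from weyl_hom.weyl_comp[OF weyl_comp(3,2)] show ?case by (simp only: o_assoc)
qed

lemma weyl_hom_is_walk: "weyl_hom C a w b \<Longrightarrow> \<exists>u\<in>lists (idx C). b = walk C a u"
proof (induction rule: weyl_hom.induct)
  case weyl_id
  then show ?case by (intro bexI[of _ "[]"]) auto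
next
  case (weyl_comp w b i)
  then obtain u where "u \<in> lists (idx C)" "b = walk C a u" by blast
  with weyl_comp(2) show ?case by (intro bexI[of _ "u @ [i]"]) auto
qed

text \<open>
  A frame at \<open>b\<close> is the image of the standard basis at the base object \<open>a\<^sub>0\<close> under the coordinate
  change along a walk from \<open>a\<^sub>0\<close> to \<open>b\<close>; simple connectivity makes it independent of the walk.
\<close>

inductive frame :: "('i, 'a) cartan_data \<Rightarrow> 'a \<Rightarrow> ('i \<Rightarrow> 'v::real_vector) \<Rightarrow> 'a \<Rightarrow> ('i \<Rightarrow> 'v) \<Rightarrow> bool"
  for C a\<^sub>0 e where
  frame_base: "frame C a\<^sub>0 e a\<^sub>0 e"
| frame_step: "frame C a\<^sub>0 e b M \<Longrightarrow> i \<in> idx C \<Longrightarrow>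
    frame C a\<^sub>0 e (rho C i b) (\<lambda>j. M j - of_int (cart C b i j) *\<^sub>R M i)"

locale framed_scheme =
  fixes C :: "('i, 'a) cartan_data" and a\<^sub>0 :: 'a and e :: "'i \<Rightarrow> 'v::real_vector"
  assumes C: "C \<in> cartan_class" and a0: "a\<^sub>0 \<in> objs C"
    and indep: "\<And>x i. (\<Sum>i\<in>idx C. x i *\<^sub>R e i) = 0 \<Longrightarrow> i \<in> idx C \<Longrightarrow> x i = (0::real)"
begin

abbreviation "I \<equiv> idx C"
abbreviation "\<Phi> \<equiv> real_roots C"
abbreviation "fr \<equiv> frame C a\<^sub>0 e"

definition R :: "'v set" where "R = comb I e ` \<Phi> a\<^sub>0"

lemma scheme: "cartan_scheme C" and connected: "connected_scheme C"
  and simply: "simply_connected_scheme C" and roots: "root_system C \<Phi>"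
  and finite_roots: "\<And>a. a \<in> objs C \<Longrightarrow> finite (\<Phi> a)"
  using C by (auto simp: cartan_class_def finite_root_system_def)

lemma finI: "finite I" and I_ne: "I \<noteq> {}"
  and rho_in: "\<And>i a. i \<in> I \<Longrightarrow> a \<in> objs C \<Longrightarrow> rho C i a \<in> objs C"
  and invol: "\<And>i a. i \<in> I \<Longrightarrow> a \<in> objs C \<Longrightarrow> rho C i (rho C i a) = a"
  and diag: "\<And>a i. a \<in> objs C \<Longrightarrow> i \<in> I \<Longrightarrow> cart C a i i = 2"
  using scheme by (auto simp: cartan_scheme_def generalized_cartan_matrix_def)

lemma hom_exists:
  assumes "a \<in> objs C" "b \<in> objs C" obtains w where "weyl_hom C a w b"
  using assms connected by (auto simp: connected_scheme_def)

lemma hom_self: 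
  assumes "weyl_hom C a w a" shows "w = id"
proof -
  have "{w. weyl_hom C a w a} = {id}"
    using simply weyl_hom_objs[OF assms] unfolding simply_connected_scheme_def by blast
  with assms show ?thesis by blast
qed

lemma frame_indep:
  "fr b M \<Longrightarrow> b \<in> objs C \<and> (\<forall>x. (\<Sum>j\<in>I. x j *\<^sub>R M j) = 0 \<longrightarrow> (\<forall>i\<in>I. x i = (0::real)))"
proof (induction rule: frame.induct)
  case frame_base
  then show ?case using a0 indep by blast
next
  case (frame_step b M i)
  then have b: "b \<in> objs C" and IH: "\<And>x k. (\<Sum>j\<in>I. x j *\<^sub>R M j) = 0 \<Longrightarrow> k \<in> I \<Longrightarrow> x k = (0::real)"
    by blast+
  note i = frame_step(2)
  have "x k = 0" if x: "(\<Sum>j\<in>I. x j *\<^sub>R (M j - of_int (cart C b i j) *\<^sub>R M i)) = 0" and k: "k \<in> I"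
    for x :: "'i \<Rightarrow> real" and k
  proof -
    let ?s = "\<Sum>j\<in>I. x j * of_int (cart C b i j)"
    let ?z = "\<lambda>j. x j - (if j = i then ?s else 0)"
    have "(\<Sum>j\<in>I. ?z j *\<^sub>R M j) = (\<Sum>j\<in>I. x j *\<^sub>R M j) - ?s *\<^sub>R M i"
      using i finI by (simp add: scaleR_diff_left sum_subtractf if_distrib[of "\<lambda>x. x *\<^sub>R _"] cong: if_cong)
    also have "\<dots> = (\<Sum>j\<in>I. x j *\<^sub>R (M j - of_int (cart C b i j) *\<^sub>R M i))"
      by (simp add: scaleR_diff_right sum_subtractf scaleR_sum_left)
    finally have z: "?z j = 0" if "j \<in> I" for j using IH[of ?z] x that by simp
    have z': "x j = 0" if "j \<in> I" "j \<noteq> i" for j using z[OF that(1)] that(2) by simp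
    \<comment> \<open>Once the other coefficients vanish, the coordinate at \<open>i\<close> is
      \<open>x i - 2 * x i\<close>, so the diagonal entry 2 prevents degeneration.\<close>
    have "?s = x i * of_int (cart C b i i)"
      using z' i finI by (subst sum.remove[OF finI i]) auto
    then have "x i = 0" using z[OF i] diag[OF b i] by simp
    with z' k show ?thesis by blast
  qed
  then show ?case using rho_in[OF i b] by blast
qed

text \<open>A frame records the movement of the basis along a walk, a morphism that of the
  coordinates; \<open>comb_sigma\<close> matches them step by step.\<close>

lemma frame_hom: "fr b M \<Longrightarrow> \<exists>w. weyl_hom C a\<^sub>0 w b \<and> (\<forall>x. comb I M (w x) = comb I e x)"
proof (induction rule: frame.induct)
  case frame_base
  show ?case by (intro exI[of _ id] conjI weyl_id[OF a0]) simp
next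
  case (frame_step b M i)
  then obtain w where w: "weyl_hom C a\<^sub>0 w b" "\<forall>x. comb I M (w x) = comb I e x" by blast
  have b: "b \<in> objs C" using frame_indep[OF frame_step(1)] by blast
  let ?M = "\<lambda>j. M j - of_int (cart C b i j) *\<^sub>R M i"
  have "comb I ?M (sigma C i b y) = comb I M y" for y
    by (rule comb_sigma[OF finI frame_step(2) diag[OF b frame_step(2)] refl])
  with w(2) have "\<forall>x. comb I ?M ((sigma C i b \<circ> w) x) = comb I e x" by simp
  with weyl_comp[OF w(1) frame_step(2)] show ?case by blast
qed

lemma frame_exists:
  assumes "b \<in> objs C" shows "\<exists>M. fr b M"
proof -
  obtain w where "weyl_hom C a\<^sub>0 w b" using hom_exists[OF a0 assms] .
  then show ?thesis
    by (induction rule: weyl_hom.induct) (blast intro: frame.intros)+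
qed

text \<open>A morphism \<open>v\<close> back to the base object is inverse to the morphism of any
  frame at \<open>b\<close>, because their composite is an endomorphism. Hence the frame vector is
  \<open>v (unit_vec j)\<close> read in the basis \<open>e\<close>, whichever walk produced
  it.\<close>

lemma frame_unique:
  assumes "fr b M" "fr b M'" "j \<in> I"
  shows "M j = M' j"
proof -
  have b: "b \<in> objs C" using frame_indep[OF assms(1)] by blast
  obtain v where v: "weyl_hom C b v a\<^sub>0" using hom_exists[OF b a0] .
  have *: "N j = comb I e (v (unit_vec j))" if N: "fr b N" for N
  proof -
    obtain w where w: "weyl_hom C a\<^sub>0 w b" "\<And>x. comb I N (w x) = comb I e x" using frame_hom[OF N] by blast
    have "w \<circ> v = id" by (rule hom_self[OF weyl_hom_trans[OF v w(1)]])
    then have "w (v (unit_vec j)) = unit_vec j" by (metis comp_apply id_apply)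
    with w(2)[of "v (unit_vec j)"] show ?thesis using comb_unit_vec[OF finI assms(3), of N] by simp
  qed
  from *[OF assms(1)] *[OF assms(2)] show ?thesis by simp
qed

lemma
  assumes "a \<in> objs C"
  shows roots_in: "\<Phi> a \<subseteq> int_lattice I"
    and roots_sign: "\<Phi> a = {x \<in> \<Phi> a. \<forall>i\<in>I. x i \<ge> 0} \<union> uminus ` {x \<in> \<Phi> a. \<forall>i\<in>I. x i \<ge> 0}"
    and roots_multiples: "i \<in> I \<Longrightarrow> \<Phi> a \<inter> range (\<lambda>z k. z * unit_vec i k) = {unit_vec i, - unit_vec i}"
    and roots_sigma: "i \<in> I \<Longrightarrow> sigma C i a ` \<Phi> a = \<Phi> (rho C i a)"
    and roots_rank_two: "i \<in> I \<Longrightarrow> j \<in> I \<Longrightarrow> i \<noteq> j \<Longrightarrow>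
      finite {x \<in> \<Phi> a. \<exists>p q::nat. x = (\<lambda>k. int p * unit_vec i k + int q * unit_vec j k)} \<Longrightarrow>
      ((rho C i \<circ> rho C j) ^^ card {x \<in> \<Phi> a. \<exists>p q::nat. x = (\<lambda>k. int p * unit_vec i k + int q * unit_vec j k)}) a = a"
proof -
  note H = bspec[OF roots[unfolded root_system_def Let_def] assms]
  show "\<Phi> a \<subseteq> int_lattice I" using H by (elim conjE)
  show "\<Phi> a = {x \<in> \<Phi> a. \<forall>i\<in>I. x i \<ge> 0} \<union> uminus ` {x \<in> \<Phi> a. \<forall>i\<in>I. x i \<ge> 0}"
    using H by (elim conjE)
  show "\<Phi> a \<inter> range (\<lambda>z k. z * unit_vec i k) = {unit_vec i, - unit_vec i}" if "i \<in> I"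
    using H by (elim conjE) (erule bspec[OF _ that])
  show "sigma C i a ` \<Phi> a = \<Phi> (rho C i a)" if "i \<in> I"
    using H by (elim conjE) (erule bspec[OF _ that])
  let ?M = "{x \<in> \<Phi> a. \<exists>p q::nat. x = (\<lambda>k. int p * unit_vec i k + int q * unit_vec j k)}"
  show "((rho C i \<circ> rho C j) ^^ card ?M) a = a" if "i \<in> I" "j \<in> I" "i \<noteq> j" "finite ?M"
  proof -
    have "\<forall>i\<in>I. \<forall>j\<in>I. i \<noteq> j \<and> finite {x \<in> \<Phi> a. \<exists>p q::nat. x = (\<lambda>k. int p * unit_vec i k + int q * unit_vec j k)} \<longrightarrow>
      ((rho C i \<circ> rho C j) ^^ card {x \<in> \<Phi> a. \<exists>p q::nat. x = (\<lambda>k. int p * unit_vec i k + int q * unit_vec j k)}) a = a"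
      using H by (elim conjE)
    from mp[OF bspec[OF bspec[OF this that(1)] that(2)] conjI[OF that(3,4)]] show ?thesis .
  qed
qed

lemma unit_vec_root: "a \<in> objs C \<Longrightarrow> i \<in> I \<Longrightarrow> unit_vec i \<in> \<Phi> a"
  using roots_multiples by blast

lemma uminus_root: "a \<in> objs C \<Longrightarrow> x \<in> \<Phi> a \<Longrightarrow> - x \<in> \<Phi> a"
  by (subst (asm) roots_sign, assumption, subst roots_sign, assumption) auto

lemma root_sign:
  assumes "a \<in> objs C" "x \<in> \<Phi> a"
  shows "(\<forall>i\<in>I. x i \<ge> 0) \<or> (\<forall>i\<in>I. x i \<le> 0)"
  using assms(2) by (subst (asm) roots_sign[OF assms(1)]) auto

lemma hom_roots: "weyl_hom C a w b \<Longrightarrow> b \<in> objs C \<and> w ` \<Phi> a = \<Phi> b"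
proof (induction rule: weyl_hom.induct)
  case (weyl_comp w b i)
  then show ?case using roots_sigma[of b i] rho_in by (metis image_comp)
qed simp

lemma frame_roots:
  assumes "fr b M"
  shows "comb I M ` \<Phi> b = R"
proof -
  obtain w where w: "weyl_hom C a\<^sub>0 w b" "\<And>x. comb I M (w x) = comb I e x" using frame_hom[OF assms] by blast
  have "comb I M ` \<Phi> b = comb I M ` w ` \<Phi> a\<^sub>0" using hom_roots[OF w(1)] by simp
  also have "\<dots> = R" unfolding R_def image_image w(2) ..
  finally show ?thesis .
qed

lemma frame_lbase:
  assumes "fr b M"
  shows "lbase R I M"
  unfolding lbase_def
proof (intro conjI allI ballI impI)
  have b: "b \<in> objs C" using frame_indep[OF assms] by blast
  show "M i \<in> R" if "i \<in> I" for i
    using imageI[OF unit_vec_root[OF b that], of "comb I M"]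
    unfolding frame_roots[OF assms] comb_unit_vec[OF finI that] .
  show "x i = 0" if "(\<Sum>i\<in>I. x i *\<^sub>R M i) = 0" "i \<in> I" for x :: "'i \<Rightarrow> real" and i
    using frame_indep[OF assms] that by blast
  fix \<alpha> assume "\<alpha> \<in> R"
  then obtain x where x: "x \<in> \<Phi> b" "\<alpha> = comb I M x" using frame_roots[OF assms] by blast
  then show "\<exists>x. \<alpha> = (\<Sum>i\<in>I. of_int (x i) *\<^sub>R M i) \<and> ((\<forall>i\<in>I. 0 \<le> x i) \<or> (\<forall>i\<in>I. x i \<le> 0))"
    using root_sign[OF b x(1)] by (intro exI[of _ x]) (simp add: comb_def)
qed

text \<open>Frames at one object agree on \<open>I\<close>, so the choice affects only values at
  indices outside \<open>I\<close>.\<close>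

definition L :: "'a \<Rightarrow> 'i \<Rightarrow> 'v" where "L b = (SOME M. fr b M)"

lemma frame_L: "b \<in> objs C \<Longrightarrow> fr b (L b)"
  unfolding L_def using frame_exists by (rule someI_ex)

text \<open>Reducedness depends on this: (R2) speaks only of multiples of unit vectors, and every
  real root becomes a unit vector at the source of its morphism.\<close>

lemma root_is_frame_vector:
  assumes "\<alpha> \<in> R"
  shows "\<exists>b\<in>objs C. \<exists>i\<in>I. \<alpha> = L b i"
proof -
  obtain x where x: "x \<in> \<Phi> a\<^sub>0" "\<alpha> = comb I e x" using assms by (auto simp: R_def)
  then obtain v j b where v: "x = v (unit_vec j)" "j \<in> I" "b \<in> objs C" "weyl_hom C b v a\<^sub>0"
    unfolding real_roots_def by blast
  obtain w where w: "weyl_hom C a\<^sub>0 w b" "\<And>x. comb I (L b) (w x) = comb I e x"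
    using frame_hom[OF frame_L[OF v(3)]] by blast
  have "w \<circ> v = id" by (rule hom_self[OF weyl_hom_trans[OF v(4) w(1)]])
  then have "w (v (unit_vec j)) = unit_vec j" by (metis comp_apply id_apply)
  with w(2)[of x] have "\<alpha> = L b j" using v(1,2) x(2) comb_unit_vec[OF finI v(2), of "L b"] by simp
  with v show ?thesis by blast
qed

lemma is_prerealization: "prerealization C L R"
proof
  show "finite I" "I \<noteq> {}" by (fact finI I_ne)+
  show "objs C \<noteq> {}" using a0 by blast
  show "rho C i a \<in> objs C" if "i \<in> I" "a \<in> objs C" for i a using rho_in that .
  show "finite R" unfolding R_def using finite_roots[OF a0] by simp
  show "- \<alpha> \<in> R" if "\<alpha> \<in> R" for \<alpha>
    using that uminus_root[OF a0] unfolding R_def by (auto simp: comb_uminus[symmetric])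
  show "lbase R I (L a)" if "a \<in> objs C" for a by (rule frame_lbase[OF frame_L[OF that]])
  show "L (rho C i a) j = L a j - of_int (cart C a i j) *\<^sub>R L a i"
    if "a \<in> objs C" "i \<in> I" "j \<in> I" for a i j
    by (rule frame_unique[OF frame_L[OF rho_in[OF that(2,1)]] frame_step[OF frame_L[OF that(1)] that(2)] that(3)])
  show "cart C a i i = 2" if "a \<in> objs C" "i \<in> I" for a i using diag that .
  show "\<exists>w\<in>lists I. b = walk C a w" if ab: "a \<in> objs C" "b \<in> objs C" for a b
    using hom_exists[OF ab] weyl_hom_is_walk by metis
  show "t = 1 \<or> t = -1" if t: "\<alpha> \<in> R" "t *\<^sub>R \<alpha> \<in> R" for \<alpha> t
  proof -
    obtain b i where b: "b \<in> objs C" "i \<in> I" "\<alpha> = L b i" using root_is_frame_vector[OF t(1)] by blast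
    obtain y where y: "y \<in> \<Phi> b" "t *\<^sub>R \<alpha> = comb I (L b) y"
      using t(2) frame_roots[OF frame_L[OF b(1)]] by blast
    \<comment> \<open>Comparing coordinates shows that the real factor \<open>t\<close> is the
      integer \<open>y i\<close>, which brings the multiple within reach of (R2).\<close>
    have "(\<Sum>k\<in>I. (if k = i then t else 0) *\<^sub>R L b k) = (\<Sum>k\<in>I. of_int (y k) *\<^sub>R L b k)"
      using y(2) b(2,3) finI by (simp add: comb_def if_distrib[of "\<lambda>x. x *\<^sub>R _"] cong: if_cong)
    note eq = lbase_eq_coords[OF frame_lbase[OF frame_L[OF b(1)]] this]
    have "y = (\<lambda>k. y i * unit_vec i k)"
    proof
      fix k show "y k = y i * unit_vec i k"
      proof (cases "k \<in> I")
        case True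
        then show ?thesis using eq[OF True] by (auto simp: unit_vec_def)
      next
        case False
        then show ?thesis using y(1) roots_in[OF b(1)] b(2) by (auto simp: int_lattice_def unit_vec_def)
      qed
    qed
    then have "y \<in> \<Phi> b \<inter> range (\<lambda>z k. z * unit_vec i k)" using y(1) by blast
    then have "y = unit_vec i \<or> y = - unit_vec i" using roots_multiples[OF b(1,2)] by blast
    then have "y i = 1 \<or> y i = -1" by (auto simp: unit_vec_def)
    then show ?thesis using eq[OF b(2)] by auto
  qed
qed

text \<open>(R4), counted in real roots, is the closing of the turns counted by \<open>pp\<close>;
  with it \<open>L_injective\<close> applies.\<close>

theorem is_realization: "realization C L R"
proof -
  interpret P: prerealization C L R by (rule is_prerealization)
  have per: "alt C a i j (2 * card (P.pp a i j)) = a" if "i \<in> I" "j \<in> I" "i \<noteq> j" "a \<in> objs C" for i j a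
  proof -
    have "card (P.pp a i j) = card (P.pp a j i)" by (simp add: P.pp_def P.plane_commute)
    also have "\<dots> = card {x \<in> \<Phi> a. \<exists>p q::nat. x = (\<lambda>k. int p * unit_vec j k + int q * unit_vec i k)}"
      by (rule P.card_rank_two[OF that(4,2,1) that(3)[symmetric], symmetric])
    finally show ?thesis
      using roots_rank_two[OF that(4,2,1) that(3)[symmetric]] finite_roots[OF that(4)]
      unfolding alt_funpow by simp
  qed
  show ?thesis
  proof
    fix a b assume ab: "a \<in> objs C" "b \<in> objs C" and eq: "\<And>i. i \<in> I \<Longrightarrow> L a i = L b i"
    show "a = b" by (rule P.L_injective[OF _ _ ab]) (fact invol, fact per, fact eq)
  qed
qed

end

section \<open>Coordinate space and the realization of abstract schemes\<close>

lemma sum_fun_apply: "(\<Sum>i\<in>A. f i) x = (\<Sum>i\<in>A. f i x)"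
  for f :: "'i \<Rightarrow> 'b \<Rightarrow> 'c::comm_monoid_add"
  by (induction A rule: infinite_finite_induct) auto

lemma scaleR_fun_apply: "(c *\<^sub>R f) x = c *\<^sub>R f x" for f :: "'b \<Rightarrow> 'c::real_vector"
  by (simp add: scaleR_fun_def)

lemma Rn_def': "Rn r = {x. \<forall>i\<ge>r. x i = 0}"
  by (simp add: topspace_Euclidean_space)

definition ax :: "nat \<Rightarrow> nat \<Rightarrow> real"
  where "ax i = (\<lambda>k. if k = i then 1 else 0)"

lemma ax_in: "i < r \<Longrightarrow> ax i \<in> Rn r"
  by (auto simp: Rn_def' ax_def)

lemma Rn_sum_ax: "x \<in> Rn r \<Longrightarrow> x = (\<Sum>i<r. x i *\<^sub>R ax i)"
  by (rule ext) (auto simp: Rn_def' sum_fun_apply scaleR_fun_apply ax_def if_distrib[of "(*) _"] not_less cong: if_cong)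

definition vbasis :: "nat \<Rightarrow> (nat \<Rightarrow> real) set \<Rightarrow> bool"
  where "vbasis r B \<longleftrightarrow> finite B \<and> independent B \<and> span B = Rn r"

lemma vbasis_ax: "vbasis r (ax ` {..<r})"
  unfolding vbasis_def
proof (intro conjI)
  show "independent (ax ` {..<r})"
    unfolding independent_explicit_finite_subsets
  proof (intro allI impI ballI)
    fix S :: "(nat \<Rightarrow> real) set" and u :: "(nat \<Rightarrow> real) \<Rightarrow> real" and v
    assume S: "S \<subseteq> ax ` {..<r}" "finite S" "(\<Sum>v\<in>S. u v *\<^sub>R v) = 0" "v \<in> S"
    then obtain k where k: "v = ax k" by auto
    have z: "w k = (if w = v then 1 else 0)" if w: "w \<in> S" for w
    proof -
      obtain l where "w = ax l" using w S(1) by blast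
      then show ?thesis using k by (auto simp: ax_def fun_eq_iff)
    qed
    have "(\<Sum>w\<in>S. u w *\<^sub>R w) k = (\<Sum>w\<in>S. if w = v then u w else 0)"
      unfolding sum_fun_apply scaleR_fun_apply
    proof (rule sum.cong)
      fix w assume "w \<in> S"
      from z[OF this] show "u w *\<^sub>R w k = (if w = v then u w else 0)" by simp
    qed simp
    then show "u v = 0" using S by simp
  qed
  show "span (ax ` {..<r}) = Rn r"
  proof
    show "span (ax ` {..<r}) \<subseteq> Rn r" by (rule span_minimal) (auto simp: ax_in subspace_Rn)
    show "Rn r \<subseteq> span (ax ` {..<r})"
    proof
      fix x assume "x \<in> Rn r"
      then have "x = (\<Sum>i<r. x i *\<^sub>R ax i)" by (rule Rn_sum_ax)
      also have "\<dots> \<in> span (ax ` {..<r})" by (intro span_sum span_scale span_base imageI) auto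
      finally show "x \<in> span (ax ` {..<r})" .
    qed
  qed
qed simp

text \<open>Numbering the labels by axes of coordinate space makes the roots at one object span
  exactly the space of the dimension given by the rank.\<close>

theorem cartan_class_realizable:
  fixes C :: "('i, 'a) cartan_data"
  assumes C: "C \<in> cartan_class"
  shows "\<exists>L R. realization C L R \<and> span R = Rn (card (idx C)) \<and> card (idx C) \<ge> 1"
proof -
  let ?I = "idx C" and ?r = "card (idx C)"
  have sch: "cartan_scheme C" using C by (simp add: cartan_class_def)
  then have fin: "finite ?I" and ne: "?I \<noteq> {}" and "objs C \<noteq> {}" by (auto simp: cartan_scheme_def)
  then obtain a0 where a0: "a0 \<in> objs C" by blast
  obtain n where n: "bij_betw n ?I {0..<?r}" using ex_bij_betw_finite_nat[OF fin] by blast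
  define e where "e = (\<lambda>i. ax (n i))"
  have ev: "(\<Sum>i\<in>?I. x i *\<^sub>R e i) (n j) = x j" if "j \<in> ?I" for x j
  proof -
    have "(\<Sum>i\<in>?I. x i *\<^sub>R e i) (n j) = (\<Sum>i\<in>?I. if i = j then x i else 0)"
      unfolding sum_fun_apply scaleR_fun_apply e_def ax_def
      using that n by (intro sum.cong refl) (auto simp: bij_betw_def dest: inj_onD)
    then show ?thesis using that fin by simp
  qed
  interpret framed_scheme C a0 e
  proof
    fix x i assume "(\<Sum>i\<in>?I. x i *\<^sub>R e i) = 0" "i \<in> ?I"
    then show "x i = 0" using ev[of i x] by simp
  qed (use C a0 in auto)
  have "span R = span (e ` ?I)" by (rule span_lbase[OF frame_lbase[OF frame_base], symmetric])
  also have "e ` ?I = ax ` {0..<?r}" unfolding e_def using n by (auto simp: bij_betw_def image_image[symmetric])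
  also have "span (ax ` {0..<?r}) = Rn ?r"
    using vbasis_ax[of ?r] by (simp add: vbasis_def atLeast0LessThan)
  finally have "span R = Rn ?r" .
  moreover have "?r \<ge> 1" using fin ne by (simp add: Suc_leI card_gt_0_iff)
  ultimately show ?thesis using is_realization by blast
qed

section \<open>Dual bases and simplicial cones\<close>

lemma dim_Rn: "dim (Rn r) = r"
proof -
  have inj: "inj_on ax {..<r}" by (rule inj_onI) (auto simp: ax_def fun_eq_iff split: if_splits)
  have "dim (Rn r) = card (ax ` {..<r})"
    using vbasis_ax[of r] unfolding vbasis_def by (metis dim_eq_card_independent dim_span)
  then show ?thesis using card_image[OF inj] by simp
qed

lemma card_vbasis: "vbasis r B \<Longrightarrow> card B = r"
  unfolding vbasis_def by (metis dim_Rn dim_eq_card_independent dim_span)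

lemma vbasis_sub: "vbasis r B \<Longrightarrow> \<beta> \<in> B \<Longrightarrow> \<beta> \<in> Rn r"
  unfolding vbasis_def using span_base by blast

lemma pairing_commute: "pairing r \<alpha> x = pairing r x \<alpha>"
  by (simp add: pairing_def mult.commute)

lemma linear_pairing: "linear (pairing r \<alpha>)"
  by (rule linearI) (simp_all add: pairing_def scaleR_fun_def sum.distrib distrib_left sum_distrib_left mult.left_commute)

lemma linear_pairing_left: "linear (\<lambda>\<alpha>. pairing r \<alpha> x)"
  by (rule linearI) (simp_all add: pairing_def scaleR_fun_def sum.distrib distrib_right sum_distrib_left mult.assoc)

lemmas pairing_sum = linear_sum[OF linear_pairing]
lemmas pairing_sum_left = linear_sum[OF linear_pairing_left]
lemmas pairing_simps =
  linear_add[OF linear_pairing] linear_add[OF linear_pairing_left]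
  linear_diff[OF linear_pairing] linear_diff[OF linear_pairing_left]
  linear_neg[OF linear_pairing] linear_neg[OF linear_pairing_left]
  linear_scale[OF linear_pairing] linear_scale[OF linear_pairing_left]
  linear_0[OF linear_pairing] linear_0[OF linear_pairing_left]

lemma Rn_closed:
  "0 \<in> Rn r" "x \<in> Rn r \<Longrightarrow> y \<in> Rn r \<Longrightarrow> x + y \<in> Rn r"
  "x \<in> Rn r \<Longrightarrow> y \<in> Rn r \<Longrightarrow> x - y \<in> Rn r" "x \<in> Rn r \<Longrightarrow> c *\<^sub>R x \<in> Rn r"
  "x \<in> Rn r \<Longrightarrow> - x \<in> Rn r"
  "(\<And>i. i \<in> A \<Longrightarrow> f i \<in> Rn r) \<Longrightarrow> (\<Sum>i\<in>A. f i) \<in> Rn r"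
  using subspace_Rn[of r]
  by (auto intro: subspace_0 subspace_add subspace_diff subspace_scale subspace_neg subspace_sum)

lemma pairing_ax: "k < r \<Longrightarrow> pairing r (ax k) x = x k"
  by (simp add: pairing_def ax_def if_distrib[of "\<lambda>a. a * _"] cong: if_cong)

lemma pairing_nondegenerate:
  assumes "x \<in> Rn r" "\<And>\<gamma>. \<gamma> \<in> Rn r \<Longrightarrow> pairing r \<gamma> x = 0"
  shows "x = 0"
proof
  fix k show "x k = 0 k"
    using assms(1) assms(2)[OF ax_in, of k] pairing_ax[of k r x]
    by (cases "k < r") (auto simp: Rn_def')
qed

text \<open>For \<beta> in \<open>B\<close> this generates the ray of the cone opposite to the wall
  of \<beta>. For \<beta> outside a basis \<open>B\<close> the conditions force the zero vector, so
  the two basic properties hold for every \<beta>.\<close>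

definition dual :: "nat \<Rightarrow> (nat \<Rightarrow> real) set \<Rightarrow> (nat \<Rightarrow> real) \<Rightarrow> (nat \<Rightarrow> real)"
  where "dual r B \<beta> =
    (SOME d. d \<in> Rn r \<and> (\<forall>\<gamma>\<in>B. pairing r \<gamma> d = (if \<gamma> = \<beta> then 1 else 0)))"

lemma
  assumes "vbasis r B"
  shows dual_in: "dual r B \<beta> \<in> Rn r"
    and pairing_dual: "\<gamma> \<in> B \<Longrightarrow> pairing r \<gamma> (dual r B \<beta>) = (if \<gamma> = \<beta> then 1 else 0)"
proof -
  have B: "independent B" using assms by (simp add: vbasis_def)
  obtain \<phi> :: "(nat \<Rightarrow> real) \<Rightarrow> real" where phi: "linear \<phi>" "\<And>\<gamma>. \<gamma> \<in> B \<Longrightarrow> \<phi> \<gamma> = (if \<gamma> = \<beta> then 1 else 0)"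
    using linear_independent_extend[OF B, of "\<lambda>\<gamma>. if \<gamma> = \<beta> then 1 else (0::real)"] by auto
  let ?d = "\<lambda>k. if k < r then \<phi> (ax k) else 0"
  have "pairing r \<gamma> ?d = \<phi> \<gamma>" if "\<gamma> \<in> B" for \<gamma>
  proof -
    have "\<phi> \<gamma> = \<phi> (\<Sum>i<r. \<gamma> i *\<^sub>R ax i)" using Rn_sum_ax[OF vbasis_sub[OF assms that]] by simp
    also have "\<dots> = (\<Sum>i<r. \<gamma> i * \<phi> (ax i))" by (simp add: linear_sum[OF phi(1)] linear_scale[OF phi(1)])
    finally show ?thesis by (simp add: pairing_def)
  qed
  then have "?d \<in> Rn r \<and> (\<forall>\<gamma>\<in>B. pairing r \<gamma> ?d = (if \<gamma> = \<beta> then 1 else 0))"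
    using phi(2) by (auto simp: Rn_def')
  from someI[of "\<lambda>d. d \<in> Rn r \<and> (\<forall>\<gamma>\<in>B. pairing r \<gamma> d = (if \<gamma> = \<beta> then 1 else 0))", OF this]
  have *: "dual r B \<beta> \<in> Rn r \<and> (\<forall>\<gamma>\<in>B. pairing r \<gamma> (dual r B \<beta>) = (if \<gamma> = \<beta> then 1 else 0))"
    unfolding dual_def .
  then show "dual r B \<beta> \<in> Rn r" by blast
  show "pairing r \<gamma> (dual r B \<beta>) = (if \<gamma> = \<beta> then 1 else 0)" if "\<gamma> \<in> B" using * that by blast
qed

lemma pairing_zero_span:
  assumes "vbasis r B" "\<And>\<beta>. \<beta> \<in> B \<Longrightarrow> pairing r \<beta> x = 0" "\<gamma> \<in> Rn r"
  shows "pairing r \<gamma> x = 0"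
proof -
  have "\<gamma> \<in> span B" using assms by (simp add: vbasis_def)
  then show ?thesis
    by (rule linear_eq_on_span[OF linear_pairing_left linear_zero, rotated]) (use assms in auto)
qed

lemma expand_dual:
  assumes "vbasis r B" "x \<in> Rn r"
  shows "x = (\<Sum>\<beta>\<in>B. pairing r \<beta> x *\<^sub>R dual r B \<beta>)"
proof -
  let ?y = "x - (\<Sum>\<beta>\<in>B. pairing r \<beta> x *\<^sub>R dual r B \<beta>)"
  have fin: "finite B" using assms by (simp add: vbasis_def)
  have "pairing r \<gamma> ?y = 0" if "\<gamma> \<in> B" for \<gamma>
    using that fin
    by (simp add: pairing_simps pairing_sum pairing_dual[OF assms(1) that] if_distrib[of "(*) _"] cong: if_cong)
  then have "pairing r \<gamma> ?y = 0" if "\<gamma> \<in> Rn r" for \<gamma>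
    using pairing_zero_span[OF assms(1)] that by blast
  then have "?y = 0"
    by (intro pairing_nondegenerate[of _ r]) (auto intro!: Rn_closed dual_in[OF assms(1)] assms(2))
  then show ?thesis by simp
qed

lemma expand_basis:
  assumes "vbasis r B" "\<gamma> \<in> Rn r"
  shows "\<gamma> = (\<Sum>\<beta>\<in>B. pairing r \<gamma> (dual r B \<beta>) *\<^sub>R \<beta>)"
proof -
  let ?y = "\<gamma> - (\<Sum>\<beta>\<in>B. pairing r \<gamma> (dual r B \<beta>) *\<^sub>R \<beta>)"
  have fin: "finite B" using assms by (simp add: vbasis_def)
  have yin: "?y \<in> Rn r" using assms vbasis_sub by (auto intro!: Rn_closed)
  have d: "pairing r ?y (dual r B \<delta>) = 0" if "\<delta> \<in> B" for \<delta>
    using that fin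
    by (simp add: pairing_simps pairing_sum_left pairing_dual[OF assms(1)] if_distrib[of "(*) _"] cong: if_cong)
  have "pairing r ?y x = 0" if "x \<in> Rn r" for x
    by (subst expand_dual[OF assms(1) that]) (simp add: pairing_sum pairing_simps(7) d)
  then have "?y = 0"
    by (intro pairing_nondegenerate[OF yin]) (simp add: pairing_commute)
  then show ?thesis by simp
qed

lemma vbasis_dual:
  assumes "vbasis r B"
  shows "inj_on (dual r B) B" and "vbasis r (dual r B ` B)"
    and "D \<subseteq> B \<Longrightarrow> independent (dual r B ` D)"
proof -
  have fin: "finite B" using assms by (simp add: vbasis_def)
  show inj: "inj_on (dual r B) B"
    by (rule inj_onI) (metis pairing_dual[OF assms] zero_neq_one)
  have ind: "independent (dual r B ` B)"
    unfolding independent_explicit_finite_subsets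
  proof (intro allI impI ballI)
    fix S :: "(nat \<Rightarrow> real) set" and u :: "(nat \<Rightarrow> real) \<Rightarrow> real" and v
    assume S: "S \<subseteq> dual r B ` B" "finite S" "(\<Sum>v\<in>S. u v *\<^sub>R v) = 0" "v \<in> S"
    then obtain \<beta> where b: "\<beta> \<in> B" "v = dual r B \<beta>" by auto
    have z: "pairing r \<beta> w = (if w = v then 1 else 0)" if w: "w \<in> S" for w
    proof -
      obtain \<gamma> where "w = dual r B \<gamma>" "\<gamma> \<in> B" using w S(1) by blast
      then show ?thesis using b pairing_dual[OF assms b(1)] inj by (auto dest: inj_onD)
    qed
    have "pairing r \<beta> (\<Sum>w\<in>S. u w *\<^sub>R w) = (\<Sum>w\<in>S. if w = v then u w else 0)"
      unfolding pairing_sum pairing_simps using z by (intro sum.cong refl) auto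
    then show "u v = 0" using S by (simp add: pairing_simps)
  qed
  moreover have "span (dual r B ` B) = Rn r"
  proof
    show "span (dual r B ` B) \<subseteq> Rn r" by (rule span_minimal) (auto simp: dual_in[OF assms] subspace_Rn)
    show "Rn r \<subseteq> span (dual r B ` B)"
    proof
      fix x assume "x \<in> Rn r"
      then have "x = (\<Sum>\<beta>\<in>B. pairing r \<beta> x *\<^sub>R dual r B \<beta>)" by (rule expand_dual[OF assms])
      also have "\<dots> \<in> span (dual r B ` B)" by (intro span_sum span_scale span_base imageI)
      finally show "x \<in> span (dual r B ` B)" .
    qed
  qed
  ultimately show "vbasis r (dual r B ` B)" using fin by (simp add: vbasis_def)
  show "independent (dual r B ` D)" if "D \<subseteq> B" using ind that by (meson image_mono independent_mono)
qed

definition open_cone :: "nat \<Rightarrow> (nat \<Rightarrow> real) set \<Rightarrow> (nat \<Rightarrow> real) set"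
  where "open_cone r B = {x \<in> Rn r. \<forall>\<beta>\<in>B. pairing r \<beta> x > 0}"

definition closed_cone :: "nat \<Rightarrow> (nat \<Rightarrow> real) set \<Rightarrow> (nat \<Rightarrow> real) set"
  where "closed_cone r B = {x \<in> Rn r. \<forall>\<beta>\<in>B. pairing r \<beta> x \<ge> 0}"

lemma dual_sum_in_cone:
  assumes "vbasis r B"
  shows "(\<Sum>\<beta>\<in>B. dual r B \<beta>) \<in> open_cone r B"
  unfolding open_cone_def using assms
  by (auto intro!: Rn_closed dual_in simp: pairing_sum pairing_dual vbasis_def)

lemma open_simplicial_cone_cone:
  assumes "vbasis r B"
  shows "open_simplicial_cone r (open_cone r B)"
  unfolding open_simplicial_cone_def
proof (intro exI conjI)
  let ?D = "dual r B ` B"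
  note inj = vbasis_dual(1)[OF assms]
  show "finite ?D" "independent ?D" "span ?D = Rn r" using vbasis_dual(2)[OF assms] by (auto simp: vbasis_def)
  have fin: "finite B" using assms by (simp add: vbasis_def)
  show "open_cone r B = {(\<Sum>v\<in>?D. a v *\<^sub>R v) | a. \<forall>v\<in>?D. a v > 0}" (is "_ = ?S")
  proof (intro equalityI subsetI)
    fix x assume x: "x \<in> open_cone r B"
    let ?a = "\<lambda>v. pairing r (inv_into B (dual r B) v) x"
    have "x = (\<Sum>\<beta>\<in>B. pairing r \<beta> x *\<^sub>R dual r B \<beta>)"
      using x by (intro expand_dual[OF assms]) (simp add: open_cone_def)
    also have "\<dots> = (\<Sum>v\<in>?D. ?a v *\<^sub>R v)" by (simp add: sum.reindex[OF inj] inv_into_f_f[OF inj])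
    finally have "x = (\<Sum>v\<in>?D. ?a v *\<^sub>R v)" .
    moreover have "\<forall>v\<in>?D. ?a v > 0" using x by (auto simp: open_cone_def inv_into_f_f[OF inj])
    ultimately show "x \<in> ?S" by (intro CollectI exI[of _ ?a] conjI)
  next
    fix x assume "x \<in> ?S"
    then obtain a :: "(nat \<Rightarrow> real) \<Rightarrow> real" where a: "x = (\<Sum>v\<in>?D. a v *\<^sub>R v)" "\<forall>v\<in>?D. a v > 0" by blast
    have x: "x = (\<Sum>\<beta>\<in>B. a (dual r B \<beta>) *\<^sub>R dual r B \<beta>)" unfolding a(1) by (simp add: sum.reindex[OF inj])
    have "pairing r \<beta> x = a (dual r B \<beta>)" if "\<beta> \<in> B" for \<beta>
      unfolding x using that fin
      by (simp add: pairing_sum pairing_simps pairing_dual[OF assms that] if_distrib[of "(*) _"] cong: if_cong)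
    then show "x \<in> open_cone r B" using a(2) x by (auto simp: open_cone_def intro!: Rn_closed dual_in[OF assms])
  qed
qed

lemma Euclidean_space_eq: "Euclidean_space r = top_of_set (Rn r)"
  by (simp add: Euclidean_space_def topspace_Euclidean_space euclidean_product_topology)

lemma continuous_pairing: "continuous_on S (pairing r \<alpha>)"
  unfolding pairing_def by (intro continuous_intros continuous_on_subset[OF continuous_on_product_coordinates]) auto

lemma continuous_line: "continuous_on S (\<lambda>t::real. x + t *\<^sub>R p)" for x p :: "nat \<Rightarrow> real"
  by (intro continuous_on_coordinatewise_then_product) (simp add: scaleR_fun_apply, intro continuous_intros)

lemma closed_Rn: "closed (Rn r)"
  using closedin_Euclidean_imp_closed[of r "Rn r"] by auto

text \<open>Translating a point of the closed cone by positive multiples of an interior vector moves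
  it into the open cone, and the multiples may tend to 0.\<close>

lemma closure_cone:
  assumes "vbasis r B"
  shows "Euclidean_space r closure_of open_cone r B = closed_cone r B"
proof -
  have sub: "open_cone r B \<subseteq> Rn r" by (auto simp: open_cone_def)
  have "closed (closed_cone r B)"
  proof -
    have "closed_cone r B = Rn r \<inter> (\<Inter>\<beta>\<in>B. pairing r \<beta> -` {0..})" by (auto simp: closed_cone_def)
    moreover have "closed (pairing r \<beta> -` {0..})" for \<beta>
      by (rule closed_vimage[OF closed_atLeast continuous_pairing])
    ultimately show ?thesis by (simp add: closed_Int closed_INT closed_Rn)
  qed
  moreover have "open_cone r B \<subseteq> closed_cone r B" by (auto simp: open_cone_def closed_cone_def intro: less_imp_le)
  ultimately have 1: "closure (open_cone r B) \<subseteq> closed_cone r B" by (rule closure_minimal[rotated])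
  have 2: "closed_cone r B \<subseteq> closure (open_cone r B)"
  proof
    fix x assume x: "x \<in> closed_cone r B"
    let ?p = "\<Sum>\<beta>\<in>B. dual r B \<beta>"
    note p = dual_sum_in_cone[OF assms]
    have "x + t *\<^sub>R ?p \<in> open_cone r B" if "t > 0" for t :: real
      using x p that by (auto simp: open_cone_def closed_cone_def pairing_simps intro!: Rn_closed add_nonneg_pos)
    then have "(\<lambda>t. x + t *\<^sub>R ?p) ` {0::real<..} \<subseteq> closure (open_cone r B)" using closure_subset by blast
    then have "(\<lambda>t. x + t *\<^sub>R ?p) ` closure {0::real<..} \<subseteq> closure (open_cone r B)"
      by (intro image_closure_subset continuous_line closed_closure)
    then have "x + 0 *\<^sub>R ?p \<in> closure (open_cone r B)"
      unfolding image_subset_iff by (rule bspec) simp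
    then show "x \<in> closure (open_cone r B)" by simp
  qed
  have "Rn r \<inter> closed_cone r B = closed_cone r B" by (auto simp: closed_cone_def)
  moreover have "closure (open_cone r B) = closed_cone r B" using 1 2 by (rule equalityI)
  moreover have "Rn r \<inter> open_cone r B = open_cone r B" using sub by (rule Int_absorb1)
  ultimately show ?thesis
    by (subst Euclidean_space_eq) (simp only: closure_of_subtopology euclidean_closure_of)
qed

section \<open>Chambers as regions of constant sign\<close>

definition region :: "nat \<Rightarrow> (nat \<Rightarrow> real) set \<Rightarrow> (nat \<Rightarrow> real) \<Rightarrow> (nat \<Rightarrow> real) set"
  where "region r R x = {y \<in> Rn r. \<forall>\<alpha>\<in>R. pairing r \<alpha> y * pairing r \<alpha> x > 0}"

definition generic :: "nat \<Rightarrow> (nat \<Rightarrow> real) set \<Rightarrow> (nat \<Rightarrow> real) \<Rightarrow> bool"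
  where "generic r R x \<longleftrightarrow> x \<in> Rn r \<and> (\<forall>\<alpha>\<in>R. pairing r \<alpha> x \<noteq> 0)"

lemma segment_pos:
  fixes a b c t :: real
  assumes "a * c > 0" "b * c > 0" "0 \<le> t" "t \<le> 1"
  shows "(a + t * (b - a)) * c > 0"
proof -
  have "(a + t * (b - a)) * c = (1 - t) * (a * c) + t * (b * c)" by (simp add: algebra_simps)
  also have "\<dots> > 0"
    using assms by (cases "t = 0") (auto intro!: add_nonneg_pos)
  finally show ?thesis .
qed

text \<open>On a connected set avoiding the hyperplanes no root changes sign, by the intermediate
  value theorem; conversely the segment between two points with the same signs stays off the
  hyperplanes.\<close>

lemma chambers_eq: "chambers r (perp r ` R) = region r R ` {x. generic r R x}"
proof -
  let ?S = "{x. generic r R x}"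
  have S: "Rn r - \<Union>(perp r ` R) = ?S" by (auto simp: perp_def generic_def)
  have SR: "?S \<subseteq> Rn r" by (auto simp: generic_def)
  have X: "subtopology (Euclidean_space r) ?S = top_of_set ?S"
    by (subst Euclidean_space_eq) (simp only: subtopology_subtopology Int_absorb1[OF SR])
  have comp: "connected_component_of_set (top_of_set ?S) x = region r R x" if x: "generic r R x" for x
  proof (intro equalityI subsetI)
    fix y assume "y \<in> connected_component_of_set (top_of_set ?S) x"
    then obtain T where T: "connectedin (top_of_set ?S) T" "x \<in> T" "y \<in> T"
      by (auto simp: connected_component_of_def)
    then have c: "connected T" and TS: "T \<subseteq> ?S"
      by (auto simp: connectedin_subtopology connectedin_iff_connected)
    have "pairing r \<alpha> y * pairing r \<alpha> x > 0" if a: "\<alpha> \<in> R" for \<alpha>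
    proof (rule ccontr)
      have ci: "connected (pairing r \<alpha> ` T)"
        by (rule connected_continuous_image[OF continuous_pairing c])
      assume "\<not> ?thesis"
      moreover have nz: "pairing r \<alpha> z \<noteq> 0" if "z \<in> T" for z using TS that a by (auto simp: generic_def)
      ultimately have "pairing r \<alpha> y < 0 \<and> pairing r \<alpha> x > 0 \<or> pairing r \<alpha> y > 0 \<and> pairing r \<alpha> x < 0"
        using nz[OF T(2)] nz[OF T(3)] by (metis linorder_neqE_linordered_idom mult_neg_neg mult_pos_pos)
      then have "0 \<in> pairing r \<alpha> ` T"
        using connectedD_interval[OF ci, of "pairing r \<alpha> y" "pairing r \<alpha> x" 0]
          connectedD_interval[OF ci, of "pairing r \<alpha> x" "pairing r \<alpha> y" 0] T(2,3) by auto
      with nz show False by force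
    qed
    moreover have "y \<in> Rn r" using T(3) TS SR by blast
    ultimately show "y \<in> region r R x" by (simp add: region_def)
  next
    fix y assume y: "y \<in> region r R x"
    let ?g = "\<lambda>t::real. x + t *\<^sub>R (y - x)"
    have c: "connected (?g ` {0..1})" by (intro connected_continuous_image continuous_line) simp
    have "?g t \<in> ?S" if t: "t \<in> {0..1}" for t
    proof -
      have "?g t \<in> Rn r" using x y by (auto simp: generic_def region_def intro!: Rn_closed)
      moreover have "pairing r \<alpha> (?g t) \<noteq> 0" if a: "\<alpha> \<in> R" for \<alpha>
      proof -
        have "pairing r \<alpha> x * pairing r \<alpha> x > 0" using x a by (auto simp: generic_def zero_less_mult_iff neq_iff)
        moreover have "pairing r \<alpha> y * pairing r \<alpha> x > 0" using y a by (simp add: region_def)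
        ultimately have "(pairing r \<alpha> x + t * (pairing r \<alpha> y - pairing r \<alpha> x)) * pairing r \<alpha> x > 0"
          using t by (intro segment_pos) auto
        then show ?thesis by (auto simp: pairing_simps)
      qed
      ultimately show ?thesis by (simp add: generic_def)
    qed
    then have "connectedin (top_of_set ?S) (?g ` {0..1})"
      using c by (auto simp: connectedin_subtopology connectedin_iff_connected)
    moreover have "x \<in> ?g ` {0..1}" by (rule image_eqI[of _ _ 0]) auto
    moreover have "y \<in> ?g ` {0..1}" by (rule image_eqI[of _ _ 1]) auto
    ultimately show "y \<in> connected_component_of_set (top_of_set ?S) x"
      unfolding connected_component_of_def by blast
  qed
  show ?thesis
    unfolding chambers_def S X connected_components_of_def using comp by (auto intro!: image_cong)
qed

lemma region_self: "generic r R x \<Longrightarrow> x \<in> region r R x"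
  by (auto simp: generic_def region_def zero_less_mult_iff neq_iff)

lemma region_eq:
  assumes "generic r R x" "y \<in> region r R x"
  shows "generic r R y" "region r R y = region r R x"
proof -
  have s: "pairing r \<alpha> y * pairing r \<alpha> x > 0" if "\<alpha> \<in> R" for \<alpha> using assms(2) that by (simp add: region_def)
  show "generic r R y" using assms(2) s by (force simp: generic_def region_def)
  show "region r R y = region r R x"
    unfolding region_def using s by (auto simp: zero_less_mult_iff) (metis less_asym)+
qed

section \<open>Chambers of root arrangements\<close>

text \<open>The pairing matrix between \<open>b\<close> and \<open>D\<close> is diagonal and
  invertible, so \<open>b\<close> is up to scaling the dual basis of \<open>D\<close>. Later
  \<open>D\<close> generates a simplicial cone and \<open>b v\<close> is a root vanishing on the
  facet opposite to \<open>v\<close>.\<close>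

lemma vbasis_I:
  assumes D: "vbasis r D" and b: "\<And>v. v \<in> D \<Longrightarrow> b v \<in> Rn r"
    and zero: "\<And>u v. u \<in> D \<Longrightarrow> v \<in> D \<Longrightarrow> u \<noteq> v \<Longrightarrow> pairing r (b v) u = 0"
    and pos: "\<And>v. v \<in> D \<Longrightarrow> pairing r (b v) v \<noteq> 0"
  shows "inj_on b D" "vbasis r (b ` D)"
proof -
  have fin: "finite D" using D by (simp add: vbasis_def)
  show inj: "inj_on b D" by (rule inj_onI) (metis zero pos)
  have "independent (b ` D)"
    unfolding independent_explicit_finite_subsets
  proof (intro allI impI ballI)
    fix S :: "(nat \<Rightarrow> real) set" and u :: "(nat \<Rightarrow> real) \<Rightarrow> real" and w
    assume S: "S \<subseteq> b ` D" "finite S" "(\<Sum>v\<in>S. u v *\<^sub>R v) = 0" "w \<in> S"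
    then obtain v where v: "v \<in> D" "w = b v" by auto
    have z: "pairing r s v = (if s = w then pairing r w v else 0)" if s: "s \<in> S" for s
    proof -
      obtain v' where "s = b v'" "v' \<in> D" using s S(1) by blast
      then show ?thesis using v zero[of v v'] by auto
    qed
    have "pairing r (\<Sum>s\<in>S. u s *\<^sub>R s) v = (\<Sum>s\<in>S. u s * pairing r s v)"
      by (simp add: pairing_sum_left pairing_simps)
    also have "\<dots> = (\<Sum>s\<in>S. if s = w then u w * pairing r w v else 0)"
      by (intro sum.cong refl) (subst z, auto)
    also have "\<dots> = u w * pairing r w v" using S by simp
    finally have "u w * pairing r w v = 0" unfolding S(3) by (simp add: pairing_simps)
    then show "u w = 0" using pos v by simp
  qed
  moreover have "span (b ` D) = Rn r"
  proof
    show "span (b ` D) \<subseteq> Rn r" by (rule span_minimal) (use b subspace_Rn in auto)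
    show "Rn r \<subseteq> span (b ` D)"
    proof
      fix \<gamma> assume g: "\<gamma> \<in> Rn r"
      let ?s = "\<Sum>v\<in>D. (pairing r \<gamma> v / pairing r (b v) v) *\<^sub>R b v"
      have sin: "?s \<in> Rn r" by (intro Rn_closed b)
      have "pairing r u (\<gamma> - ?s) = 0" if u: "u \<in> D" for u
      proof -
        have "pairing r ?s u = (\<Sum>v\<in>D. if v = u then pairing r \<gamma> v else 0)"
          unfolding pairing_sum_left
          by (intro sum.cong refl) (auto simp: pairing_simps zero u pos)
        then show ?thesis using u fin
          by (simp add: pairing_simps pairing_commute[of r u])
      qed
      then have "pairing r \<delta> (\<gamma> - ?s) = 0" if "\<delta> \<in> Rn r" for \<delta>
        by (rule pairing_zero_span[OF D _ that])
      then have "\<gamma> - ?s = 0" by (intro pairing_nondegenerate[of _ r] Rn_closed(3) g sin)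
      then have "\<gamma> = ?s" by simp
      moreover have "?s \<in> span (b ` D)" by (intro span_sum span_scale span_base imageI)
      ultimately show "\<gamma> \<in> span (b ` D)" by simp
    qed
  qed
  ultimately show "vbasis r (b ` D)" using fin by (simp add: vbasis_def)
qed

lemma dual_unique:
  assumes "vbasis r B" "d \<in> Rn r" "\<And>\<gamma>. \<gamma> \<in> B \<Longrightarrow> pairing r \<gamma> d = (if \<gamma> = \<beta> then 1 else 0)"
  shows "dual r B \<beta> = d"
proof -
  have "pairing r \<gamma> (dual r B \<beta> - d) = 0" if "\<gamma> \<in> B" for \<gamma>
    using assms(3)[OF that] pairing_dual[OF assms(1) that, of \<beta>] by (simp add: pairing_simps)
  then have "pairing r \<gamma> (dual r B \<beta> - d) = 0" if "\<gamma> \<in> Rn r" for \<gamma>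
    using pairing_zero_span[OF assms(1)] that by blast
  then have "dual r B \<beta> - d = 0"
    by (intro pairing_nondegenerate[of _ r] Rn_closed dual_in[OF assms(1)] assms(2))
  then show ?thesis by simp
qed

locale reduced_roots =
  fixes r :: nat and R :: "(nat \<Rightarrow> real) set"
  assumes finite_R: "finite R" and R_sub: "R \<subseteq> Rn r"
    and sym_R: "\<And>\<alpha>. \<alpha> \<in> R \<Longrightarrow> - \<alpha> \<in> R"
    and reduced: "\<And>\<alpha> t. \<alpha> \<in> R \<Longrightarrow> t *\<^sub>R \<alpha> \<in> R \<Longrightarrow> t = 1 \<or> t = -1"
begin

abbreviation "\<A> \<equiv> perp r ` R"

lemma zero_notin: "0 \<notin> R"
  using reduced[of 0 2] by auto

text \<open>Sign coherence with real coordinates, read off by the dual basis. The geometry of a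
  chamber needs only this; integrality is added in \<open>rbase_lbase\<close>.\<close>

definition rbase :: "(nat \<Rightarrow> real) set \<Rightarrow> bool"
  where "rbase B \<longleftrightarrow> vbasis r B \<and> B \<subseteq> R \<and>
    (\<forall>\<alpha>\<in>R. (\<forall>\<beta>\<in>B. pairing r \<alpha> (dual r B \<beta>) \<ge> 0) \<or> (\<forall>\<beta>\<in>B. pairing r \<alpha> (dual r B \<beta>) \<le> 0))"

definition positive :: "(nat \<Rightarrow> real) set \<Rightarrow> (nat \<Rightarrow> real) \<Rightarrow> bool"
  where "positive B \<alpha> \<longleftrightarrow> (\<forall>\<beta>\<in>B. pairing r \<alpha> (dual r B \<beta>) \<ge> 0)"

context
  fixes B
  assumes B: "rbase B"
begin

lemma rbase_vbasis: "vbasis r B" and rbase_subset: "B \<subseteq> R" and rbase_finite: "finite B"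
  using B by (auto simp: rbase_def vbasis_def)

lemma pairing_expand:
  assumes "\<alpha> \<in> R"
  shows "pairing r \<alpha> x = (\<Sum>\<beta>\<in>B. pairing r \<alpha> (dual r B \<beta>) * pairing r \<beta> x)"
proof -
  have "\<alpha> \<in> Rn r" using assms R_sub by blast
  then have "pairing r \<alpha> x = pairing r (\<Sum>\<beta>\<in>B. pairing r \<alpha> (dual r B \<beta>) *\<^sub>R \<beta>) x"
    using expand_basis[OF rbase_vbasis] by simp
  then show ?thesis by (simp add: pairing_sum_left pairing_simps)
qed

lemma coordinate_nonzero:
  assumes "\<alpha> \<in> R"
  shows "\<exists>\<beta>\<in>B. pairing r \<alpha> (dual r B \<beta>) \<noteq> 0"
proof (rule ccontr)
  assume "\<not> ?thesis"
  moreover have "\<alpha> \<in> Rn r" using assms R_sub by blast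
  ultimately have "\<alpha> = 0" using expand_basis[OF rbase_vbasis, of \<alpha>] by simp
  with assms zero_notin show False by simp
qed

lemma positive_uminus: "\<alpha> \<in> R \<Longrightarrow> \<not> positive B \<alpha> \<Longrightarrow> positive B (- \<alpha>)"
  using B by (auto simp: rbase_def positive_def pairing_simps)

lemma positive_open: 
  assumes "\<alpha> \<in> R" "positive B \<alpha>" "x \<in> open_cone r B"
  shows "pairing r \<alpha> x > 0"
proof -
  obtain \<beta> where "\<beta> \<in> B" "pairing r \<alpha> (dual r B \<beta>) \<noteq> 0" using coordinate_nonzero[OF assms(1)] by blast
  then show ?thesis unfolding pairing_expand[OF assms(1), of x]
    using assms(2,3) rbase_finite
    by (intro sum_pos2[of B \<beta>]) (auto simp: positive_def open_cone_def order_less_le)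
qed

lemma positive_closed: 
  assumes "\<alpha> \<in> R" "positive B \<alpha>" "x \<in> closed_cone r B"
  shows "pairing r \<alpha> x \<ge> 0"
  unfolding pairing_expand[OF assms(1), of x]
  using assms(2,3) by (intro sum_nonneg) (auto simp: positive_def closed_cone_def)

lemma positive_base: "\<beta> \<in> B \<Longrightarrow> positive B \<beta>"
  by (auto simp: positive_def pairing_dual[OF rbase_vbasis])

text \<open>Every root has one sign on the open cone, given by the sign of its coordinates, so the
  signs on \<open>B\<close> determine all others.\<close>

lemma
  assumes "x \<in> open_cone r B"
  shows open_cone_generic: "generic r R x" and region_open_cone: "region r R x = open_cone r B"
proof -
  have s: "pairing r \<alpha> x > 0 \<or> pairing r (- \<alpha>) x > 0" if "\<alpha> \<in> R" for \<alpha>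
    using positive_open[OF that _ assms] positive_open[OF sym_R[OF that] positive_uminus[OF that] assms] by blast
  then show "generic r R x" using assms by (force simp: generic_def open_cone_def pairing_simps)
  show "region r R x = open_cone r B"
  proof (intro equalityI subsetI)
    fix y assume y: "y \<in> region r R x"
    have "pairing r \<beta> y > 0" if "\<beta> \<in> B" for \<beta>
    proof -
      have "pairing r \<beta> y * pairing r \<beta> x > 0" using y rbase_subset that by (auto simp: region_def)
      moreover have "pairing r \<beta> x > 0" using assms that by (simp add: open_cone_def)
      ultimately show ?thesis by (simp add: zero_less_mult_iff)
    qed
    then show "y \<in> open_cone r B" using y by (simp add: open_cone_def region_def)
  next
    fix y assume y: "y \<in> open_cone r B"
    have "pairing r \<alpha> y * pairing r \<alpha> x > 0" if a: "\<alpha> \<in> R" for \<alpha>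
    proof (cases "positive B \<alpha>")
      case True
      then show ?thesis using positive_open[OF a True] y assms by simp
    next
      case False
      from positive_open[OF sym_R[OF a] positive_uminus[OF a False]] y assms
      have "pairing r \<alpha> y < 0" "pairing r \<alpha> x < 0" by (force simp: pairing_simps)+
      then show ?thesis by (simp add: mult_neg_neg)
    qed
    then show "y \<in> region r R x" using y by (simp add: region_def open_cone_def)
  qed
qed

text \<open>The dual vectors other than that of \<beta> form a basis of the hyperplane. Any set
  between them and the hyperplane thus has full dimension; this covers the hyperplane itself, a
  facet, and the common facet of two chambers.\<close>

lemma dim_perp_between:
  assumes "\<beta> \<in> B" "(dual r B ` (B - {\<beta>})) \<subseteq> X" "X \<subseteq> perp r \<beta>"
  shows "dim X = r - 1" and "perp r \<beta> \<subseteq> span X"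
proof -
  have sp: "perp r \<beta> \<subseteq> span (dual r B ` (B - {\<beta>}))"
  proof
    fix x assume x: "x \<in> perp r \<beta>"
    then have "x = (\<Sum>\<gamma>\<in>B. pairing r \<gamma> x *\<^sub>R dual r B \<gamma>)"
      by (intro expand_dual[OF rbase_vbasis]) (simp add: perp_def)
    also have "\<dots> = (\<Sum>\<gamma>\<in>B - {\<beta>}. pairing r \<gamma> x *\<^sub>R dual r B \<gamma>)"
      using x assms(1) rbase_finite by (subst sum.remove[of B \<beta>]) (auto simp: perp_def)
    also have "\<dots> \<in> span (dual r B ` (B - {\<beta>}))" by (intro span_sum span_scale span_base imageI)
    finally show "x \<in> span (dual r B ` (B - {\<beta>}))" .
  qed
  then show "perp r \<beta> \<subseteq> span X" using span_mono[OF assms(2)] by blast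
  have "card (dual r B ` (B - {\<beta>})) = card (B - {\<beta>})"
    by (rule card_image) (rule inj_on_subset[OF vbasis_dual(1)[OF rbase_vbasis]], auto)
  also have "\<dots> = r - 1" using assms(1) rbase_finite card_vbasis[OF rbase_vbasis] by simp
  finally show "dim X = r - 1"
    using sp assms vbasis_dual(3)[OF rbase_vbasis, of "B - {\<beta>}"] by (intro dim_unique[of "dual r B ` (B - {\<beta>})"]) auto
qed

lemma dual_closed_cone: "dual r B \<beta> \<in> closed_cone r B"
  unfolding closed_cone_def using dual_in[OF rbase_vbasis] pairing_dual[OF rbase_vbasis] by auto

lemma dual_perp: "\<gamma> \<in> B \<Longrightarrow> \<beta> \<noteq> \<gamma> \<Longrightarrow> dual r B \<beta> \<in> perp r \<gamma>"
  unfolding perp_def using dual_in[OF rbase_vbasis] pairing_dual[OF rbase_vbasis] by auto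

lemma single_coordinate:
  assumes "\<alpha> \<in> R" "\<beta> \<in> B" "\<And>\<gamma>. \<gamma> \<in> B \<Longrightarrow> \<gamma> \<noteq> \<beta> \<Longrightarrow> pairing r \<alpha> (dual r B \<gamma>) = 0"
  shows "\<alpha> = \<beta> \<or> \<alpha> = - \<beta>"
proof -
  have "\<alpha> \<in> Rn r" using assms R_sub by blast
  then have "\<alpha> = (\<Sum>\<gamma>\<in>B. pairing r \<alpha> (dual r B \<gamma>) *\<^sub>R \<gamma>)" by (rule expand_basis[OF rbase_vbasis])
  also have "\<dots> = pairing r \<alpha> (dual r B \<beta>) *\<^sub>R \<beta>"
    using assms rbase_finite by (subst sum.remove[of B \<beta>]) auto
  finally have eq: "\<alpha> = pairing r \<alpha> (dual r B \<beta>) *\<^sub>R \<beta>" .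
  have "\<beta> \<in> R" using assms rbase_subset by blast
  from reduced[OF this] eq assms(1) show ?thesis by (metis scaleR_minus1_left scaleR_one)
qed

text \<open>A root that is nonnegative on the cone has nonnegative coordinates, so it vanishes
  exactly on the face generated by the dual vectors at which its coordinate is 0. Two nonzero
  coordinates leave at most \<open>r - 2\<close> generators, too few for a wall.\<close>

lemma chamber_basis_open_cone: "chamber_basis r \<A> R (open_cone r B) = B"
proof (intro equalityI subsetI)
  fix \<beta> assume b: "\<beta> \<in> B"
  then have bR: "\<beta> \<in> R" using rbase_subset by blast
  have "dual r B ` (B - {\<beta>}) \<subseteq> perp r \<beta> \<inter> closed_cone r B"
    using dual_closed_cone dual_perp[OF b] by blast
  from dim_perp_between(1)[OF b this] have "perp r \<beta> \<in> walls r \<A> (open_cone r B)"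
    unfolding walls_def closure_cone[OF rbase_vbasis] using bR by auto
  then show "\<beta> \<in> chamber_basis r \<A> R (open_cone r B)"
    unfolding chamber_basis_def using bR b by (auto simp: open_cone_def less_imp_le)
next
  fix \<alpha> assume "\<alpha> \<in> chamber_basis r \<A> R (open_cone r B)"
  then have aR: "\<alpha> \<in> R" and nn: "\<And>x. x \<in> open_cone r B \<Longrightarrow> pairing r \<alpha> x \<ge> 0"
    and dim: "dim (perp r \<alpha> \<inter> closed_cone r B) = r - 1"
    unfolding chamber_basis_def walls_def closure_cone[OF rbase_vbasis] by auto
  have pos: "positive B \<alpha>"
  proof (rule ccontr)
    assume "\<not> ?thesis"
    from positive_open[OF sym_R[OF aR] positive_uminus[OF aR this] dual_sum_in_cone[OF rbase_vbasis]]
      nn[OF dual_sum_in_cone[OF rbase_vbasis]] show False by (simp add: pairing_simps)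
  qed
  obtain \<beta> where b: "\<beta> \<in> B" "pairing r \<alpha> (dual r B \<beta>) \<noteq> 0" using coordinate_nonzero[OF aR] by blast
  have "\<not> (\<exists>\<gamma>\<in>B. \<gamma> \<noteq> \<beta> \<and> pairing r \<alpha> (dual r B \<gamma>) \<noteq> 0)"
  proof
    assume "\<exists>\<gamma>\<in>B. \<gamma> \<noteq> \<beta> \<and> pairing r \<alpha> (dual r B \<gamma>) \<noteq> 0"
    then obtain \<gamma> where g: "\<gamma> \<in> B" "\<gamma> \<noteq> \<beta>" "pairing r \<alpha> (dual r B \<gamma>) \<noteq> 0" by blast
    have z: "pairing r \<delta> x = 0"
      if x: "x \<in> perp r \<alpha> \<inter> closed_cone r B" and d: "\<delta> \<in> B" "pairing r \<alpha> (dual r B \<delta>) \<noteq> 0" for x \<delta>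
    proof -
      have "(\<Sum>\<beta>\<in>B. pairing r \<alpha> (dual r B \<beta>) * pairing r \<beta> x) = 0"
        using x pairing_expand[OF aR, of x] by (simp add: perp_def)
      then have "\<forall>\<beta>\<in>B. pairing r \<alpha> (dual r B \<beta>) * pairing r \<beta> x = 0"
        using x pos rbase_finite by (subst (asm) sum_nonneg_eq_0_iff) (auto simp: positive_def closed_cone_def)
      with d show ?thesis by auto
    qed
    have "perp r \<alpha> \<inter> closed_cone r B \<subseteq> span (dual r B ` (B - {\<beta>, \<gamma>}))"
    proof
      fix x assume x: "x \<in> perp r \<alpha> \<inter> closed_cone r B"
      then have "x = (\<Sum>\<delta>\<in>B. pairing r \<delta> x *\<^sub>R dual r B \<delta>)"
        by (intro expand_dual[OF rbase_vbasis]) (simp add: perp_def)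
      also have "\<dots> = (\<Sum>\<delta>\<in>B - {\<beta>, \<gamma>}. pairing r \<delta> x *\<^sub>R dual r B \<delta>)"
        using z[OF x b] z[OF x g(1,3)] rbase_finite by (intro sum.mono_neutral_right) auto
      also have "\<dots> \<in> span (dual r B ` (B - {\<beta>, \<gamma>}))" by (intro span_sum span_scale span_base imageI)
      finally show "x \<in> span (dual r B ` (B - {\<beta>, \<gamma>}))" .
    qed
    then have "dim (perp r \<alpha> \<inter> closed_cone r B) \<le> card (dual r B ` (B - {\<beta>, \<gamma>}))"
      by (rule dim_le_card) (use rbase_finite in simp)
    also have "\<dots> \<le> card (B - {\<beta>, \<gamma>})" by (rule card_image_le) (use rbase_finite in simp)
    also have "\<dots> = r - 2"
      using b g rbase_finite card_vbasis[OF rbase_vbasis] by (subst card_Diff_subset) auto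
    \<comment> \<open>With truncated subtraction this is contradictory only for
      \<open>r \<ge> 2\<close>, which the two distinct elements of \<open>B\<close>
      guarantee.\<close>
    finally have "r - 1 \<le> r - 2" using dim by simp
    moreover have "card {\<beta>, \<gamma>} \<le> card B" using b g rbase_finite by (intro card_mono) auto
    ultimately show False using g card_vbasis[OF rbase_vbasis] by auto
  qed
  then have "\<alpha> = \<beta> \<or> \<alpha> = - \<beta>" using single_coordinate[OF aR b(1)] by blast
  moreover have "\<alpha> \<noteq> - \<beta>"
  proof
    assume "\<alpha> = - \<beta>"
    then have "pairing r \<alpha> (dual r B \<beta>) = -1" using pairing_dual[OF rbase_vbasis b(1), of \<beta>] by (simp add: pairing_simps)
    with pos b show False by (auto simp: positive_def)
  qed
  ultimately show "\<alpha> \<in> B" using b by simp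
qed

end

lemma generic_exists: "\<exists>x. generic r R x"
proof -
  \<comment> \<open>every hyperplane meets the moment curve in finitely many points\<close>
  let ?x = "\<lambda>t::real. \<lambda>k. if k < r then t ^ k else 0"
  have "finite {t. pairing r \<alpha> (?x t) = 0}" if "\<alpha> \<in> R" for \<alpha>
  proof -
    have "\<alpha> \<noteq> 0" "\<alpha> \<in> Rn r" using that zero_notin R_sub by auto
    then obtain k where k: "\<alpha> k \<noteq> 0" "k < r" by (auto simp: Rn_def' fun_eq_iff) (metis not_le)
    have eq: "pairing r \<alpha> (?x t) = (\<Sum>i\<le>r. (if i < r then \<alpha> i else 0) * t ^ i)" for t
      unfolding pairing_def by (rule sum.mono_neutral_cong_left) auto
    show ?thesis unfolding eq
      by (subst polyfun_finite_roots, rule exI[of _ k]) (use k in auto)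
  qed
  then have "finite (\<Union>\<alpha>\<in>R. {t. pairing r \<alpha> (?x t) = 0})" using finite_R by blast
  then obtain t :: real where "t \<notin> (\<Union>\<alpha>\<in>R. {t. pairing r \<alpha> (?x t) = 0})"
    using ex_new_if_finite infinite_UNIV_char_0 by blast
  then have "generic r R (?x t)" by (auto simp: generic_def Rn_def')
  then show ?thesis by blast
qed

text \<open>
  Each facet of the cone is contained in a hyperplane of the arrangement, because the sum of the
  generators of the facet does not belong to the region.
\<close>

lemma simplicial_region_rbase:
  assumes x0: "generic r R x0" and simp: "open_simplicial_cone r (region r R x0)"
  shows "\<exists>B. rbase B \<and> region r R x0 = open_cone r B"
proof -
  let ?K = "region r R x0"
  obtain D where D: "vbasis r D" and K: "?K = {(\<Sum>v\<in>D. a v *\<^sub>R v) | a :: (nat \<Rightarrow> real) \<Rightarrow> real. \<forall>v\<in>D. a v > 0}"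
    using simp unfolding open_simplicial_cone_def vbasis_def by blast
  have fin: "finite D" using D by (simp add: vbasis_def)
  have inK: "(\<Sum>v\<in>D. a v *\<^sub>R v) \<in> ?K" if "\<forall>v\<in>D. a v > 0" for a :: "(nat \<Rightarrow> real) \<Rightarrow> real"
    unfolding K using that by blast
  have sign: "pairing r \<alpha> u * pairing r \<alpha> x0 \<ge> 0" if a: "\<alpha> \<in> R" and u: "u \<in> D" for \<alpha> u
  proof (rule ccontr)
    assume "\<not> ?thesis"
    then have "pairing r \<alpha> u * pairing r \<alpha> x0 < 0" by simp
    then obtain q where q: "q = pairing r \<alpha> u * pairing r \<alpha> x0" and neg: "q < 0" by blast
    define c where "c = (\<Sum>w\<in>D - {u}. pairing r \<alpha> w) * pairing r \<alpha> x0"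
    \<comment> \<open>Weighting the generator \<open>u\<close> by this \<open>t\<close> makes its
      negative contribution \<open>t * q\<close> outweigh the total \<open>c\<close> of the
      others.\<close>
    define t where "t = (\<bar>c\<bar> + 1) / (- q)"
    have t: "t > 0" using neg by (simp add: t_def divide_pos_neg)
    let ?a = "\<lambda>w. if w = u then t else 1"
    have "pairing r \<alpha> (\<Sum>w\<in>D. ?a w *\<^sub>R w) = t * pairing r \<alpha> u + (\<Sum>w\<in>D - {u}. pairing r \<alpha> w)"
      using u fin by (subst sum.remove[OF fin u]) (simp add: pairing_simps pairing_sum)
    moreover have "pairing r \<alpha> (\<Sum>w\<in>D. ?a w *\<^sub>R w) * pairing r \<alpha> x0 > 0"
      using inK[of ?a] t a by (simp add: region_def)
    ultimately have "t * q + c > 0"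
      by (simp add: c_def q algebra_simps)
    moreover have "t * - q = \<bar>c\<bar> + 1" unfolding t_def using neg by simp
    ultimately show False by linarith
  qed
  have ex: "\<exists>\<alpha>\<in>R. pairing r \<alpha> v > 0 \<and> (\<forall>u\<in>D. u \<noteq> v \<longrightarrow> pairing r \<alpha> u = 0)" if v: "v \<in> D" for v
  proof -
    let ?p = "\<Sum>u\<in>D - {v}. u"
    have pin: "?p \<in> Rn r" using vbasis_sub[OF D] by (intro Rn_closed) auto
    have p_notin: "?p \<notin> ?K"
    proof
      assume "?p \<in> ?K"
      then obtain a where a: "?p = (\<Sum>v\<in>D. a v *\<^sub>R v)" "\<forall>v\<in>D. a v > (0::real)" unfolding K by blast
      have "pairing r (\<Sum>v\<in>D. a v *\<^sub>R v) (dual r D v) = a v"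
        using v fin by (simp add: pairing_sum_left pairing_simps pairing_dual[OF D] if_distrib[of "(*) _"] cong: if_cong)
      moreover have "pairing r ?p (dual r D v) = 0"
        using fin by (auto simp: pairing_sum_left pairing_dual[OF D] intro!: sum.neutral)
      ultimately show False using a v by force
    qed
    have pp: "pairing r \<alpha> ?p * pairing r \<alpha> x0 = (\<Sum>u\<in>D - {v}. pairing r \<alpha> u * pairing r \<alpha> x0)" for \<alpha>
      by (simp add: pairing_sum sum_distrib_right)
    have "\<exists>\<alpha>\<in>R. \<not> pairing r \<alpha> ?p * pairing r \<alpha> x0 > 0"
      using p_notin pin by (auto simp: region_def)
    then obtain \<alpha> where a: "\<alpha> \<in> R" "\<not> pairing r \<alpha> ?p * pairing r \<alpha> x0 > 0" by blast
    have nn: "\<And>u. u \<in> D - {v} \<Longrightarrow> pairing r \<alpha> u * pairing r \<alpha> x0 \<ge> 0" using sign[OF a(1)] by simp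
    have "(\<Sum>u\<in>D - {v}. pairing r \<alpha> u * pairing r \<alpha> x0) \<ge> 0" by (rule sum_nonneg[OF nn])
    then have "(\<Sum>u\<in>D - {v}. pairing r \<alpha> u * pairing r \<alpha> x0) = 0" using a(2) unfolding pp by simp
    then have z: "\<forall>u\<in>D - {v}. pairing r \<alpha> u * pairing r \<alpha> x0 = 0"
      using nn fin by (subst (asm) sum_nonneg_eq_0_iff) auto
    have ax0: "pairing r \<alpha> x0 \<noteq> 0" using x0 a(1) by (simp add: generic_def)
    then have zero: "\<forall>u\<in>D. u \<noteq> v \<longrightarrow> pairing r \<alpha> u = 0" using z by auto
    have x0R: "x0 \<in> Rn r" using x0 by (simp add: generic_def)
    \<comment> \<open>As \<alpha> vanishes on the other generators, its value at the generic point
      \<open>x0\<close> is a multiple of its value at \<open>v\<close>, which is therefore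
      nonzero.\<close>
    have "pairing r \<alpha> x0 = (\<Sum>u\<in>D. pairing r x0 (dual r D u) * pairing r \<alpha> u)"
      by (subst expand_basis[OF D x0R]) (simp add: pairing_sum pairing_simps)
    also have "\<dots> = pairing r x0 (dual r D v) * pairing r \<alpha> v"
      using zero v fin by (subst sum.remove[OF fin v]) auto
    finally have vnz: "pairing r \<alpha> v \<noteq> 0" using ax0 by auto
    show ?thesis
    proof (cases "pairing r \<alpha> v > 0")
      case True
      then show ?thesis using a zero by blast
    next
      case False
      then have "pairing r (- \<alpha>) v > 0" using vnz by (simp add: pairing_simps)
      moreover have "\<forall>u\<in>D. u \<noteq> v \<longrightarrow> pairing r (- \<alpha>) u = 0" using zero by (simp add: pairing_simps)
      ultimately show ?thesis using sym_R[OF a(1)] by blast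
    qed
  qed
  then obtain b where b: "\<And>v. v \<in> D \<Longrightarrow> b v \<in> R" "\<And>v. v \<in> D \<Longrightarrow> pairing r (b v) v > 0"
    "\<And>u v. v \<in> D \<Longrightarrow> u \<in> D \<Longrightarrow> u \<noteq> v \<Longrightarrow> pairing r (b v) u = 0" by metis
  have bR: "b v \<in> Rn r" if "v \<in> D" for v using b(1)[OF that] R_sub by blast
  let ?B = "b ` D"
  have inj: "inj_on b D" and vb: "vbasis r ?B"
    by (rule vbasis_I[OF D bR]; use b in force)+
  have dual_b: "dual r ?B (b v) = (1 / pairing r (b v) v) *\<^sub>R v" if v: "v \<in> D" for v
  proof (rule dual_unique[OF vb])
    show "(1 / pairing r (b v) v) *\<^sub>R v \<in> Rn r" by (intro Rn_closed vbasis_sub[OF D v])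
    fix \<gamma> assume "\<gamma> \<in> ?B"
    then obtain u where u: "u \<in> D" "\<gamma> = b u" by blast
    then show "pairing r \<gamma> ((1 / pairing r (b v) v) *\<^sub>R v) = (if \<gamma> = b v then 1 else 0)"
      using b(2)[OF v] b(3)[OF u(1) v] inj v by (auto simp: pairing_simps dest: inj_onD)
  qed
  have rb: "rbase ?B"
    unfolding rbase_def
  proof (intro conjI vb ballI)
    show "?B \<subseteq> R" using b by blast
    fix \<alpha> assume a: "\<alpha> \<in> R"
    have s: "pairing r \<alpha> (dual r ?B (b v)) * pairing r \<alpha> x0 \<ge> 0" if "v \<in> D" for v
      using sign[OF a that] b(2)[OF that] by (simp add: dual_b[OF that] pairing_simps zero_le_divide_iff)
    have "pairing r \<alpha> x0 \<noteq> 0" using x0 a by (simp add: generic_def)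
    then consider "pairing r \<alpha> x0 > 0" | "pairing r \<alpha> x0 < 0" by linarith
    then show "(\<forall>\<beta>\<in>?B. 0 \<le> pairing r \<alpha> (dual r ?B \<beta>)) \<or> (\<forall>\<beta>\<in>?B. pairing r \<alpha> (dual r ?B \<beta>) \<le> 0)"
    proof cases
      case 1 then show ?thesis using s by (auto simp: zero_le_mult_iff)
    next
      case 2 then show ?thesis using s by (auto simp: zero_le_mult_iff)
    qed
  qed
  have "(\<Sum>v\<in>D. 1 *\<^sub>R v) \<in> ?K" by (rule inK) simp
  moreover have "(\<Sum>v\<in>D. 1 *\<^sub>R v) \<in> open_cone r ?B"
  proof -
    have "pairing r (b u) (\<Sum>v\<in>D. 1 *\<^sub>R v) = pairing r (b u) u" if "u \<in> D" for u
      using b(3)[OF that] by (simp add: sum.remove[OF fin that] pairing_simps pairing_sum)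
    then show ?thesis using b(2) vbasis_sub[OF D] by (auto simp: open_cone_def intro!: Rn_closed)
  qed
  ultimately have "?K = open_cone r ?B"
    using region_eq(2)[OF x0] region_open_cone[OF rb] by metis
  with rb show ?thesis by blast
qed

lemma rbase_lbase:
  assumes B: "rbase B" and int: "R \<subseteq> int_span B"
  shows "lbase R B (\<lambda>\<beta>. \<beta>)"
  unfolding lbase_def
proof (intro conjI ballI allI impI)
  note vb = rbase_vbasis[OF B]
  have fin: "finite B" using vb by (simp add: vbasis_def)
  have coord: "pairing r (\<Sum>\<gamma>\<in>B. x \<gamma> *\<^sub>R \<gamma>) (dual r B \<beta>) = x \<beta>" if "\<beta> \<in> B" for x \<beta>
    using that fin by (simp add: pairing_sum_left pairing_simps pairing_dual[OF vb] if_distrib[of "(*) _"] cong: if_cong)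
  show "\<beta> \<in> R" if "\<beta> \<in> B" for \<beta> using rbase_subset[OF B] that by blast
  show "x \<beta> = 0" if "(\<Sum>\<beta>\<in>B. x \<beta> *\<^sub>R \<beta>) = 0" "\<beta> \<in> B" for x \<beta>
    using coord[OF that(2), of x] that(1) by (simp add: pairing_simps)
  fix \<alpha> assume a: "\<alpha> \<in> R"
  then obtain c :: "(nat \<Rightarrow> real) \<Rightarrow> int" where c: "\<alpha> = (\<Sum>\<beta>\<in>B. of_int (c \<beta>) *\<^sub>R \<beta>)"
    using int unfolding int_span_def by blast
  have "pairing r \<alpha> (dual r B \<beta>) = c \<beta>" if "\<beta> \<in> B" for \<beta> unfolding c by (rule coord[OF that])
  then have "(\<forall>\<beta>\<in>B. c \<beta> \<ge> 0) \<or> (\<forall>\<beta>\<in>B. c \<beta> \<le> 0)"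
    using B a unfolding rbase_def by auto
  with c show "\<exists>x. \<alpha> = (\<Sum>i\<in>B. of_int (x i) *\<^sub>R i) \<and> ((\<forall>i\<in>B. 0 \<le> x i) \<or> (\<forall>i\<in>B. x i \<le> 0))" by blast
qed

lemma lbase_rbase:
  assumes b: "lbase R I b" and fin: "finite I" and sp: "span R = Rn r"
  shows "rbase (b ` I)" and "R \<subseteq> int_span (b ` I)"
proof -
  let ?B = "b ` I"
  have inj: "inj_on b I" by (rule lbase_inj[OF b fin])
  have vb: "vbasis r ?B"
    unfolding vbasis_def using fin lbase_independent[OF b fin] span_lbase[OF b] sp by simp
  have crd: "pairing r \<alpha> (dual r ?B (b i)) = crd I b \<alpha> i" if a: "\<alpha> \<in> R" and i: "i \<in> I" for \<alpha> i
  proof -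
    have d: "pairing r (b k) (dual r ?B (b i)) = (if k = i then 1 else 0)" if "k \<in> I" for k
      using pairing_dual[OF vb, of "b k" "b i"] inj that i by (auto dest: inj_onD)
    have "pairing r \<alpha> (dual r ?B (b i)) = pairing r (\<Sum>k\<in>I. of_int (crd I b \<alpha> k) *\<^sub>R b k) (dual r ?B (b i))"
      using crd_sum[OF b a] by simp
    also have "\<dots> = crd I b \<alpha> i"
      using i fin by (simp add: pairing_sum_left pairing_simps d if_distrib[of "(*) _"] cong: if_cong)
    finally show ?thesis .
  qed
  show "rbase ?B"
    unfolding rbase_def
  proof (intro conjI vb ballI)
    show "?B \<subseteq> R" using lbase_in[OF b] by blast
    fix \<alpha> assume a: "\<alpha> \<in> R"
    show "(\<forall>\<beta>\<in>?B. 0 \<le> pairing r \<alpha> (dual r ?B \<beta>)) \<or> (\<forall>\<beta>\<in>?B. pairing r \<alpha> (dual r ?B \<beta>) \<le> 0)"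
      using crd_sign[OF b a] crd[OF a] by auto
  qed
  show "R \<subseteq> int_span ?B"
  proof
    fix \<alpha> assume a: "\<alpha> \<in> R"
    have "\<alpha> = (\<Sum>i\<in>I. of_int (crd I b \<alpha> i) *\<^sub>R b i)" by (rule crd_sum[OF b a])
    also have "\<dots> = (\<Sum>\<beta>\<in>?B. of_int (crd I b \<alpha> (inv_into I b \<beta>)) *\<^sub>R \<beta>)"
      by (simp add: sum.reindex[OF inj] inv_into_f_f[OF inj])
    finally show "\<alpha> \<in> int_span ?B"
      unfolding int_span_def by (intro CollectI exI[of _ "\<lambda>\<beta>. crd I b \<alpha> (inv_into I b \<beta>)"] conjI TrueI)
  qed
qed

end

section \<open>Crystallographic arrangements and their root bases\<close>

lemma crystallographic_reduced_roots:
  assumes "crystallographic r \<A> R"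
  shows "reduced_roots r R" and "\<A> = perp r ` R"
proof -
  show A: "\<A> = perp r ` R" using assms by (simp add: crystallographic_def)
  have line: "range (\<lambda>t. t *\<^sub>R \<alpha>) \<inter> R = {\<alpha>, - \<alpha>}" if "\<alpha> \<in> R" for \<alpha>
    using assms that by (simp add: crystallographic_def)
  have nz: "\<alpha> \<noteq> 0" if "\<alpha> \<in> R" for \<alpha>
  proof
    assume "\<alpha> = 0"
    \<comment> \<open>Here the dimension of the hyperplanes excludes 0 as a root;
      \<open>r \<ge> 1\<close> keeps \<open>r - 1\<close> distinct from \<open>r\<close>.\<close>
    then have "perp r \<alpha> = Rn r" by (auto simp: perp_def pairing_simps)
    moreover have "dim (perp r \<alpha>) = r - 1" "r \<ge> 1"
      using assms that unfolding crystallographic_def simplicial_arrangement_def hyperplane_def by auto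
    ultimately show False using dim_Rn[of r] by simp
  qed
  show "reduced_roots r R"
  proof
    show "finite R" "R \<subseteq> Rn r" using assms by (auto simp: crystallographic_def)
    show "- \<alpha> \<in> R" if "\<alpha> \<in> R" for \<alpha> using line[OF that] by blast
    show "t = 1 \<or> t = -1" if "\<alpha> \<in> R" "t *\<^sub>R \<alpha> \<in> R" for \<alpha> t
    proof -
      have "t *\<^sub>R \<alpha> \<in> {\<alpha>, - \<alpha>}" using line[OF that(1)] that(2) by blast
      then have "(t - 1) *\<^sub>R \<alpha> = 0 \<or> (t + 1) *\<^sub>R \<alpha> = 0" by (auto simp: scaleR_diff_left scaleR_add_left)
      then show ?thesis using nz[OF that(1)] by (auto simp: eq_neg_iff_add_eq_0)
    qed
  qed
qed

lemma crystallographic_chamber: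
  assumes "crystallographic r \<A> R" and K: "K \<in> chambers r \<A>"
  shows "reduced_roots.rbase r R (chamber_basis r \<A> R K)"
    and "K = open_cone r (chamber_basis r \<A> R K)"
    and "lbase R (chamber_basis r \<A> R K) (\<lambda>\<beta>. \<beta>)"
proof -
  interpret reduced_roots r R by (rule crystallographic_reduced_roots(1)[OF assms(1)])
  have A: "\<A> = perp r ` R" by (rule crystallographic_reduced_roots(2)[OF assms(1)])
  obtain x where x: "generic r R x" "K = region r R x" using K unfolding A chambers_eq by blast
  have "open_simplicial_cone r K"
    using assms unfolding crystallographic_def simplicial_arrangement_def by blast
  then obtain B where B: "rbase B" "K = open_cone r B" using simplicial_region_rbase[OF x(1)] x(2) by blast
  then have cb: "chamber_basis r \<A> R K = B" unfolding A using chamber_basis_open_cone by simp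
  show "rbase (chamber_basis r \<A> R K)" "K = open_cone r (chamber_basis r \<A> R K)" unfolding cb by (fact B)+
  have "R \<subseteq> int_span B" using assms cb unfolding crystallographic_def by blast
  then show "lbase R (chamber_basis r \<A> R K) (\<lambda>\<beta>. \<beta>)" unfolding cb by (rule rbase_lbase[OF B(1)])
qed

lemma chambers_nonempty:
  assumes "crystallographic r \<A> R"
  shows "chambers r \<A> \<noteq> {}"
proof -
  interpret reduced_roots r R by (rule crystallographic_reduced_roots(1)[OF assms])
  show ?thesis
    using generic_exists unfolding crystallographic_reduced_roots(2)[OF assms] chambers_eq by blast
qed

text \<open>A chamber contains a generic point, and a walk leads to an object whose basis is
  positive there. So every chamber is the open cone over the basis of an object, which is simplicial
  and for which integrality is known.\<close>

theorem realization_crystallographic: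
  assumes "realization C L R" and sp: "span R = Rn r" and r: "r \<ge> 1"
  shows "crystallographic r (perp r ` R) R"
proof -
  interpret P: realization C L R by fact
  have RR: "R \<subseteq> Rn r" using sp span_superset by blast
  interpret reduced_roots r R
    by standard (fact P.finite_R, fact RR, rule P.sym_R, assumption, rule P.reduced, assumption+)
  have cham: "\<exists>a\<in>objs C. K = open_cone r (L a ` idx C)" if KK: "K \<in> chambers r \<A>" for K
  proof -
    obtain x where x: "generic r R x" "K = region r R x" using KK unfolding chambers_eq by blast
    obtain a0 where a0: "a0 \<in> objs C" using P.objs_ne by blast
    obtain w where w: "w \<in> lists (idx C)" "\<forall>i\<in>idx C. pairing r (L (walk C a0 w) i) x > 0"
      using P.walk_to_chamber[OF linear_pairing_left[of r x] _ a0] x(1) by (auto simp: generic_def)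
    let ?a = "walk C a0 w"
    have a: "?a \<in> objs C" by (rule P.walk_in[OF a0 w(1)])
    have "x \<in> open_cone r (L ?a ` idx C)" using w(2) x(1) by (auto simp: open_cone_def generic_def)
    from region_open_cone[OF lbase_rbase(1)[OF P.base[OF a] P.finite_idx sp] this] x(2) a show ?thesis by blast
  qed
  show ?thesis
    unfolding crystallographic_def simplicial_arrangement_def
  proof (intro conjI ballI)
    show "r \<ge> 1" "finite R" "R \<subseteq> Rn r" "\<A> = \<A>" "finite \<A>" using r finite_R R_sub by auto
    show "hyperplane r H" if "H \<in> \<A>" for H
    proof -
      obtain \<alpha> where "\<alpha> \<in> R" "H = perp r \<alpha>" using \<open>H \<in> \<A>\<close> by blast
      \<comment> \<open>Each root is simple somewhere, so its hyperplane is a wall, and the dual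
        vectors of that basis measure its dimension.\<close>
      then obtain a i where a: "a \<in> objs C" "i \<in> idx C" "H = perp r (L a i)" using P.root_is_simple by blast
      let ?B = "L a ` idx C"
      note rB = lbase_rbase(1)[OF P.base[OF a(1)] P.finite_idx sp]
      have bB: "L a i \<in> ?B" using a by blast
      have "dual r ?B ` (?B - {L a i}) \<subseteq> perp r (L a i)" using dual_perp[OF rB bB] by blast
      from dim_perp_between(1)[OF rB bB this] have "dim H = r - 1" using a(3) by simp
      moreover have "subspace H" unfolding a(3) subspace_def perp_def by (auto simp: pairing_simps intro: Rn_closed)
      ultimately show ?thesis unfolding hyperplane_def a(3) by (auto simp: perp_def)
    qed
    show "range (\<lambda>t. t *\<^sub>R \<alpha>) \<inter> R = {\<alpha>, - \<alpha>}" if "\<alpha> \<in> R" for \<alpha>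
    proof
      show "range (\<lambda>t. t *\<^sub>R \<alpha>) \<inter> R \<subseteq> {\<alpha>, - \<alpha>}" using reduced[OF that] by force
      have "\<alpha> = 1 *\<^sub>R \<alpha>" "- \<alpha> = (-1) *\<^sub>R \<alpha>" by simp_all
      then show "{\<alpha>, - \<alpha>} \<subseteq> range (\<lambda>t. t *\<^sub>R \<alpha>) \<inter> R" using that sym_R[OF that] by blast
    qed
    fix K assume K: "K \<in> chambers r \<A>"
    obtain a where a: "a \<in> objs C" "K = open_cone r (L a ` idx C)" using cham[OF K] by blast
    note rB = lbase_rbase[OF P.base[OF a(1)] P.finite_idx sp]
    show "open_simplicial_cone r K" unfolding a(2) by (rule open_simplicial_cone_cone[OF rbase_vbasis[OF rB(1)]])
    show "R \<subseteq> int_span (chamber_basis r \<A> R K)"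
      unfolding a(2) chamber_basis_open_cone[OF rB(1)] by (rule rB(2))
  qed
qed

section \<open>Crossing a wall\<close>

locale crystallographic_roots = reduced_roots +
  assumes crys: "crystallographic r (perp r ` R) R"
begin

abbreviation "cb K \<equiv> chamber_basis r \<A> R K"

lemma
  assumes "K \<in> chambers r \<A>"
  shows cb_rbase: "rbase (cb K)" and cb_cone: "open_cone r (cb K) = K"
    and cb_lbase: "lbase R (cb K) (\<lambda>\<beta>. \<beta>)"
  using crystallographic_chamber[OF crys assms] by simp_all

lemma r_pos: "r \<ge> 1"
  using crys by (simp add: crystallographic_def)

lemma coordinate_int:
  assumes K: "K \<in> chambers r \<A>" and a: "\<alpha> \<in> R" and b: "\<beta> \<in> cb K"
  shows "\<exists>n::int. pairing r \<alpha> (dual r (cb K) \<beta>) = of_int n"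
proof -
  note B = cb_rbase[OF K]
  have "\<alpha> = (\<Sum>\<gamma>\<in>cb K. of_int (crd (cb K) (\<lambda>\<beta>. \<beta>) \<alpha> \<gamma>) *\<^sub>R \<gamma>)" by (rule crd_sum[OF cb_lbase[OF K] a])
  then have "pairing r \<alpha> (dual r (cb K) \<beta>)
      = pairing r (\<Sum>\<gamma>\<in>cb K. of_int (crd (cb K) (\<lambda>\<beta>. \<beta>) \<alpha> \<gamma>) *\<^sub>R \<gamma>) (dual r (cb K) \<beta>)" by simp
  also have "\<dots> = of_int (crd (cb K) (\<lambda>\<beta>. \<beta>) \<alpha> \<beta>)"
    using b rbase_finite[OF B]
    by (simp add: pairing_sum_left pairing_simps pairing_dual[OF rbase_vbasis[OF B]] if_distrib[of "(*) _"] cong: if_cong)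
  finally show ?thesis by blast
qed

lemma positive_iff:
  assumes B: "rbase B" and x: "x \<in> open_cone r B" and a: "\<alpha> \<in> R"
  shows "positive B \<alpha> \<longleftrightarrow> pairing r \<alpha> x > 0"
proof
  assume "pairing r \<alpha> x > 0"
  then show "positive B \<alpha>"
    using positive_open[OF B sym_R[OF a] positive_uminus[OF B a] x] by (force simp: pairing_simps)
qed (rule positive_open[OF B a _ x])

text \<open>Integrality leaves room to step over exactly one wall: on the sum of the dual vectors
  other than that of \<alpha>, every further positive root is at least 1, so a uniformly small push
  across the wall preserves its sign.\<close>

lemma point_beyond_wall:
  assumes K: "K \<in> chambers r \<A>" and al: "\<alpha> \<in> cb K"
  obtains q where "q \<in> Rn r" "pairing r \<alpha> q < 0"
    "\<And>\<gamma>. \<gamma> \<in> R \<Longrightarrow> positive (cb K) \<gamma> \<Longrightarrow> \<gamma> \<noteq> \<alpha> \<Longrightarrow> pairing r \<gamma> q > 0"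
proof -
  let ?B = "cb K" and ?d = "dual r (cb K)"
  note B = cb_rbase[OF K]
  note vb = rbase_vbasis[OF B]
  have fin: "finite ?B" by (rule rbase_finite[OF B])
  obtain M where M: "\<And>\<gamma>. \<gamma> \<in> R \<Longrightarrow> \<bar>pairing r \<gamma> (?d \<alpha>)\<bar> \<le> M" "M > 0"
  proof
    show "\<bar>pairing r \<gamma> (?d \<alpha>)\<bar> \<le> (\<Sum>\<gamma>\<in>R. \<bar>pairing r \<gamma> (?d \<alpha>)\<bar>) + 1" if "\<gamma> \<in> R" for \<gamma>
      using member_le_sum[of \<gamma> R "\<lambda>\<gamma>. \<bar>pairing r \<gamma> (?d \<alpha>)\<bar>"] finite_R that by simp
    show "(\<Sum>\<gamma>\<in>R. \<bar>pairing r \<gamma> (?d \<alpha>)\<bar>) + 1 > 0" by (simp add: add_nonneg_pos sum_nonneg)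
  qed
  let ?p = "\<Sum>\<beta>\<in>?B - {\<alpha>}. ?d \<beta>"
  \<comment> \<open>As \<open>M\<close> bounds the coordinates at \<alpha> of all roots, the push
    changes the value of a root by at most 1/2.\<close>
  define q where "q = ?p - (1 / (2 * M)) *\<^sub>R ?d \<alpha>"
  have qin: "q \<in> Rn r" unfolding q_def by (intro Rn_closed dual_in[OF vb])
  have "pairing r \<alpha> ?p = 0"
    using pairing_dual[OF vb al] by (auto simp: pairing_sum intro!: sum.neutral split: if_splits)
  then have q1: "pairing r \<alpha> q < 0"
    using pairing_dual[OF vb al, of \<alpha>] M(2) by (simp add: q_def pairing_simps)
  have q2: "pairing r \<gamma> q > 0" if g: "\<gamma> \<in> R" "positive ?B \<gamma>" "\<gamma> \<noteq> \<alpha>" for \<gamma>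
  proof -
    have "\<gamma> \<noteq> - \<alpha>" using g(2) pairing_dual[OF vb al, of \<alpha>] al by (auto simp: positive_def pairing_simps)
    then obtain \<beta> where b: "\<beta> \<in> ?B" "\<beta> \<noteq> \<alpha>" "pairing r \<gamma> (?d \<beta>) \<noteq> 0"
      using single_coordinate[OF B g(1) al] g(3) by blast
    obtain n :: int where n: "pairing r \<gamma> (?d \<beta>) = of_int n" using coordinate_int[OF K g(1) b(1)] by blast
    have nn: "\<And>\<beta>. \<beta> \<in> ?B \<Longrightarrow> pairing r \<gamma> (?d \<beta>) \<ge> 0" using g(2) by (simp add: positive_def)
    have "n \<ge> 1" using nn[OF b(1)] b(3) unfolding n by auto
    then have "1 \<le> pairing r \<gamma> (?d \<beta>)" unfolding n by simp
    also have "\<dots> \<le> (\<Sum>\<beta>\<in>?B - {\<alpha>}. pairing r \<gamma> (?d \<beta>))"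
      using b nn fin by (intro member_le_sum) auto
    also have "\<dots> = pairing r \<gamma> ?p" by (simp add: pairing_sum)
    finally have "1 \<le> pairing r \<gamma> ?p" .
    moreover have "pairing r \<gamma> (?d \<alpha>) / (2 * M) \<le> 1 / 2"
      using M(1)[OF g(1)] M(2) by (simp add: field_simps)
    ultimately show ?thesis unfolding q_def by (simp add: pairing_simps)
  qed
  show ?thesis by (rule that[OF qin q1 q2])
qed

text \<open>
  Modulo \<open>\<alpha>\<close> both bases generate the same positive roots, and the coefficients are natural numbers,
  so they agree modulo \<open>\<alpha>\<close>.
\<close>

lemma opposite_basis:
  assumes K: "K \<in> chambers r \<A>" and al: "\<alpha> \<in> cb K"
    and K': "K' \<in> chambers r \<A>" and q: "q \<in> K'" "pairing r \<alpha> q < 0"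
      "\<And>\<gamma>. \<gamma> \<in> R \<Longrightarrow> positive (cb K) \<gamma> \<Longrightarrow> \<gamma> \<noteq> \<alpha> \<Longrightarrow> pairing r \<gamma> q > 0"
  shows "- \<alpha> \<in> cb K'" and "\<beta> \<in> cb K - {\<alpha>} \<Longrightarrow> \<exists>c::nat. real c *\<^sub>R \<alpha> + \<beta> \<in> cb K'"
proof -
  let ?B = "cb K" and ?B' = "cb K'" and ?d = "dual r (cb K)" and ?d' = "dual r (cb K')"
  note B = cb_rbase[OF K] and B' = cb_rbase[OF K']
  have fin': "finite ?B'" by (rule rbase_finite[OF B'])
  have q': "q \<in> open_cone r ?B'" using q(1) cb_cone[OF K'] by simp
  have B'R: "\<beta> \<in> R" if "\<beta> \<in> ?B'" for \<beta> using rbase_subset[OF B'] that by blast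
  have BR: "\<beta> \<in> R" if "\<beta> \<in> ?B" for \<beta> using rbase_subset[OF B] that by blast
  have qpos: "pairing r \<beta> q > 0" if "\<beta> \<in> ?B'" for \<beta> using q' that by (simp add: open_cone_def)
  have pos: "positive ?B \<beta> \<or> \<beta> = - \<alpha>" if b: "\<beta> \<in> ?B'" for \<beta>
  proof (cases "positive ?B \<beta>")
    case False
    have "- \<beta> = \<alpha>"
    proof (rule ccontr)
      assume "- \<beta> \<noteq> \<alpha>"
      from q(3)[OF sym_R[OF B'R[OF b]] positive_uminus[OF B B'R[OF b] False] this] qpos[OF b]
      show False by (simp add: pairing_simps)
    qed
    then show ?thesis by auto
  qed blast
  have nonneg: "pairing r \<beta> (?d \<gamma>) \<ge> 0" if "\<beta> \<in> ?B'" "\<gamma> \<in> ?B - {\<alpha>}" for \<beta> \<gamma>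
    using pos[OF that(1)] that(2) pairing_dual[OF rbase_vbasis[OF B] al, of \<gamma>]
    by (auto simp: positive_def pairing_simps)
  have trans: "pairing r \<gamma> (?d \<beta>) = (\<Sum>\<delta>\<in>?B'. pairing r \<gamma> (?d' \<delta>) * pairing r \<delta> (?d \<beta>))" if "\<gamma> \<in> R" for \<gamma> \<beta>
    by (rule pairing_expand[OF B' that])
  have coord': "\<And>\<delta>. \<delta> \<in> ?B' \<Longrightarrow> pairing r \<gamma> (?d' \<delta>) \<ge> 0" if "\<gamma> \<in> R" "pairing r \<gamma> q > 0" for \<gamma>
    using positive_iff[OF B' q' that(1)] that(2) by (simp add: positive_def)
  \<comment> \<open>A zero coordinate of a root positive at \<open>q\<close> is a sum of nonnegative
    terms, so every element of the new basis occurring in that root has the same zero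
    coordinate.\<close>
  have vanish: "pairing r \<delta> (?d \<beta>) = 0"
    if g: "\<gamma> \<in> R" "pairing r \<gamma> q > 0" and b: "\<beta> \<in> ?B - {\<alpha>}" "pairing r \<gamma> (?d \<beta>) = 0"
      and d: "\<delta> \<in> ?B'" "pairing r \<gamma> (?d' \<delta>) \<noteq> 0" for \<gamma> \<beta> \<delta>
  proof -
    have "(\<Sum>\<delta>\<in>?B'. pairing r \<gamma> (?d' \<delta>) * pairing r \<delta> (?d \<beta>)) = 0" using trans[OF g(1)] b(2) by simp
    then have "\<forall>\<delta>\<in>?B'. pairing r \<gamma> (?d' \<delta>) * pairing r \<delta> (?d \<beta>) = 0"
      using coord'[OF g] nonneg[OF _ b(1)] fin' by (subst (asm) sum_nonneg_eq_0_iff) auto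
    with d show ?thesis by auto
  qed
  show mal: "- \<alpha> \<in> ?B'"
  proof -
    have mR: "- \<alpha> \<in> R" by (rule sym_R[OF BR[OF al]])
    have mq: "pairing r (- \<alpha>) q > 0" using q(2) by (simp add: pairing_simps)
    obtain \<delta> where d: "\<delta> \<in> ?B'" "pairing r (- \<alpha>) (?d' \<delta>) \<noteq> 0" using coordinate_nonzero[OF B' mR] by blast
    have "pairing r \<delta> (?d \<beta>) = 0" if "\<beta> \<in> ?B" "\<beta> \<noteq> \<alpha>" for \<beta>
      by (rule vanish[OF mR mq _ _ d]) (use that pairing_dual[OF rbase_vbasis[OF B] al, of \<beta>] in \<open>auto simp: pairing_simps\<close>)
    then have "\<delta> = \<alpha> \<or> \<delta> = - \<alpha>" by (rule single_coordinate[OF B B'R[OF d(1)] al])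
    then show ?thesis using d(1) qpos[OF d(1)] q(2) by auto
  qed
  show "\<exists>c::nat. real c *\<^sub>R \<alpha> + \<beta> \<in> ?B'" if b: "\<beta> \<in> ?B - {\<alpha>}"
  proof -
    have bB: "\<beta> \<in> ?B" and bR: "\<beta> \<in> R" using b BR by auto
    have bq: "pairing r \<beta> q > 0" using q(3)[OF bR positive_base[OF B bB]] b by simp
    \<comment> \<open>The coordinate of \<beta> along itself is a sum of products of natural numbers
      with value 1. A nonzero product is then 1 times 1, and its \<delta> is congruent to \<beta>
      modulo \<alpha>.\<close>
    have one: "(\<Sum>\<delta>\<in>?B'. pairing r \<beta> (?d' \<delta>) * pairing r \<delta> (?d \<beta>)) = 1"
      using trans[OF bR, of \<beta>] pairing_dual[OF rbase_vbasis[OF B] bB, of \<beta>] by simp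
    obtain \<delta> where d: "\<delta> \<in> ?B'" "pairing r \<beta> (?d' \<delta>) * pairing r \<delta> (?d \<beta>) \<noteq> 0"
      using one by (metis (no_types, lifting) sum.neutral zero_neq_one)
    have dR: "\<delta> \<in> R" by (rule B'R[OF d(1)])
    obtain m n :: int where mn: "pairing r \<beta> (?d' \<delta>) = of_int m" "pairing r \<delta> (?d \<beta>) = of_int n"
      using coordinate_int[OF K' bR d(1)] coordinate_int[OF K dR bB] by blast
    have "pairing r \<beta> (?d' \<delta>) * pairing r \<delta> (?d \<beta>) \<le> 1"
      unfolding one[symmetric] using d(1) fin' coord'[OF bR bq] nonneg[OF _ b]
      by (intro member_le_sum[of \<delta> ?B']) auto
    then have "m * n \<le> 1" unfolding mn by (metis of_int_le_1_iff of_int_mult)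
    moreover have "m \<ge> 0" "n \<ge> 0" using coord'[OF bR bq d(1)] nonneg[OF d(1) b] unfolding mn by auto
    moreover have "m \<noteq> 0" "n \<noteq> 0" using d(2) unfolding mn by auto
    ultimately have "1 * n \<le> m * n" "m * n \<le> 1" "n \<ge> 1" by (auto intro!: mult_right_mono)
    then have "n = 1" by linarith
    then have d1: "pairing r \<delta> (?d \<beta>) = 1" using mn by simp
    have d0: "pairing r \<delta> (?d \<gamma>) = 0" if "\<gamma> \<in> ?B - {\<alpha>, \<beta>}" for \<gamma>
      by (rule vanish[OF bR bq _ _ d(1)])
        (use that d(2) pairing_dual[OF rbase_vbasis[OF B] bB, of \<gamma>] in auto)
    have "\<delta> \<noteq> - \<alpha>" using d1 pairing_dual[OF rbase_vbasis[OF B] al, of \<beta>] b by (auto simp: pairing_simps)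
    then have "pairing r \<delta> (?d \<alpha>) \<ge> 0" using pos[OF d(1)] al by (auto simp: positive_def)
    moreover obtain c :: int where c: "pairing r \<delta> (?d \<alpha>) = of_int c" using coordinate_int[OF K dR al] by blast
    ultimately have c0: "c \<ge> 0" by simp
    have "\<delta> \<in> Rn r" using dR R_sub by blast
    then have "\<delta> = (\<Sum>\<gamma>\<in>?B. pairing r \<delta> (?d \<gamma>) *\<^sub>R \<gamma>)" by (rule expand_basis[OF rbase_vbasis[OF B]])
    also have "\<dots> = (\<Sum>\<gamma>\<in>{\<alpha>, \<beta>}. pairing r \<delta> (?d \<gamma>) *\<^sub>R \<gamma>)"
      using d0 rbase_finite[OF B] al bB by (intro sum.mono_neutral_right) auto
    also have "\<dots> = real (nat c) *\<^sub>R \<alpha> + \<beta>"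
    proof -
      have "\<alpha> \<noteq> \<beta>" using b by blast
      then show ?thesis using d1 c c0 by simp
    qed
    finally show ?thesis using d(1) by metis
  qed
qed

text \<open>Both definite descriptions have to be justified. The region \<open>N\<close> of a point
  just beyond the wall is adjacent to \<open>K\<close>; an adjacent chamber must have the signs of
  \<open>N\<close> on all roots, and the bijection of bases is forced because each vector may change
  only by multiples of \<alpha>.\<close>

lemma wall_crossing:
  assumes K: "K \<in> chambers r \<A>" and al: "\<alpha> \<in> cb K"
  defines "K' \<equiv> next_chamber r \<A> K (perp r \<alpha>)"
  shows "K' \<in> chambers r \<A>"
    and "bij_betw (transition r \<A> R K K') (cb K) (cb K')"
    and "transition r \<A> R K K' \<alpha> = - \<alpha>"
    and "\<beta> \<in> cb K - {\<alpha>} \<Longrightarrow> \<exists>c::nat. transition r \<A> R K K' \<beta> = real c *\<^sub>R \<alpha> + \<beta>"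
proof -
  let ?B = "cb K" and ?d = "dual r (cb K)"
  note B = cb_rbase[OF K]
  have fin: "finite ?B" by (rule rbase_finite[OF B])
  have BR: "\<beta> \<in> R" if "\<beta> \<in> ?B" for \<beta> using rbase_subset[OF B] that by blast
  obtain q where q: "q \<in> Rn r" "pairing r \<alpha> q < 0"
    "\<And>\<gamma>. \<gamma> \<in> R \<Longrightarrow> positive ?B \<gamma> \<Longrightarrow> \<gamma> \<noteq> \<alpha> \<Longrightarrow> pairing r \<gamma> q > 0"
    using point_beyond_wall[OF K al] by blast
  have gen: "generic r R q"
    unfolding generic_def
  proof (intro conjI ballI q(1))
    fix \<gamma> assume g: "\<gamma> \<in> R"
    show "pairing r \<gamma> q \<noteq> 0"
    proof (cases "\<gamma> = \<alpha> \<or> \<gamma> = - \<alpha>")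
      case True
      then show ?thesis using q(2) by (auto simp: pairing_simps)
    next
      case False
      then have "- \<gamma> \<noteq> \<alpha>" by auto
      then show ?thesis
        using q(3)[OF g] q(3)[OF sym_R[OF g] positive_uminus[OF B g]] False by (force simp: pairing_simps)
    qed
  qed
  define N where "N = region r R q"
  have N: "N \<in> chambers r \<A>" unfolding N_def chambers_eq using gen by blast
  have qN: "q \<in> N" unfolding N_def by (rule region_self[OF gen])
  note B' = cb_rbase[OF N]
  note ob = opposite_basis[OF K al N qN q(2,3)]
  obtain c :: "(nat \<Rightarrow> real) \<Rightarrow> nat" where c: "\<And>\<beta>. \<beta> \<in> ?B - {\<alpha>} \<Longrightarrow> real (c \<beta>) *\<^sub>R \<alpha> + \<beta> \<in> cb N"
    using ob(2) by metis
  define f where "f = (\<lambda>\<beta>. if \<beta> = \<alpha> then - \<alpha> else real (c \<beta>) *\<^sub>R \<alpha> + \<beta>)"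
  have f_dual: "pairing r (f \<beta>) (?d \<gamma>) = (if \<gamma> = \<beta> then 1 else 0)" if "\<beta> \<in> ?B" "\<gamma> \<in> ?B - {\<alpha>}" for \<beta> \<gamma>
    using that al pairing_dual[OF rbase_vbasis[OF B]] by (auto simp: f_def pairing_simps)
  have f_inj: "inj_on f ?B"
  proof (rule inj_onI)
    fix x y assume xy: "x \<in> ?B" "y \<in> ?B" "f x = f y"
    have key: "u = v" if "u \<in> ?B" "v \<in> ?B" "f u = f v" "u \<noteq> \<alpha>" for u v
    proof -
      have "pairing r (f v) (?d u) = 1" using f_dual[of u u] that by simp
      then show ?thesis using f_dual[of v u] that by (simp split: if_splits)
    qed
    show "x = y" using key[OF xy] key[OF xy(2,1)] xy(3) by metis
  qed
  \<comment> \<open>Both bases have \<open>r\<close> elements, so injectivity into the new basis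
    suffices.\<close>
  have f_img: "f ` ?B = cb N"
  proof (rule card_subset_eq[OF rbase_finite[OF B']])
    show "f ` ?B \<subseteq> cb N" using ob(1) c by (auto simp: f_def)
    show "card (f ` ?B) = card (cb N)"
      using card_image[OF f_inj] card_vbasis[OF rbase_vbasis[OF B]] card_vbasis[OF rbase_vbasis[OF B']] by simp
  qed
  have clK: "Euclidean_space r closure_of K = closed_cone r ?B"
    using closure_cone[OF rbase_vbasis[OF B]] cb_cone[OF K] by simp
  have clC: "Euclidean_space r closure_of C = closed_cone r (cb C)" if "C \<in> chambers r \<A>" for C
    using closure_cone[OF rbase_vbasis[OF cb_rbase[OF that]]] cb_cone[OF that] by simp
  have neq: "K \<noteq> N"
  proof
    assume "K = N"
    then have "q \<in> open_cone r ?B" using qN cb_cone[OF K] by simp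
    with al q(2) show False by (force simp: open_cone_def)
  qed
  have adj: "adjacent r K N (perp r \<alpha>)"
    unfolding adjacent_def clK clC[OF N]
  proof (intro conjI neq equalityI)
    let ?X = "closed_cone r ?B \<inter> closed_cone r (cb N)"
    have X: "?X \<subseteq> perp r \<alpha>"
    proof
      fix x assume "x \<in> ?X"
      then have "x \<in> Rn r" "pairing r \<alpha> x \<ge> 0" "pairing r (- \<alpha>) x \<ge> 0"
        using al ob(1) by (auto simp: closed_cone_def)
      then show "x \<in> perp r \<alpha>" by (simp add: perp_def pairing_simps)
    qed
    moreover have "subspace (perp r \<alpha>)"
      unfolding subspace_def perp_def by (auto simp: pairing_simps intro: Rn_closed)
    ultimately show "span ?X \<subseteq> perp r \<alpha>" by (rule span_minimal)
    have "?d ` (?B - {\<alpha>}) \<subseteq> ?X"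
    proof
      fix x assume "x \<in> ?d ` (?B - {\<alpha>})"
      then obtain \<beta> where b: "\<beta> \<in> ?B - {\<alpha>}" "x = ?d \<beta>" by blast
      have "pairing r \<gamma> x \<ge> 0" if "\<gamma> \<in> cb N" for \<gamma>
      proof -
        obtain \<delta> where "\<delta> \<in> ?B" "\<gamma> = f \<delta>" using \<open>\<gamma> \<in> cb N\<close> f_img by blast
        then show ?thesis using f_dual[OF _ b(1)] b(2) by auto
      qed
      then show "x \<in> ?X" using dual_closed_cone[OF B] dual_in[OF rbase_vbasis[OF B]] b by (auto simp: closed_cone_def)
    qed
    from dim_perp_between(2)[OF B al this X] show "perp r \<alpha> \<subseteq> span ?X" .
  qed
  \<comment> \<open>The common facet spans the wall, so no other basis root vanishes on all of it.
    Summing suitable points gives \<open>?p\<close> in both closures, off all root hyperplanes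
    except that of \<alpha>; hence every other root has the same sign on both chambers.\<close>
  have opposite: "pairing r \<gamma> y * pairing r \<gamma> x > 0"
    if C: "C \<in> chambers r \<A>" "adjacent r K C (perp r \<alpha>)" "y \<in> C" and x: "x \<in> K"
      and g: "\<gamma> \<in> R" "\<gamma> \<noteq> \<alpha>" "\<gamma> \<noteq> - \<alpha>" for C \<gamma> x y
  proof -
    let ?X = "closed_cone r ?B \<inter> closed_cone r (cb C)"
    have sp: "span ?X = perp r \<alpha>" using C(2) unfolding adjacent_def clK clC[OF C(1)] by blast
    have "\<exists>y\<in>?X. pairing r \<beta> y > 0" if b: "\<beta> \<in> ?B - {\<alpha>}" for \<beta>
    proof (rule ccontr)
      assume "\<not> ?thesis"
      then have "?X \<subseteq> {y. pairing r \<beta> y = 0}" using b by (force simp: closed_cone_def)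
      moreover have "subspace {y. pairing r \<beta> y = 0}"
        unfolding subspace_def by (auto simp: pairing_simps)
      ultimately have "span ?X \<subseteq> {y. pairing r \<beta> y = 0}" by (rule span_minimal)
      moreover have "?d \<beta> \<in> span ?X" unfolding sp using dual_perp[OF B al] b by blast
      ultimately have "pairing r \<beta> (?d \<beta>) = 0" by blast
      then show False using pairing_dual[OF rbase_vbasis[OF B], of \<beta> \<beta>] b by simp
    qed
    then obtain z where z: "\<And>\<beta>. \<beta> \<in> ?B - {\<alpha>} \<Longrightarrow> z \<beta> \<in> ?X" "\<And>\<beta>. \<beta> \<in> ?B - {\<alpha>} \<Longrightarrow> pairing r \<beta> (z \<beta>) > 0"
      by metis
    let ?p = "\<Sum>\<beta>\<in>?B - {\<alpha>}. z \<beta>"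
    have pX: "?p \<in> ?X"
      using z(1) by (auto simp: closed_cone_def pairing_sum intro!: Rn_closed sum_nonneg)
    have pp: "pairing r \<beta> ?p > 0" if b: "\<beta> \<in> ?B - {\<alpha>}" for \<beta>
      unfolding pairing_sum using z b fin
      by (intro sum_pos2[of _ \<beta>]) (auto simp: closed_cone_def)
    have main: "pairing r \<delta> x > 0 \<and> pairing r \<delta> y > 0"
      if d: "\<delta> \<in> R" "\<delta> \<noteq> \<alpha>" "\<delta> \<noteq> - \<alpha>" "positive ?B \<delta>" for \<delta>
    proof
      show "pairing r \<delta> x > 0" using positive_open[OF B d(1,4)] x cb_cone[OF K] by simp
      obtain \<beta> where b: "\<beta> \<in> ?B" "\<beta> \<noteq> \<alpha>" "pairing r \<delta> (?d \<beta>) \<noteq> 0"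
        using single_coordinate[OF B d(1) al] d(2,3) by blast
      have "pairing r \<delta> ?p > 0"
        unfolding pairing_expand[OF B d(1), of ?p]
      proof (rule sum_pos2[OF fin b(1)])
        show "pairing r \<delta> (?d \<beta>) * pairing r \<beta> ?p > 0"
          using d(4) b pp[of \<beta>] by (auto simp: positive_def order_less_le)
        show "pairing r \<delta> (?d \<beta>) * pairing r \<beta> ?p \<ge> 0" if "\<beta> \<in> ?B" for \<beta>
          using d(4) that pX by (auto simp: positive_def closed_cone_def)
      qed
      note CB = cb_rbase[OF C(1)]
      have "positive (cb C) \<delta>"
      proof (rule ccontr)
        assume "\<not> ?thesis"
        then have "pairing r (- \<delta>) ?p \<ge> 0"
          using positive_closed[OF CB sym_R[OF d(1)] positive_uminus[OF CB d(1)]] pX by blast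
        with \<open>pairing r \<delta> ?p > 0\<close> show False by (simp add: pairing_simps)
      qed
      then show "pairing r \<delta> y > 0" using positive_open[OF CB d(1)] C(3) cb_cone[OF C(1)] by simp
    qed
    show ?thesis
    proof (cases "positive ?B \<gamma>")
      case True
      then show ?thesis using main[OF g] by simp
    next
      case False
      have "- \<gamma> \<noteq> \<alpha>" "- \<gamma> \<noteq> - \<alpha>" using g by auto
      from main[OF sym_R[OF g(1)] this positive_uminus[OF B g(1) False]]
      show ?thesis by (simp add: pairing_simps mult_neg_neg)
    qed
  qed
  obtain x0 where x0: "x0 \<in> K" using dual_sum_in_cone[OF rbase_vbasis[OF B]] cb_cone[OF K] by metis
  have gx0: "generic r R x0" and rx0: "region r R x0 = K"
    using open_cone_generic[OF B] region_open_cone[OF B] x0 cb_cone[OF K] by simp_all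
  have ax0: "pairing r \<alpha> x0 > 0" using x0 cb_cone[OF K] al by (force simp: open_cone_def)
  \<comment> \<open>Otherwise no sign would change and the two chambers would coincide.\<close>
  have beyond: "pairing r \<alpha> y < 0" if C: "C \<in> chambers r \<A>" "adjacent r K C (perp r \<alpha>)" "y \<in> C" for C y
  proof (rule ccontr)
    note CB = cb_rbase[OF C(1)]
    have gy: "generic r R y" and ry: "region r R y = C"
      using open_cone_generic[OF CB] region_open_cone[OF CB] C(3) cb_cone[OF C(1)] by simp_all
    assume "\<not> ?thesis"
    then have ay: "pairing r \<alpha> y > 0" using gy BR[OF al] by (force simp: generic_def)
    have "pairing r \<gamma> y * pairing r \<gamma> x0 > 0" if g: "\<gamma> \<in> R" for \<gamma>
    proof (cases "\<gamma> = \<alpha> \<or> \<gamma> = - \<alpha>")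
      case True
      then show ?thesis using ay ax0 by (auto simp: pairing_simps)
    qed (use opposite[OF C x0 g] in blast)
    then have "y \<in> region r R x0" using gy by (simp add: region_def generic_def)
    from region_eq(2)[OF gx0 this] have "C = K" using rx0 ry by simp
    then show False using C(2) by (simp add: adjacent_def)
  qed
  have uniq: "C = N" if C: "C \<in> chambers r \<A>" "adjacent r K C (perp r \<alpha>)" for C
  proof -
    note CB = cb_rbase[OF C(1)]
    obtain y where y: "y \<in> C" using dual_sum_in_cone[OF rbase_vbasis[OF CB]] cb_cone[OF C(1)] by metis
    have gy: "generic r R y" and ry: "region r R y = C"
      using open_cone_generic[OF CB] region_open_cone[OF CB] y cb_cone[OF C(1)] by simp_all
    have "pairing r \<gamma> y * pairing r \<gamma> q > 0" if g: "\<gamma> \<in> R" for \<gamma>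
    proof (cases "\<gamma> = \<alpha> \<or> \<gamma> = - \<alpha>")
      case True
      then show ?thesis using beyond[OF C y] q(2) by (auto simp: pairing_simps mult_neg_neg)
    next
      case False
      then have "pairing r \<gamma> y * pairing r \<gamma> x0 > 0" "pairing r \<gamma> q * pairing r \<gamma> x0 > 0"
        using opposite[OF C y x0 g] opposite[OF N adj qN x0 g] by blast+
      then show ?thesis by (auto simp: zero_less_mult_iff)
    qed
    then have "y \<in> region r R q" using gy by (simp add: region_def generic_def)
    from region_eq(2)[OF gen this] show ?thesis using ry by (simp add: N_def)
  qed
  have K'N: "K' = N"
    unfolding K'_def next_chamber_def by (rule the_equality) (use N adj uniq in blast)+
  have tr: "transition r \<A> R K N = restrict f ?B"
    unfolding transition_def
  proof (rule the_equality)
    show "restrict f ?B \<in> extensional ?B \<and> bij_betw (restrict f ?B) ?B (cb N) \<and>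
      (\<exists>\<alpha>\<in>?B. adjacent r K N (perp r \<alpha>) \<and> restrict f ?B \<alpha> = - \<alpha> \<and>
        (\<forall>\<beta>\<in>?B - {\<alpha>}. \<exists>c::nat. restrict f ?B \<beta> = real c *\<^sub>R \<alpha> + \<beta>))"
    proof (intro conjI bexI[of _ \<alpha>] al adj ballI)
      show "bij_betw (restrict f ?B) ?B (cb N)"
        using f_inj f_img by (auto simp: bij_betw_def inj_on_def)
    qed (use al in \<open>auto simp: f_def\<close>)
  next
    fix g
    assume "g \<in> extensional ?B \<and> bij_betw g ?B (cb N) \<and>
      (\<exists>\<alpha>\<in>?B. adjacent r K N (perp r \<alpha>) \<and> g \<alpha> = - \<alpha> \<and>
        (\<forall>\<beta>\<in>?B - {\<alpha>}. \<exists>c::nat. g \<beta> = real c *\<^sub>R \<alpha> + \<beta>))"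
    then obtain \<alpha>' where g: "g \<in> extensional ?B" "bij_betw g ?B (cb N)" "\<alpha>' \<in> ?B"
      "adjacent r K N (perp r \<alpha>')" "g \<alpha>' = - \<alpha>'" "\<And>\<beta>. \<beta> \<in> ?B - {\<alpha>'} \<Longrightarrow> \<exists>c::nat. g \<beta> = real c *\<^sub>R \<alpha>' + \<beta>"
      by blast
    have "perp r \<alpha>' = perp r \<alpha>" using g(4) adj by (simp add: adjacent_def)
    \<comment> \<open>Were they different, the dual vector of \<alpha> would lie in the hyperplane
      of \<alpha>', which is that of \<alpha>, although it pairs to 1 with \<alpha>.\<close>
    then have "\<alpha>' = \<alpha>"
      using dual_perp[OF B g(3), of \<alpha>] pairing_dual[OF rbase_vbasis[OF B] al, of \<alpha>] by (auto simp: perp_def)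
    show "g = restrict f ?B"
    proof (rule extensionalityI[OF g(1) restrict_extensional])
      fix \<beta> assume b: "\<beta> \<in> ?B"
      show "g \<beta> = restrict f ?B \<beta>"
      proof (cases "\<beta> = \<alpha>")
        case True
        then show ?thesis using g(5) \<open>\<alpha>' = \<alpha>\<close> al by (simp add: f_def)
      next
        case False
        then obtain k :: nat where k: "g \<beta> = real k *\<^sub>R \<alpha> + \<beta>" using g(6)[of \<beta>] b \<open>\<alpha>' = \<alpha>\<close> by auto
        have gN: "g \<beta> \<in> cb N" using g(2) b by (auto simp: bij_betw_def)
        have fN: "f \<beta> \<in> cb N" using f_img b by blast
        have "g \<beta> \<noteq> - \<alpha>"
        proof
          assume "g \<beta> = - \<alpha>"
          then have "pairing r (real k *\<^sub>R \<alpha> + \<beta>) (?d \<beta>) = pairing r (- \<alpha>) (?d \<beta>)" using k by simp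
          then show False
            using False b pairing_dual[OF rbase_vbasis[OF B] al, of \<beta>] pairing_dual[OF rbase_vbasis[OF B] b, of \<beta>]
            by (simp add: pairing_simps)
        qed
        \<comment> \<open>The dual vector of \<open>g \<beta>\<close> kills \<alpha>, so it cannot
          tell \<open>f \<beta>\<close> from \<open>g \<beta>\<close>; among basis elements only
          \<open>g \<beta>\<close> pairs to 1 with it.\<close>
        then have "pairing r (- \<alpha>) (dual r (cb N) (g \<beta>)) = 0"
          using pairing_dual[OF rbase_vbasis[OF B'] ob(1), of "g \<beta>"] by simp
        then have "pairing r (f \<beta>) (dual r (cb N) (g \<beta>)) = pairing r (g \<beta>) (dual r (cb N) (g \<beta>))"
          using False by (simp add: f_def k pairing_simps)
        also have "\<dots> = 1" using pairing_dual[OF rbase_vbasis[OF B'] gN, of "g \<beta>"] by simp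
        finally have "f \<beta> = g \<beta>" using pairing_dual[OF rbase_vbasis[OF B'] fN, of "g \<beta>"] by (simp split: if_splits)
        then show ?thesis using b by simp
      qed
    qed
  qed
  show "K' \<in> chambers r \<A>" unfolding K'N by (rule N)
  show "bij_betw (transition r \<A> R K K') (cb K) (cb K')"
    unfolding K'N tr using f_inj f_img by (auto simp: bij_betw_def inj_on_def)
  show "transition r \<A> R K K' \<alpha> = - \<alpha>" unfolding K'N tr using al by (simp add: f_def)
  show "\<exists>c::nat. transition r \<A> R K K' \<beta> = real c *\<^sub>R \<alpha> + \<beta>" if "\<beta> \<in> cb K - {\<alpha>}"
    unfolding K'N tr using that by (auto simp: f_def)
qed

end

section \<open>The map \<open>\<Lambda>\<close>\<close>

locale ordered_chamber = crystallographic_roots +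
  fixes K\<^sub>0 :: "(nat \<Rightarrow> real) set" and \<alpha> :: "nat \<Rightarrow> nat \<Rightarrow> real"
  assumes K0: "K\<^sub>0 \<in> chambers r (perp r ` R)"
    and ord: "basis_ordering r (perp r ` R) R K\<^sub>0 \<alpha>"
begin

abbreviation "W \<equiv> lists {1..r}"
abbreviation "CC \<equiv> cartan_of r \<A> R K\<^sub>0 \<alpha>"
abbreviation "S \<equiv> seq_rel r \<A> R K\<^sub>0 \<alpha>"

definition Kch :: "nat list \<Rightarrow> (nat \<Rightarrow> real) set"
  where "Kch a = fst (chain r \<A> R K\<^sub>0 \<alpha> a)"

definition Lch :: "nat list \<Rightarrow> nat \<Rightarrow> (nat \<Rightarrow> real)"
  where "Lch a i = phi r \<A> R K\<^sub>0 \<alpha> a (\<alpha> i)"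

lemma Kch_snoc: "Kch (a @ [i]) = next_chamber r \<A> (Kch a) (perp r (Lch a i))"
  by (simp add: Kch_def Lch_def phi_def chain_def Let_def split_beta)

lemma Lch_snoc: "Lch (a @ [i]) j = transition r \<A> R (Kch a) (Kch (a @ [i])) (Lch a j)"
  by (simp add: Kch_def Lch_def phi_def chain_def Let_def split_beta)

lemma Lch_Nil: "Lch [] i = \<alpha> i"
  by (simp add: Lch_def phi_def chain_def)

lemma chain_invariant:
  assumes "a \<in> W"
  shows "Kch a \<in> chambers r \<A> \<and> bij_betw (Lch a) {1..r} (cb (Kch a))"
  using assms
proof (induction a rule: rev_induct)
  case Nil
  have "Kch [] = K\<^sub>0" by (simp add: Kch_def chain_def)
  moreover have "Lch [] = \<alpha>" by (rule ext) (rule Lch_Nil)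
  ultimately show ?case using K0 ord by (simp add: basis_ordering_def)
next
  case (snoc i a)
  then have i: "i \<in> {1..r}" and K: "Kch a \<in> chambers r \<A>" and bij: "bij_betw (Lch a) {1..r} (cb (Kch a))"
    by auto
  have al: "Lch a i \<in> cb (Kch a)" using bij i by (auto simp: bij_betw_def)
  note wc = wall_crossing[OF K al, folded Kch_snoc]
  have "Lch (a @ [i]) = transition r \<A> R (Kch a) (Kch (a @ [i])) \<circ> Lch a"
    by (rule ext) (simp add: Lch_snoc)
  then have "bij_betw (Lch (a @ [i])) {1..r} (cb (Kch (a @ [i])))"
    using bij_betw_trans[OF bij wc(2)] by simp
  with wc(1) show ?case by blast
qed

lemma Lch_lbase:
  assumes "a \<in> W"
  shows "lbase R {1..r} (Lch a)"
  using chain_invariant[OF assms] lbase_reindex[OF cb_lbase, of "Kch a" "Lch a" "{1..r}"] by blast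

lemma Kch_eq:
  assumes "a \<in> W"
  shows "Kch a = open_cone r (Lch a ` {1..r})"
  using chain_invariant[OF assms] cb_cone[of "Kch a"] by (simp add: bij_betw_def)

lemma Lch_step:
  assumes a: "a \<in> W" and i: "i \<in> {1..r}"
  shows "Lch (a @ [i]) i = - Lch a i"
    and "j \<in> {1..r} \<Longrightarrow> \<exists>c::int. Lch (a @ [i]) j = Lch a j - of_int c *\<^sub>R Lch a i \<and> (j = i \<longrightarrow> c = 2)"
proof -
  have K: "Kch a \<in> chambers r \<A>" and bij: "bij_betw (Lch a) {1..r} (cb (Kch a))"
    using chain_invariant[OF a] by auto
  have al: "Lch a i \<in> cb (Kch a)" using bij i by (auto simp: bij_betw_def)
  note wc = wall_crossing[OF K al, folded Kch_snoc]
  show ii: "Lch (a @ [i]) i = - Lch a i" unfolding Lch_snoc by (rule wc(3))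
  show "\<exists>c::int. Lch (a @ [i]) j = Lch a j - of_int c *\<^sub>R Lch a i \<and> (j = i \<longrightarrow> c = 2)" if j: "j \<in> {1..r}"
  proof (cases "j = i")
    case True
    then show ?thesis using ii by (intro exI[of _ 2]) (simp add: scaleR_2)
  next
    case False
    then have "Lch a j \<noteq> Lch a i" using bij i j by (auto simp: bij_betw_def dest: inj_onD)
    moreover have "Lch a j \<in> cb (Kch a)" using bij j by (auto simp: bij_betw_def)
    ultimately obtain c :: nat where "Lch (a @ [i]) j = real c *\<^sub>R Lch a i + Lch a j"
      using wc(4)[of "Lch a j"] unfolding Lch_snoc by blast
    then show ?thesis using False by (intro exI[of _ "- int c"]) simp
  qed
qed

text \<open>The relation \<open>seq_rel\<close> compares linear maps and forgets the last chamber.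
  That chamber is the open cone over the basis, so equal labelled bases still lead to equal next
  steps.\<close>

lemma Lch_determines_step:
  assumes "a \<in> W" "b \<in> W" "i \<in> {1..r}" "j \<in> {1..r}"
    and eq: "\<And>k. k \<in> {1..r} \<Longrightarrow> Lch a k = Lch b k"
  shows "Lch (a @ [i]) j = Lch (b @ [i]) j"
proof -
  have "Lch a ` {1..r} = Lch b ` {1..r}" using eq by (intro image_cong) auto
  then have "Kch a = Kch b" using Kch_eq assms(1,2) by simp
  then show ?thesis unfolding Lch_snoc Kch_snoc using eq assms(3,4) by simp
qed

text \<open>The same argument as for (C1), carried out on sequences before a realization is
  available. It makes walks reversible, which connectedness of the chain scheme requires.\<close>

lemma Lch_back:
  assumes a: "a \<in> W" and i: "i \<in> {1..r}" and j: "j \<in> {1..r}"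
  shows "Lch (a @ [i] @ [i]) j = Lch a j"
proof -
  let ?b = "a @ [i]"
  have b: "?b \<in> W" "?b @ [i] \<in> W" using a i by auto
  obtain c d :: int where c: "Lch ?b j = Lch a j - of_int c *\<^sub>R Lch a i" and cd: "j = i \<longrightarrow> c = 2"
    and d: "Lch (?b @ [i]) j = Lch ?b j - of_int d *\<^sub>R Lch ?b i" "j = i \<longrightarrow> d = 2"
    using Lch_step(2)[OF a i j] Lch_step(2)[OF b(1) i j] by blast
  have eq: "Lch (?b @ [i]) j = Lch a j + of_int (d - c) *\<^sub>R Lch a i"
    unfolding d(1) Lch_step(1)[OF a i] c by (simp add: scaleR_diff_left)
  have "d - c = 0"
  proof (cases "j = i")
    case False
    show ?thesis
      by (rule lbase_step_unique[OF Lch_lbase[OF a] Lch_lbase[OF b(2)] _ i j False _ eq])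
        (simp_all only: Lch_step(1)[OF b(1) i] Lch_step(1)[OF a i] minus_minus finite_atLeastAtMost)
  qed (use cd d in simp)
  with eq show ?thesis by simp
qed

lemma span_cb: assumes "K \<in> chambers r \<A>" shows "span (cb K) = Rn r" "independent (cb K)"
  using rbase_vbasis[OF cb_rbase[OF assms]] by (auto simp: vbasis_def)

text \<open>The basis at the starting chamber spans the dual space, so the linear extensions agree
  as soon as they agree on the ordered basis.\<close>

lemma seq_rel_iff: "(a, b) \<in> S \<longleftrightarrow> a \<in> W \<and> b \<in> W \<and> (\<forall>i\<in>{1..r}. Lch a i = Lch b i)"
proof -
  note sp = span_cb[OF K0]
  let ?E = "chain_endo r \<A> R K\<^sub>0 \<alpha>"
  have lin: "linear (?E a)" for a unfolding chain_endo_def by (rule linear_construct[OF sp(2)])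
  have ev: "?E a (\<alpha> i) = Lch a i" if "i \<in> {1..r}" for a i
    unfolding chain_endo_def Lch_def
    by (rule construct_basis[OF sp(2)]) (use ord that in \<open>auto simp: basis_ordering_def bij_betw_def\<close>)
  have img: "\<alpha> ` {1..r} = cb K\<^sub>0" using ord by (simp add: basis_ordering_def bij_betw_def)
  have "(\<forall>x\<in>Rn r. ?E a x = ?E b x) \<longleftrightarrow> (\<forall>i\<in>{1..r}. Lch a i = Lch b i)"
  proof
    assume *: "\<forall>x\<in>Rn r. ?E a x = ?E b x"
    show "\<forall>i\<in>{1..r}. Lch a i = Lch b i"
    proof
      fix i assume i: "i \<in> {1..r}"
      then have "\<alpha> i \<in> Rn r" using img sp(1) span_base by blast
      with * ev[OF i] show "Lch a i = Lch b i" by metis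
    qed
  next
    assume *: "\<forall>i\<in>{1..r}. Lch a i = Lch b i"
    show "\<forall>x\<in>Rn r. ?E a x = ?E b x"
    proof
      fix x assume "x \<in> Rn r"
      then have "x \<in> span (cb K\<^sub>0)" using sp(1) by simp
      moreover have "?E a v = ?E b v" if v: "v \<in> cb K\<^sub>0" for v
      proof -
        obtain i where i: "i \<in> {1..r}" "v = \<alpha> i" using v img by blast
        then show ?thesis using * ev[OF i(1)] by simp
      qed
      ultimately show "?E a x = ?E b x"
        by (rule linear_eq_on_span[OF lin lin, rotated])
    qed
  qed
  then show ?thesis unfolding seq_rel_def by blast
qed

lemma equiv_S: "equiv W S"
proof (rule equivI)
  show "S \<subseteq> W \<times> W" "refl_on W S" "sym S" "trans S"
    by (auto simp: seq_rel_iff refl_on_def sym_def trans_def)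
qed

lemma in_class: "a \<in> W \<Longrightarrow> b \<in> S `` {a} \<longleftrightarrow> b \<in> W \<and> (\<forall>i\<in>{1..r}. Lch a i = Lch b i)"
  by (auto simp: seq_rel_iff)

lemma class_eq: "a \<in> W \<Longrightarrow> b \<in> W \<Longrightarrow> S `` {a} = S `` {b} \<longleftrightarrow> (\<forall>i\<in>{1..r}. Lch a i = Lch b i)"
  by (subst eq_equiv_class_iff[OF equiv_S]) (auto simp: seq_rel_iff)

lemma objs_iff: "X \<in> objs CC \<longleftrightarrow> (\<exists>a\<in>W. X = S `` {a})"
  by (auto simp: cartan_of_def quotient_def)

lemma idx_CC: "idx CC = {1..r}"
  by (simp add: cartan_of_def)

lemma rho_class:
  assumes a: "a \<in> W" and i: "i \<in> {1..r}"
  shows "rho CC i (S `` {a}) = S `` {a @ [i]}"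
proof -
  have const: "S `` {b @ [i]} = S `` {a @ [i]}" if "b \<in> S `` {a}" for b
  proof -
    have b: "b \<in> W" "\<forall>i\<in>{1..r}. Lch a i = Lch b i" using that in_class[OF a] by auto
    then show ?thesis using a i Lch_determines_step[OF a b(1) i] by (subst class_eq) auto
  qed
  have self: "a \<in> S `` {a}" using a in_class[OF a] by auto
  have "rho CC i (S `` {a}) = (\<Union>b\<in>S `` {a}. S `` {b @ [i]})"
    by (simp only: cartan_of_def cartan_data.simps)
  also have "\<dots> = S `` {a @ [i]}"
    by (rule UN_constant_eq[OF self]) (intro ballI const)
  finally show ?thesis .
qed

text \<open>The description of the entry is unique because \<open>Lch a i\<close> is nonzero, and
  independent of the representative because a labelled basis determines the next one.\<close>

lemma cart_class:
  assumes a: "a \<in> W" and i: "i \<in> {1..r}" and j: "j \<in> {1..r}"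
  shows "Lch (a @ [i]) j = Lch a j - of_int (cart CC (S `` {a}) i j) *\<^sub>R Lch a i"
    and "cart CC (S `` {a}) i i = 2"
proof -
  have nz: "Lch a i \<noteq> 0" using lbase_in[OF Lch_lbase[OF a] i] zero_notin by auto
  have main: "cart CC (S `` {a}) i j = c"
    if j: "j \<in> {1..r}" and c: "Lch (a @ [i]) j = Lch a j - of_int c *\<^sub>R Lch a i" for j c
    unfolding cartan_of_def cartan_data.simps Lch_def[symmetric]
  proof (rule the_equality)
    have "a \<in> S `` {a}" using a in_class[OF a] by auto
    then show "\<exists>b\<in>S `` {a}. Lch (b @ [i]) j = - (of_int c *\<^sub>R Lch b i) + Lch b j"
      using c by (intro bexI[of _ a]) simp_all
    fix c' assume "\<exists>b\<in>S `` {a}. Lch (b @ [i]) j = - (of_int c' *\<^sub>R Lch b i) + Lch b j"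
    then obtain b where b: "b \<in> S `` {a}" "Lch (b @ [i]) j = - (of_int c' *\<^sub>R Lch b i) + Lch b j" by blast
    then have bW: "b \<in> W" and eq: "\<And>k. k \<in> {1..r} \<Longrightarrow> Lch a k = Lch b k" using in_class[OF a] by auto
    have "Lch (a @ [i]) j = - (of_int c' *\<^sub>R Lch a i) + Lch a j"
      using b(2) Lch_determines_step[OF a bW i j eq] eq[OF i] eq[OF j] by simp
    then have "(of_int c - of_int c') *\<^sub>R Lch a i = 0" unfolding c by (auto simp: scaleR_diff_left)
    then show "c' = c" using nz by simp
  qed
  obtain c :: int where "Lch (a @ [i]) j = Lch a j - of_int c *\<^sub>R Lch a i"
    using Lch_step(2)[OF a i j] by blast
  with main[OF j this] show "Lch (a @ [i]) j = Lch a j - of_int (cart CC (S `` {a}) i j) *\<^sub>R Lch a i" by simp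
  have "Lch (a @ [i]) i = Lch a i - of_int 2 *\<^sub>R Lch a i" using Lch_step(1)[OF a i] by (simp add: scaleR_2)
  from main[OF i this] show "cart CC (S `` {a}) i i = 2" .
qed

definition Lobj :: "nat list set \<Rightarrow> nat \<Rightarrow> (nat \<Rightarrow> real)"
  where "Lobj X = Lch (SOME a. a \<in> X)"

lemma Lobj_class:
  assumes "a \<in> W" "i \<in> {1..r}"
  shows "Lobj (S `` {a}) i = Lch a i"
proof -
  have "a \<in> S `` {a}" using assms(1) in_class[OF assms(1)] by auto
  then have "(SOME b. b \<in> S `` {a}) \<in> S `` {a}" by (rule someI)
  then show ?thesis unfolding Lobj_def using in_class[OF assms(1)] assms(2) by simp
qed

lemma walk_class:
  assumes "w \<in> W" "a \<in> W"
  shows "walk CC (S `` {a}) w = S `` {a @ w}"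
  using assms(1)
proof (induction w rule: rev_induct)
  case (snoc i w)
  then show ?case using rho_class[of "a @ w" i] assms(2) by simp
qed simp

lemma walk_back:
  assumes "w \<in> W" "a \<in> W"
  shows "walk CC (S `` {a @ w}) (rev w) = S `` {a}"
  using assms(1)
proof (induction w rule: rev_induct)
  case (snoc i w)
  then have i: "i \<in> {1..r}" and w: "w \<in> W" and aw: "a @ w \<in> W" using assms(2) by auto
  have "rho CC i (S `` {a @ w @ [i]}) = S `` {(a @ w) @ [i] @ [i]}"
    using rho_class[of "(a @ w) @ [i]" i] aw i by simp
  also have "\<dots> = S `` {a @ w}"
    using Lch_back[OF aw i] aw i by (subst class_eq) auto
  finally show ?case using snoc.IH[OF w] by simp
qed simp

text \<open>Injectivity holds by construction of the classes. The Cartan axioms and the root system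
  axioms then come from the general theory of realizations.\<close>

theorem chain_realization: "realization CC Lobj R"
proof
  show "finite (idx CC)" "idx CC \<noteq> {}" using r_pos by (simp_all add: idx_CC)
  show "objs CC \<noteq> {}" using objs_iff[of "S `` {[]}"] by auto
  show "finite R" by (rule finite_R)
  show "- \<alpha> \<in> R" if "\<alpha> \<in> R" for \<alpha> by (rule sym_R[OF that])
  show "t = 1 \<or> t = -1" if "\<alpha> \<in> R" "t *\<^sub>R \<alpha> \<in> R" for \<alpha> t by (rule reduced[OF that])
next
  fix X i assume "i \<in> idx CC" "X \<in> objs CC"
  then obtain a where a: "a \<in> W" "X = S `` {a}" "i \<in> {1..r}" by (auto simp: idx_CC objs_iff)
  then have "a @ [i] \<in> W" by auto
  then show "rho CC i X \<in> objs CC" unfolding objs_iff a(2) rho_class[OF a(1,3)] by blast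
next
  fix X assume "X \<in> objs CC"
  then obtain a where a: "a \<in> W" "X = S `` {a}" by (auto simp: objs_iff)
  have "lbase R {1..r} (Lobj X) = lbase R {1..r} (Lch a)"
    unfolding a(2) by (rule lbase_cong) (rule Lobj_class[OF a(1)])
  then show "lbase R (idx CC) (Lobj X)" unfolding idx_CC using Lch_lbase[OF a(1)] by blast
next
  fix X i j assume "X \<in> objs CC" "i \<in> idx CC" "j \<in> idx CC"
  then obtain a where a: "a \<in> W" "X = S `` {a}" "i \<in> {1..r}" "j \<in> {1..r}" by (auto simp: idx_CC objs_iff)
  then have ai: "a @ [i] \<in> W" by auto
  show "Lobj (rho CC i X) j = Lobj X j - of_int (cart CC X i j) *\<^sub>R Lobj X i"
    unfolding a(2) rho_class[OF a(1,3)] Lobj_class[OF ai a(4)] Lobj_class[OF a(1,3)] Lobj_class[OF a(1,4)]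
    by (rule cart_class(1)[OF a(1,3,4)])
next
  fix X i assume "X \<in> objs CC" "i \<in> idx CC"
  then obtain a where a: "a \<in> W" "X = S `` {a}" "i \<in> {1..r}" by (auto simp: idx_CC objs_iff)
  show "cart CC X i i = 2" unfolding a(2) by (rule cart_class(2)[OF a(1,3,3)])
next
  fix X Y assume "X \<in> objs CC" "Y \<in> objs CC"
  then obtain a b where ab: "a \<in> W" "X = S `` {a}" "b \<in> W" "Y = S `` {b}" by (auto simp: objs_iff)
  have "walk CC (walk CC X (rev a)) b = Y"
    using walk_back[of a "[]"] walk_class[of b "[]"] ab by simp
  moreover have "rev a @ b \<in> lists (idx CC)" using ab by (auto simp: idx_CC)
  ultimately show "\<exists>w\<in>lists (idx CC). Y = walk CC X w" by (metis walk_append)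
next
  fix X Y assume "X \<in> objs CC" "Y \<in> objs CC" and eq: "\<And>i. i \<in> idx CC \<Longrightarrow> Lobj X i = Lobj Y i"
  then obtain a b where ab: "a \<in> W" "X = S `` {a}" "b \<in> W" "Y = S `` {b}" by (auto simp: objs_iff)
  then have "\<forall>i\<in>{1..r}. Lch a i = Lch b i" using eq Lobj_class by (simp add: idx_CC)
  then show "X = Y" using ab class_eq by simp
qed

end

section \<open>Arrangements and schemes compared through their roots\<close>

lemma cartan_of_realization:
  assumes "crystallographic r \<A> R" "K \<in> chambers r \<A>" "basis_ordering r \<A> R K \<alpha>"
  shows "\<exists>L. realization (cartan_of r \<A> R K \<alpha>) L R" and "span R = Rn r"
proof -
  interpret reduced_roots r R by (rule crystallographic_reduced_roots(1)[OF assms(1)])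
  have A: "\<A> = perp r ` R" by (rule crystallographic_reduced_roots(2)[OF assms(1)])
  interpret ordered_chamber r R K \<alpha>
    by standard (use assms in \<open>simp_all only: A\<close>)
  show "\<exists>L. realization (cartan_of r \<A> R K \<alpha>) L R" unfolding A using chain_realization by blast
  show "span R = Rn r"
    using span_lbase[OF cb_lbase[OF K0]] span_cb[OF K0] by simp
qed

lemma basis_ordering_exists:
  assumes "crystallographic r \<A> R" "K \<in> chambers r \<A>"
  shows "\<exists>\<alpha>. basis_ordering r \<A> R K \<alpha>"
proof -
  interpret reduced_roots r R by (rule crystallographic_reduced_roots(1)[OF assms(1)])
  note vb = rbase_vbasis[OF crystallographic_chamber(1)[OF assms]]
  show ?thesis
    using ex_bij_betw_nat_finite_1[of "chamber_basis r \<A> R K"] vb card_vbasis[OF vb]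
    by (auto simp: basis_ordering_def vbasis_def)
qed

lemma arrangement_equiv_if_cartan_equiv:
  assumes "realization C L R" "span R = Rn (card (idx C))"
    and "realization C' L' R'" "span R' = Rn (card (idx C'))" and "cartan_equiv C C'"
  shows "arrangement_equiv (card (idx C), \<A>, R) (card (idx C'), \<A>', R')"
  using equiv_realizations_isomorphic[OF assms(1,3,5)] assms(2,4)
  unfolding arrangement_equiv_iff linear_iso_def by metis

lemma cartan_equiv_if_arrangement_equiv:
  assumes "realization C L R" "span R = Rn r" and "realization C' L' R'"
    and "arrangement_equiv (r, \<A>, R) (r', \<A>', R')"
  shows "cartan_equiv C C'"
proof -
  obtain \<psi> where "linear \<psi>" "inj_on \<psi> (span R)" "\<psi> ` R = R'"
    using assms(2,4) unfolding arrangement_equiv_iff linear_iso_def bij_betw_def by metis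
  with isomorphic_realizations_equiv[of C L R C' L' \<psi>] assms(1,3) show ?thesis by blast
qed

lemma card_idx_cartan_of: "card (idx (cartan_of r \<A> R K \<alpha>)) = r"
  by (simp add: cartan_of_def)

lemma cartan_of_in_class:
  assumes "crystallographic r \<A> R" "K \<in> chambers r \<A>" "basis_ordering r \<A> R K \<alpha>"
  shows "cartan_of r \<A> R K \<alpha> \<in> cartan_class"
  using cartan_of_realization(1)[OF assms] realization.in_cartan_class by blast

text \<open>For every chamber and every ordering the scheme is realized by the same set
  \<open>R\<close>, so both choices drop out of the comparison.\<close>

lemma cartan_of_equiv_iff:
  assumes "crystallographic r \<A> R" "K \<in> chambers r \<A>" "basis_ordering r \<A> R K \<alpha>"
    and "crystallographic r' \<A>' R'" "K' \<in> chambers r' \<A>'" "basis_ordering r' \<A>' R' K' \<alpha>'"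
  shows "cartan_equiv (cartan_of r \<A> R K \<alpha>) (cartan_of r' \<A>' R' K' \<alpha>')
    \<longleftrightarrow> arrangement_equiv (r, \<A>, R) (r', \<A>', R')"
proof -
  obtain L where L: "realization (cartan_of r \<A> R K \<alpha>) L R" "span R = Rn r"
    using cartan_of_realization[OF assms(1-3)] by blast
  obtain L' where L': "realization (cartan_of r' \<A>' R' K' \<alpha>') L' R'" "span R' = Rn r'"
    using cartan_of_realization[OF assms(4-6)] by blast
  show ?thesis
    using arrangement_equiv_if_cartan_equiv[OF L(1) _ L'(1), unfolded card_idx_cartan_of, OF L(2) L'(2)]
      cartan_equiv_if_arrangement_equiv[OF L L'(1)] by blast
qed

text \<open>The roots of any realization of \<open>C\<close> form the arrangement. Existence serves
  the surjectivity of \<open>Lambda\<close>; the free index and object types let the uniqueness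
  claim cover schemes outside the type on which \<open>Lambda\<close> is defined.\<close>

lemma cartan_class_arrangement:
  fixes C :: "('i, 'a) cartan_data"
  assumes "C \<in> cartan_class"
  shows "\<exists>r \<A> R. crystallographic r \<A> R \<and>
    (\<exists>K\<in>chambers r \<A>. \<exists>\<alpha>. basis_ordering r \<A> R K \<alpha> \<and> cartan_equiv C (cartan_of r \<A> R K \<alpha>)) \<and>
    (\<forall>r' \<A>' R'. crystallographic r' \<A>' R' \<and>
      (\<exists>K'\<in>chambers r' \<A>'. \<exists>\<alpha>'. basis_ordering r' \<A>' R' K' \<alpha>' \<and> cartan_equiv C (cartan_of r' \<A>' R' K' \<alpha>'))
      \<longrightarrow> arrangement_equiv (r, \<A>, R) (r', \<A>', R'))"
proof -
  let ?r = "card (idx C)"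
  obtain L R where L: "realization C L R" "span R = Rn ?r" "?r \<ge> 1"
    using cartan_class_realizable[OF assms] by blast
  let ?A = "perp ?r ` R"
  have cr: "crystallographic ?r ?A R" by (rule realization_crystallographic[OF L])
  obtain K where K: "K \<in> chambers ?r ?A" using chambers_nonempty[OF cr] by blast
  obtain \<alpha> where al: "basis_ordering ?r ?A R K \<alpha>" using basis_ordering_exists[OF cr K] by blast
  obtain L' where L': "realization (cartan_of ?r ?A R K \<alpha>) L' R" using cartan_of_realization(1)[OF cr K al] by blast
  have ce: "cartan_equiv C (cartan_of ?r ?A R K \<alpha>)"
    by (rule cartan_equiv_if_arrangement_equiv[OF L(1,2) L' arrangement_equiv_refl])
  have "arrangement_equiv (?r, ?A, R) (r', \<A>', R')"
    if that': "crystallographic r' \<A>' R'" "K' \<in> chambers r' \<A>'" "basis_ordering r' \<A>' R' K' \<alpha>'"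
      "cartan_equiv C (cartan_of r' \<A>' R' K' \<alpha>')" for r' \<A>' R' K' \<alpha>'
  proof -
    obtain L'' where L'': "realization (cartan_of r' \<A>' R' K' \<alpha>') L'' R'" "span R' = Rn r'"
      using cartan_of_realization[OF that'(1-3)] by blast
    from arrangement_equiv_if_cartan_equiv[OF L(1,2) L''(1) _ that'(4), unfolded card_idx_cartan_of, OF L''(2)]
    show ?thesis .
  qed
  with cr K al ce show ?thesis by blast
qed

lemma Lambda_class:
  assumes X: "X \<in> arrangement_class // arrangement_rel" and XY: "(r, \<A>, R) \<in> X"
    and K: "K \<in> chambers r \<A>" and al: "basis_ordering r \<A> R K \<alpha>"
  shows "Lambda X = cartan_rel `` {cartan_of r \<A> R K \<alpha>}"
proof -
  have rel: "((r, \<A>, R), Y) \<in> arrangement_rel" if "Y \<in> X" for Y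
    using quotient_eq_iff[OF equiv_arrangement_rel X X XY that] by simp
  have cr: "crystallographic r \<A> R"
    using rel[OF XY] by (simp add: arrangement_rel_def arrangement_class_def)
  have same: "cartan_rel `` {cartan_of r' \<A>' R' K' \<alpha>'} = cartan_rel `` {cartan_of r \<A> R K \<alpha>}"
    if "(r', \<A>', R') \<in> X" "K' \<in> chambers r' \<A>'" "basis_ordering r' \<A>' R' K' \<alpha>'" for r' \<A>' R' K' \<alpha>'
  proof -
    have cr': "crystallographic r' \<A>' R'" and eq: "arrangement_equiv (r, \<A>, R) (r', \<A>', R')"
      using rel[OF that(1)] by (simp_all add: arrangement_rel_def arrangement_class_def)
    have "cartan_equiv (cartan_of r \<A> R K \<alpha>) (cartan_of r' \<A>' R' K' \<alpha>')"
      using cartan_of_equiv_iff[OF cr K al cr' that(2,3)] eq by simp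
    then have "(cartan_of r \<A> R K \<alpha>, cartan_of r' \<A>' R' K' \<alpha>') \<in> cartan_rel"
      unfolding cartan_rel_def using cartan_of_in_class[OF cr K al] cartan_of_in_class[OF cr' that(2,3)] by blast
    from equiv_class_eq[OF equiv_cartan_rel this] show ?thesis by simp
  qed
  show ?thesis
  proof (intro equalityI subsetI)
    fix x assume "x \<in> Lambda X"
    then obtain r' \<A>' R' K' \<alpha>' where "(r', \<A>', R') \<in> X" "K' \<in> chambers r' \<A>'" "basis_ordering r' \<A>' R' K' \<alpha>'"
      "x \<in> cartan_rel `` {cartan_of r' \<A>' R' K' \<alpha>'}" unfolding Lambda_def by blast
    with same show "x \<in> cartan_rel `` {cartan_of r \<A> R K \<alpha>}" by blast
  next
    fix x assume "x \<in> cartan_rel `` {cartan_of r \<A> R K \<alpha>}"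
    then show "x \<in> Lambda X" unfolding Lambda_def using XY K al by blast
  qed
qed

lemma arrangement_class_member:
  assumes "X \<in> arrangement_class // arrangement_rel"
  obtains r \<A> R K \<alpha> where "(r, \<A>, R) \<in> X" "crystallographic r \<A> R" "K \<in> chambers r \<A>" "basis_ordering r \<A> R K \<alpha>"
    "X = arrangement_rel `` {(r, \<A>, R)}"
proof -
  from assms obtain Y where Y: "Y \<in> arrangement_class" "X = arrangement_rel `` {Y}" by (rule quotientE)
  obtain r \<A> R where eq: "Y = (r, \<A>, R)" by (rule prod_cases3)
  have cr: "crystallographic r \<A> R" using Y(1) eq by (simp add: arrangement_class_def)
  have "Y \<in> X" using equiv_class_self[OF equiv_arrangement_rel Y(1)] Y(2) by simp
  moreover obtain K where "K \<in> chambers r \<A>" using chambers_nonempty[OF cr] by blast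
  moreover obtain \<alpha> where "basis_ordering r \<A> R K \<alpha>" using basis_ordering_exists[OF cr calculation(2)] by blast
  ultimately show ?thesis using that cr Y(2) unfolding eq by blast
qed

lemma bij_Lambda:
  "bij_betw Lambda (arrangement_class // arrangement_rel) (cartan_class // cartan_rel)"
  unfolding bij_betw_def
proof
  show "inj_on Lambda (arrangement_class // arrangement_rel)"
  proof (rule inj_onI)
    fix X Y assume X: "X \<in> arrangement_class // arrangement_rel" and Y: "Y \<in> arrangement_class // arrangement_rel"
      and eq: "Lambda X = Lambda Y"
    obtain r \<A> R K \<alpha> where x: "(r, \<A>, R) \<in> X" "crystallographic r \<A> R" "K \<in> chambers r \<A>"
      "basis_ordering r \<A> R K \<alpha>" "X = arrangement_rel `` {(r, \<A>, R)}"
      by (rule arrangement_class_member[OF X])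
    obtain r' \<A>' R' K' \<alpha>' where y: "(r', \<A>', R') \<in> Y" "crystallographic r' \<A>' R'" "K' \<in> chambers r' \<A>'"
      "basis_ordering r' \<A>' R' K' \<alpha>'" "Y = arrangement_rel `` {(r', \<A>', R')}"
      by (rule arrangement_class_member[OF Y])
    have "cartan_rel `` {cartan_of r \<A> R K \<alpha>} = cartan_rel `` {cartan_of r' \<A>' R' K' \<alpha>'}"
      using eq Lambda_class[OF X x(1,3,4)] Lambda_class[OF Y y(1,3,4)] by simp
    then have "(cartan_of r \<A> R K \<alpha>, cartan_of r' \<A>' R' K' \<alpha>') \<in> cartan_rel"
      using eq_equiv_class[OF _ equiv_cartan_rel] cartan_of_in_class[OF y(2-4)] by blast
    then have "arrangement_equiv (r, \<A>, R) (r', \<A>', R')"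
      using cartan_of_equiv_iff[OF x(2-4) y(2-4)] by (simp add: cartan_rel_def)
    then have "((r, \<A>, R), (r', \<A>', R')) \<in> arrangement_rel"
      using x(2) y(2) by (simp add: arrangement_rel_def arrangement_class_def)
    from equiv_class_eq[OF equiv_arrangement_rel this] show "X = Y" using x(5) y(5) by simp
  qed
  show "Lambda ` (arrangement_class // arrangement_rel) = cartan_class // cartan_rel"
  proof (intro equalityI subsetI)
    fix Z assume "Z \<in> Lambda ` (arrangement_class // arrangement_rel)"
    then obtain X where X: "X \<in> arrangement_class // arrangement_rel" "Z = Lambda X" by blast
    obtain r \<A> R K \<alpha> where x: "(r, \<A>, R) \<in> X" "crystallographic r \<A> R" "K \<in> chambers r \<A>"
      "basis_ordering r \<A> R K \<alpha>" by (rule arrangement_class_member[OF X(1)])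
    show "Z \<in> cartan_class // cartan_rel"
      unfolding X(2) Lambda_class[OF X(1) x(1,3,4)] by (rule quotientI[OF cartan_of_in_class[OF x(2-4)]])
  next
    fix Z :: "(nat, nat list set) cartan_data set" assume "Z \<in> cartan_class // cartan_rel"
    then obtain C where C: "C \<in> cartan_class" "Z = cartan_rel `` {C}" by (rule quotientE)
    obtain r \<A> R K \<alpha> where x: "crystallographic r \<A> R" "K \<in> chambers r \<A>" "basis_ordering r \<A> R K \<alpha>"
      "cartan_equiv C (cartan_of r \<A> R K \<alpha>)" using cartan_class_arrangement[OF C(1)] by blast
    let ?X = "arrangement_rel `` {(r, \<A>, R)}"
    have cl: "(r, \<A>, R) \<in> arrangement_class" using x(1) by (simp add: arrangement_class_def)
    have X: "?X \<in> arrangement_class // arrangement_rel" by (rule quotientI[OF cl])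
    have "(r, \<A>, R) \<in> ?X" by (rule equiv_class_self[OF equiv_arrangement_rel cl])
    then have "Lambda ?X = cartan_rel `` {cartan_of r \<A> R K \<alpha>}" by (rule Lambda_class[OF X _ x(2,3)])
    moreover have "(C, cartan_of r \<A> R K \<alpha>) \<in> cartan_rel"
      using x(4) C(1) cartan_of_in_class[OF x(1-3)] by (simp add: cartan_rel_def)
    ultimately have "Z = Lambda ?X" using equiv_class_eq[OF equiv_cartan_rel] C(2) by simp
    then show "Z \<in> Lambda ` (arrangement_class // arrangement_rel)" using X by blast
  qed
qed

lemma roots_are_real_roots:
  assumes cr: "crystallographic r \<A> R"
  shows "\<exists>(C :: (nat, nat list set) cartan_data) a (f :: (nat \<Rightarrow> real) \<Rightarrow> (nat \<Rightarrow> real)).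
     cartan_scheme C \<and> connected_scheme C \<and> a \<in> objs C \<and>
     linear_iso (Rn r) {x. \<forall>i. i \<notin> idx C \<longrightarrow> x i = 0} f \<and>
     f ` R = (\<lambda>x i. real_of_int (x i)) ` real_roots C a"
proof -
  obtain K where K: "K \<in> chambers r \<A>" using chambers_nonempty[OF cr] by blast
  obtain \<alpha> where al: "basis_ordering r \<A> R K \<alpha>" using basis_ordering_exists[OF cr K] by blast
  let ?C = "cartan_of r \<A> R K \<alpha>"
  obtain L where L: "realization ?C L R" and sp: "span R = Rn r" using cartan_of_realization[OF cr K al] by blast
  interpret realization ?C L R by (rule L)
  interpret Q: reduced_roots r R by (rule crystallographic_reduced_roots(1)[OF cr])
  obtain a where a: "a \<in> objs ?C" using objs_ne by blast
  let ?B = "L a ` I"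
  have inj: "inj_on (L a) I" by (rule lbase_inj[OF base[OF a] finite_idx])
  have vb: "vbasis r ?B" using Q.rbase_vbasis[OF Q.lbase_rbase(1)[OF base[OF a] finite_idx sp]] .
  \<comment> \<open>\<open>f\<close> takes coordinates in the basis at \<open>a\<close> and
    \<open>g\<close> recombines them. Real roots at \<open>a\<close> are the integer coordinate
    vectors of elements of \<open>R\<close>.\<close>
  define f where "f = (\<lambda>\<gamma> i. if i \<in> I then pairing r \<gamma> (dual r ?B (L a i)) else 0)"
  define g where "g = (\<lambda>x::nat \<Rightarrow> real. \<Sum>i\<in>I. x i *\<^sub>R L a i)"
  let ?RI = "{x :: nat \<Rightarrow> real. \<forall>i. i \<notin> I \<longrightarrow> x i = 0}"
  have lin: "linear f" unfolding f_def
    by (rule linearI) (auto simp: fun_eq_iff pairing_simps scaleR_fun_apply)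
  have LR: "L a i \<in> Rn r" if "i \<in> I" for i using vbasis_sub[OF vb] that by blast
  have gf: "g (f \<gamma>) = \<gamma>" if "\<gamma> \<in> Rn r" for \<gamma>
    using expand_basis[OF vb that] unfolding g_def f_def by (simp add: sum.reindex[OF inj] cong: sum.cong)
  have fg: "f (g x) = x" if "x \<in> ?RI" for x
  proof
    fix i show "f (g x) i = x i"
    proof (cases "i \<in> I")
      case True
      have d: "pairing r (L a k) (dual r ?B (L a i)) = (if k = i then 1 else 0)" if "k \<in> I" for k
        using pairing_dual[OF vb, of "L a k" "L a i"] inj that True by (auto dest: inj_onD)
      show ?thesis unfolding f_def g_def using True finite_idx
        by (simp add: pairing_sum_left pairing_simps d if_distrib[of "(*) _"] cong: if_cong)
    qed (use that in \<open>simp add: f_def\<close>)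
  qed
  have iso: "linear_iso (Rn r) ?RI f"
    unfolding linear_iso_def
  proof (intro conjI lin)
    show "bij_betw f (Rn r) ?RI"
      by (rule bij_betw_byWitness[where f' = g])
        (use gf fg LR in \<open>auto simp: f_def g_def intro!: Rn_closed\<close>)
  qed
  have gval: "g (\<lambda>i. real_of_int (x i)) = val a x" for x by (simp add: g_def comb_def)
  have "f ` R = (\<lambda>x i. real_of_int (x i)) ` real_roots ?C a"
  proof (intro equalityI subsetI)
    fix y assume "y \<in> f ` R"
    then obtain \<gamma> where g: "\<gamma> \<in> R" "y = f \<gamma>" by blast
    let ?x = "\<lambda>i. if i \<in> I then co a \<gamma> i else 0"
    have x: "?x \<in> int_lattice I" by (simp add: int_lattice_def)
    have v: "val a ?x = \<gamma>" using crd_sum[OF base[OF a] g(1)] by (simp add: comb_def cong: sum.cong)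
    then have "?x \<in> real_roots ?C a" unfolding real_roots_eq[OF a] using x g by simp
    moreover have "f (val a ?x) = (\<lambda>i. real_of_int (?x i))"
      unfolding gval[symmetric] by (rule fg) simp
    then have "y = (\<lambda>i. real_of_int (?x i))" unfolding v g(2)[symmetric] .
    ultimately show "y \<in> (\<lambda>x i. real_of_int (x i)) ` real_roots ?C a"
      by (intro image_eqI[where x = ?x])
  next
    fix y assume "y \<in> (\<lambda>x i. real_of_int (x i)) ` real_roots ?C a"
    then obtain x where x: "x \<in> int_lattice I" "val a x \<in> R" "y = (\<lambda>i. real_of_int (x i))"
      unfolding real_roots_eq[OF a] by blast
    have "f (val a x) = y" unfolding gval[symmetric] x(3) by (rule fg) (use x(1) in \<open>simp add: int_lattice_def\<close>)
    then show "y \<in> f ` R" using x(2) by blast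
  qed
  then show ?thesis using is_cartan_scheme is_connected a iso by blast
qed

theorem theorem1p1:
  shows
    "(\<forall>r \<A> R. crystallographic r \<A> R \<longrightarrow>
        chambers r \<A> \<noteq> {} \<and>
        (\<forall>K\<in>chambers r \<A>. (\<exists>\<alpha>. basis_ordering r \<A> R K \<alpha>) \<and>
           (\<forall>\<alpha>. basis_ordering r \<A> R K \<alpha> \<longrightarrow> cartan_of r \<A> R K \<alpha> \<in> cartan_class)))
     \<and> (\<forall>X \<in> arrangement_class // arrangement_rel. \<forall>r \<A> R. (r, \<A>, R) \<in> X \<longrightarrow>
        (\<forall>K\<in>chambers r \<A>. \<forall>\<alpha>. basis_ordering r \<A> R K \<alpha> \<longrightarrow>
           Lambda X = cartan_rel `` {cartan_of r \<A> R K \<alpha>}))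
     \<and> bij_betw Lambda
        (arrangement_class // arrangement_rel)
        (cartan_class // cartan_rel)
     \<and> (\<forall>r \<A> R. crystallographic r \<A> R \<longrightarrow>
        (\<exists>(C :: (nat, nat list set) cartan_data) a (f :: (nat \<Rightarrow> real) \<Rightarrow> (nat \<Rightarrow> real)).
           cartan_scheme C \<and> connected_scheme C \<and> a \<in> objs C \<and>
           linear_iso (Rn r) {x. \<forall>i. i \<notin> idx C \<longrightarrow> x i = 0} f \<and>
           f ` R = (\<lambda>x i. real_of_int (x i)) ` real_roots C a))
     \<and> (\<forall>C :: ('i, 'a) cartan_data. C \<in> cartan_class \<longrightarrow>
        (\<exists>r \<A> R. crystallographic r \<A> R \<and>
           (\<exists>K\<in>chambers r \<A>. \<exists>\<alpha>. basis_ordering r \<A> R K \<alpha> \<and>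
              cartan_equiv C (cartan_of r \<A> R K \<alpha>)) \<and>
           (\<forall>r' \<A>' R'. crystallographic r' \<A>' R' \<and>
              (\<exists>K'\<in>chambers r' \<A>'. \<exists>\<alpha>'. basis_ordering r' \<A>' R' K' \<alpha>' \<and>
                 cartan_equiv C (cartan_of r' \<A>' R' K' \<alpha>')) \<longrightarrow>
              arrangement_equiv (r, \<A>, R) (r', \<A>', R'))))"
proof (intro conjI)
  show "\<forall>r \<A> R. crystallographic r \<A> R \<longrightarrow>
        chambers r \<A> \<noteq> {} \<and>
        (\<forall>K\<in>chambers r \<A>. (\<exists>\<alpha>. basis_ordering r \<A> R K \<alpha>) \<and>
           (\<forall>\<alpha>. basis_ordering r \<A> R K \<alpha> \<longrightarrow> cartan_of r \<A> R K \<alpha> \<in> cartan_class))"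
    by (intro allI impI conjI ballI chambers_nonempty basis_ordering_exists cartan_of_in_class)
qed (intro ballI allI impI Lambda_class bij_Lambda roots_are_real_roots cartan_class_arrangement; assumption)+

end
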